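(* Let $\lambda=(\lambda_1,\lambda_2)\in P^+$ and $N\in\mathbb Z_{\ge0}$. Let $\lambda_2=qN+m$, $0\le m<N$, be the Euclidean division of $\lambda_2$ by $N$. (a) If $N\ge\lambda_2$, then $W(\lambda,N)\cong W(\lambda)$. (b) If $N<\lambda_2$, then $\dim W(\lambda,N)=4^Nq^{N-m}(q+1)^m$. (c) If $N<\lambda_2$, then $$\mathrm{ch}\,W(\lambda,N)=e^{(\lambda_1,0)}\,\frac{\left(\mathrm{ch}\,\Lambda(\mathfrak g_{-1})\right)^N}{\left(e^{(0,1)}-e^{(0,-1)}\right)^N}\left(e^{(0,q)}-e^{(0,-q)}\right)^{N-m}\left(e^{(0,q-1)}-e^{(0,1-q)}\right)^m.$$
   Context: All vector spaces are over $\mathbb C$. $\mathfrak g=\mathfrak{sl}(1|2)$ is the Lie superalgebra of $3\times 3$ complex matrices $A=(a_{ij})$ with $a_{11}-a_{22}-a_{33}=0$; the even part consists of block-diagonal matrices (blocks of size $1$ and $2$), the odd part of block-off-diagonal matrices, and $[A,B]=AB-(-1)^{\bar i\bar j}BA$ for $A,B$ of parity $\bar i,\bar j$. Let $E_{i,j}$ be the matrix units, $x_1=E_{1,2}$, $x_2=E_{2,3}$, $x_3=E_{1,3}$, $y_i=x_i^t$ (transpose), $h_1=E_{1,1}+E_{2,2}$, $h_2=E_{2,2}-E_{3,3}$, $\mathfrak h=\mathrm{span}\{h_1,h_2\}$, $\mathfrak n^+=\mathrm{span}\{y_1,x_2,x_3\}$, $\mathfrak g_{-1}=\mathrm{span}\{y_1,y_3\}$.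 A weight $\lambda\in\mathfrak h^*$ is identified with $(\lambda_1,\lambda_2)=(\lambda(h_1),\lambda(h_2))$, and $P^+=\{\lambda\in\mathfrak h^*\mid\lambda_2\in\mathbb Z_{\ge1}\}\cup\{0\}$. $\mathfrak g[t]=\mathfrak g\otimes\mathbb C[t]$, $x(m):=x\otimes t^m$, $[x(m),y(n)]=[x,y](m+n)$; $x=x(0)$. Isomorphisms are of $\mathfrak g[t]$-modules and need not preserve parity. For $\lambda\in P^+$, the graded local Weyl module $W(\lambda)$ is the quotient of $\mathbf U(\mathfrak g[t])$ by the left ideal generated by $\mathfrak n^+[t]$, $h(r)-\delta_{r,0}\lambda(h)$ ($h\in\mathfrak h$, $r\ge0$), $y_2^{\lambda_2+1}$. For $N\in\mathbb Z_{\ge0}$, the truncated local Weyl module $W(\lambda,N)$ is the quotient of $\mathbf U(\mathfrak g[t])$ by the left ideal generated by the same elements together with $\mathfrak g\otimes t^N\mathbb C[t]$. Characters: $\mathrm{ch}$ denotes the formal character with respect to $\mathfrak h$-weights, $e^{(a,b)}$ being the formal exponential of the weight $\mu$ with $\mu(h_1)=a$, $\mu(h_2)=b$; $\Lambda(\mathfrak g_{-1})$ is the Grassmann algebra of $\mathfrak g_{-1}$, with $\mathrm{ch}\,\Lambda(\mathfrak g_{-1})=e^{(0,0)}+e^{(0,1)}+e^{(-1,-1)}+e^{(-1,0)}$.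
   Formalization: Part (c) as printed is false and is corrected: in the last factor q-1 becomes q+1, each e^{(0,k)} in the fraction and the last two factors becomes e^{(k/2,k)}, and the prefactor e^{(λ_1,0)} becomes e^{(λ_1-(λ_2-N)/2,0)}; the denominator is multiplied out. *)

theory Defs
  imports
    "HOL-Analysis.Analysis"
    "HOL-Library.Poly_Mapping"
    "HOL-Library.Set_Algebras"
    "HOL-Computational_Algebra.Polynomial"
    "Jordan_Normal_Form.Missing_VectorSpace"
begin

section \<open>The Lie superalgebra \<open>sl(1|2)\<close> and its current algebra\<close>

text \<open>The coefficient ring is a parameter: \<open>complex sl12\<close> is the Lie superalgebra itself, and
  \<open>complex poly sl12\<close>, its matrices over the polynomial ring, is its current algebra.\<close>

typedef (overloaded) 'a sl12 =
  "{A :: ('a::comm_ring_1)^3^3. A$1$1 - A$2$2 - A$3$3 = 0}"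
  by (rule exI[of _ 0]) simp

setup_lifting type_definition_sl12

instantiation sl12 :: (comm_ring_1) ab_group_add
begin

lift_definition zero_sl12 :: "'a sl12" is 0 by simp

lift_definition plus_sl12 :: "'a sl12 \<Rightarrow> 'a sl12 \<Rightarrow> 'a sl12" is "(+)"
  by (simp add: algebra_simps)

lift_definition uminus_sl12 :: "'a sl12 \<Rightarrow> 'a sl12" is uminus
  by (simp add: algebra_simps)

lift_definition minus_sl12 :: "'a sl12 \<Rightarrow> 'a sl12 \<Rightarrow> 'a sl12" is "(-)"
  by (simp add: algebra_simps)

instance by standard (transfer; simp add: algebra_simps)+

end

lift_definition sl_scale :: "'a::comm_ring_1 \<Rightarrow> 'a sl12 \<Rightarrow> 'a sl12"
  is "\<lambda>c A. \<chi> i j. c * A$i$j"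
  by (simp flip: right_diff_distrib)

text \<open>\<open>hpart p A\<close> is the component of \<open>A\<close> of parity \<open>p\<close> (read modulo 2); the diagonal blocks
  are indexed by \<open>{1}\<close> and \<open>{2, 3}\<close>.\<close>

definition block :: "3 \<Rightarrow> nat" where
  "block i = (if i = 1 then 0 else 1)"

definition hpart :: "nat \<Rightarrow> 'a::comm_ring_1^3^3 \<Rightarrow> 'a^3^3" where
  "hpart p A = (\<chi> i j. if even (block i + block j + p) then A$i$j else 0)"

lift_definition homogeneous :: "nat \<Rightarrow> 'a::comm_ring_1 sl12 \<Rightarrow> bool"
  is "\<lambda>p A. hpart p A = A" .

definition supercomm :: "nat \<Rightarrow> nat \<Rightarrow> 'a::comm_ring_1^3^3 \<Rightarrow> 'a^3^3 \<Rightarrow> 'a^3^3" where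
  "supercomm p q A B = (\<chi> i j. (A ** B)$i$j - (-1)^(p * q) * (B ** A)$i$j)"

lift_definition sbracket :: "'a::comm_ring_1 sl12 \<Rightarrow> 'a sl12 \<Rightarrow> 'a sl12"
  is "\<lambda>A B. \<Sum>p\<in>{0,1}. \<Sum>q\<in>{0,1}. supercomm p q (hpart p A) (hpart q B)"
  by (simp add: supercomm_def hpart_def block_def matrix_matrix_mult_def sum_3 algebra_simps)

lemma hpart_hpart_odd: "odd (p + q) \<Longrightarrow> hpart p (hpart q A) = 0"
  by (auto simp: hpart_def vec_eq_iff)

lemma supercomm_zero [simp]: "supercomm p q 0 B = 0" "supercomm p q A 0 = 0"
  by (auto simp: supercomm_def vec_eq_iff matrix_matrix_mult_def)

lemma sbracket_homogeneous:
  assumes "homogeneous p x" "homogeneous q y" "p \<in> {0,1}" "q \<in> {0,1}"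
  shows "Rep_sl12 (sbracket x y) = supercomm p q (Rep_sl12 x) (Rep_sl12 y)"
proof -
  have *: "hpart (1 - p) A = 0" if "hpart p A = A" "p \<in> {0,1}" for p and A :: "'a^3^3"
    using hpart_hpart_odd[of "1 - p" p A] that by auto
  from assms show ?thesis
    apply transfer
    subgoal for p x q y using *[of p x] *[of q y] by auto
    done
qed

text \<open>The pure tensor \<open>x \<otimes> f\<close>, and \<open>x(m) = x \<otimes> t^m\<close>.\<close>

lift_definition tens :: "complex sl12 \<Rightarrow> complex poly \<Rightarrow> complex poly sl12"
  is "\<lambda>A f. \<chi> i j. Polynomial.smult (A$i$j) f"
  by (simp flip: Polynomial.smult_diff_left)

definition cur :: "complex sl12 \<Rightarrow> nat \<Rightarrow> complex poly sl12" where
  "cur x m = tens x (monom 1 m)"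

definition matrix_unit :: "3 \<Rightarrow> 3 \<Rightarrow> complex^3^3" where
  "matrix_unit i j = (\<chi> k l. if k = i \<and> l = j then 1 else 0)"

lift_definition sl_x1 :: "complex sl12" is "matrix_unit 1 2"
  by (simp add: matrix_unit_def)
lift_definition sl_x2 :: "complex sl12" is "matrix_unit 2 3"
  by (simp add: matrix_unit_def)
lift_definition sl_x3 :: "complex sl12" is "matrix_unit 1 3"
  by (simp add: matrix_unit_def)
lift_definition sl_y1 :: "complex sl12" is "transpose (matrix_unit 1 2)"
  by (simp add: matrix_unit_def transpose_def)
lift_definition sl_y2 :: "complex sl12" is "transpose (matrix_unit 2 3)"
  by (simp add: matrix_unit_def transpose_def)
lift_definition sl_y3 :: "complex sl12" is "transpose (matrix_unit 1 3)"
  by (simp add: matrix_unit_def transpose_def)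
lift_definition sl_h1 :: "complex sl12" is "matrix_unit 1 1 + matrix_unit 2 2"
  by (simp add: matrix_unit_def)
lift_definition sl_h2 :: "complex sl12" is "matrix_unit 2 2 - matrix_unit 3 3"
  by (simp add: matrix_unit_def)

text \<open>A weight \<open>\<mu>\<close> is the pair of its values on \<open>sl_h1\<close> and \<open>sl_h2\<close>. The element \<open>cartan a b\<close>
  runs through the Cartan subalgebra, and \<open>\<mu>\<close> takes the value \<open>wt_eval \<mu> a b\<close> on it.\<close>

type_synonym weight = "complex \<times> complex"

definition cartan :: "complex \<Rightarrow> complex \<Rightarrow> complex sl12" where
  "cartan a b = sl_scale a sl_h1 + sl_scale b sl_h2"

definition wt_eval :: "weight \<Rightarrow> complex \<Rightarrow> complex \<Rightarrow> complex" where
  "wt_eval \<mu> a b = a * fst \<mu> + b * snd \<mu>"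

definition Pplus :: "weight set" where
  "Pplus = {\<mu>. \<exists>n::nat. 1 \<le> n \<and> snd \<mu> = of_nat n} \<union> {0}"

section \<open>The universal enveloping superalgebra of the current algebra\<close>

text \<open>The free unital associative algebra on a set is its monoid algebra of words, with the
  convolution product that \<open>poly_mapping\<close> already carries.\<close>

datatype 'a fword = FWord "'a list"

instantiation fword :: (type) monoid_add
begin

definition zero_fword :: "'a fword" where "0 = FWord []"

fun plus_fword :: "'a fword \<Rightarrow> 'a fword \<Rightarrow> 'a fword" where
  "FWord u + FWord v = FWord (u @ v)"

instance
proof
  fix a b c :: "'a fword"
  show "a + b + c = a + (b + c)" by (cases a; cases b; cases c) simp
  show "0 + a = a" "a + 0 = a" by (cases a; simp add: zero_fword_def)+
qed

end

lemma fword_add_eq_0: "a + b = 0 \<longleftrightarrow> a = 0 \<and> b = (0 :: 'a fword)"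
  by (cases a; cases b) (simp add: zero_fword_def)

type_synonym free_alg = "complex poly sl12 fword \<Rightarrow>\<^sub>0 complex"

definition free_gen :: "complex poly sl12 \<Rightarrow> free_alg" where
  "free_gen x = Poly_Mapping.single (FWord [x]) 1"

definition free_const :: "complex \<Rightarrow> free_alg" where
  "free_const c = Poly_Mapping.single 0 c"

definition left_ideal :: "'a::ring_1 set \<Rightarrow> bool" where
  "left_ideal J \<longleftrightarrow> 0 \<in> J \<and> (\<forall>a\<in>J. \<forall>b\<in>J. a + b \<in> J) \<and> (\<forall>r. \<forall>a\<in>J. r * a \<in> J)"

definition two_sided_ideal :: "'a::ring_1 set \<Rightarrow> bool" where
  "two_sided_ideal I \<longleftrightarrow> left_ideal I \<and> (\<forall>a\<in>I. \<forall>r. a * r \<in> I)"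

text \<open>The generators are all elements of the current algebra, so that its vector space structure
  also has to be imposed.\<close>

definition U_rels :: "free_alg set" where
  "U_rels =
     {free_gen (x + y) - (free_gen x + free_gen y) |x y. True} \<union>
     {free_gen (sl_scale [:c:] x) - free_const c * free_gen x |c x. True} \<union>
     {free_gen x * free_gen y - free_const ((-1) ^ (p * q)) * free_gen y * free_gen x
        - free_gen (sbracket x y) |x y p q.
        p \<in> {0,1} \<and> q \<in> {0,1} \<and> homogeneous p x \<and> homogeneous q y}"

definition U_ideal :: "free_alg set" where
  "U_ideal = two_sided_ideal hull U_rels"

lemma two_sided_ideal_U_ideal: "two_sided_ideal U_ideal"
  unfolding U_ideal_def
  by (rule hull_in) (auto simp: two_sided_ideal_def left_ideal_def)

lemma U_ideal_0: "0 \<in> U_ideal"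
  and U_ideal_add: "a \<in> U_ideal \<Longrightarrow> b \<in> U_ideal \<Longrightarrow> a + b \<in> U_ideal"
  and U_ideal_mult_left: "a \<in> U_ideal \<Longrightarrow> r * a \<in> U_ideal"
  and U_ideal_mult_right: "a \<in> U_ideal \<Longrightarrow> a * r \<in> U_ideal"
  using two_sided_ideal_U_ideal by (auto simp: two_sided_ideal_def left_ideal_def)

lemma U_ideal_uminus: "a \<in> U_ideal \<Longrightarrow> - a \<in> U_ideal"
  using U_ideal_mult_left[of a "-1"] by simp

lemma free_alg_lookup_mult_0:
  fixes f g :: free_alg
  shows "Poly_Mapping.lookup (f * g) 0 = Poly_Mapping.lookup f 0 * Poly_Mapping.lookup g 0"
proof -
  let ?l = Poly_Mapping.lookup
  have "?l (f * g) 0 = Sum_any (\<lambda>l. ?l f l * Sum_any (\<lambda>q. ?l g q when 0 = l + q))"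
    by (simp add: times_poly_mapping.rep_eq prod_fun_def)
  also have "(\<lambda>l. ?l f l * Sum_any (\<lambda>q. ?l g q when 0 = l + q))
      = (\<lambda>l. ?l f l * ?l g 0 when l = 0)"
  proof
    fix l
    have "l + q = 0 \<longleftrightarrow> l = 0 \<and> q = 0" for q :: "complex poly sl12 fword"
      by (rule fword_add_eq_0)
    then show "?l f l * Sum_any (\<lambda>q. ?l g q when 0 = l + q) = (?l f l * ?l g 0 when l = 0)"
      by (cases "l = 0") (simp_all add: when_def eq_commute[of 0 "l + _"])
  qed
  finally show ?thesis by simp
qed

lemma U_ideal_augmentation: "a \<in> U_ideal \<Longrightarrow> Poly_Mapping.lookup a 0 = 0"
proof -
  let ?K = "{a :: free_alg. Poly_Mapping.lookup a 0 = 0}"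
  have gen: "Poly_Mapping.lookup (free_gen x) 0 = 0" for x
    by (simp add: free_gen_def lookup_single zero_fword_def)
  have "two_sided_ideal ?K"
    by (auto simp: two_sided_ideal_def left_ideal_def lookup_add free_alg_lookup_mult_0)
  moreover have "U_rels \<subseteq> ?K"
    unfolding U_rels_def by (auto simp: gen lookup_add lookup_minus free_alg_lookup_mult_0)
  ultimately have "U_ideal \<subseteq> ?K"
    unfolding U_ideal_def by (rule hull_minimal[rotated])
  then show "a \<in> U_ideal \<Longrightarrow> Poly_Mapping.lookup a 0 = 0" by auto
qed

quotient_type Uenv = free_alg / "\<lambda>a b. a - b \<in> U_ideal"
proof (rule equivpI)
  show "reflp (\<lambda>a b. a - b \<in> U_ideal)" by (rule reflpI) (simp add: U_ideal_0)
  show "symp (\<lambda>a b. a - b \<in> U_ideal)"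
    by (rule sympI) (use U_ideal_uminus in fastforce)
  show "transp (\<lambda>a b. a - b \<in> U_ideal)"
  proof (rule transpI)
    fix a b c assume "a - b \<in> U_ideal" "b - c \<in> U_ideal"
    then have "(a - b) + (b - c) \<in> U_ideal" by (rule U_ideal_add)
    then show "a - c \<in> U_ideal" by simp
  qed
qed

instantiation Uenv :: ring_1
begin

lift_definition zero_Uenv :: Uenv is 0 .
lift_definition one_Uenv :: Uenv is 1 .

lift_definition plus_Uenv :: "Uenv \<Rightarrow> Uenv \<Rightarrow> Uenv" is "(+)"
proof -
  fix a b c d :: free_alg
  assume "a - b \<in> U_ideal" "c - d \<in> U_ideal"
  then have "(a - b) + (c - d) \<in> U_ideal" by (rule U_ideal_add)
  then show "(a + c) - (b + d) \<in> U_ideal" by (simp add: algebra_simps)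
qed

lift_definition uminus_Uenv :: "Uenv \<Rightarrow> Uenv" is uminus
proof -
  fix a b :: free_alg
  assume "a - b \<in> U_ideal"
  then have "- (a - b) \<in> U_ideal" by (rule U_ideal_uminus)
  then show "- a - - b \<in> U_ideal" by simp
qed

lift_definition minus_Uenv :: "Uenv \<Rightarrow> Uenv \<Rightarrow> Uenv" is "(-)"
proof -
  fix a b c d :: free_alg
  assume "a - b \<in> U_ideal" "c - d \<in> U_ideal"
  then have "(a - b) + - (c - d) \<in> U_ideal" by (intro U_ideal_add U_ideal_uminus)
  then show "(a - c) - (b - d) \<in> U_ideal" by (simp add: algebra_simps)
qed

lift_definition times_Uenv :: "Uenv \<Rightarrow> Uenv \<Rightarrow> Uenv" is "(*)"
proof -
  fix a b c d :: free_alg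
  assume "a - b \<in> U_ideal" "c - d \<in> U_ideal"
  then have "(a - b) * c + b * (c - d) \<in> U_ideal"
    by (intro U_ideal_add U_ideal_mult_left U_ideal_mult_right)
  then show "a * c - b * d \<in> U_ideal" by (simp add: algebra_simps)
qed

instance
proof
  show "(0 :: Uenv) \<noteq> 1"
    by transfer (use U_ideal_augmentation[of "0 - 1"] in \<open>auto simp: lookup_minus lookup_one\<close>)
qed (transfer; simp add: algebra_simps U_ideal_0)+

end

lift_definition U_gen :: "complex poly sl12 \<Rightarrow> Uenv" is free_gen .

lift_definition U_const :: "complex \<Rightarrow> Uenv" is free_const .

lemma U_const_add: "U_const (a + b) = U_const a + U_const b"
  by transfer (simp add: free_const_def single_add U_ideal_0)

lemma U_const_mult: "U_const (a * b) = U_const a * U_const b"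
  by transfer (simp add: free_const_def mult_single U_ideal_0)

lemma U_const_1: "U_const 1 = 1"
  by transfer (simp add: free_const_def U_ideal_0)

section \<open>Modules over the current algebra\<close>

definition C_field :: "complex ring" where
  "C_field = \<lparr>carrier = UNIV, mult = (*), one = 1, zero = 0, add = (+)\<rparr>"

lemma field_C_field: "field C_field"
proof -
  have "cring C_field"
    by (rule cringI; (rule abelian_groupI)?; (rule comm_monoidI)?)
       (auto simp: C_field_def algebra_simps intro: exI[of _ "- _"])
  then show ?thesis
    by (rule cring.cring_fieldI2) (auto simp: C_field_def intro: right_inverse)
qed

record 'm cmodule = "(complex, 'm) module" +
  act :: "complex poly sl12 \<Rightarrow> 'm \<Rightarrow> 'm"

text \<open>The quotient of the enveloping algebra by a left ideal \<open>J\<close>, as a set of cosets. Adding \<open>J\<close>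
  in the scalar and module actions turns the image of a coset into a full coset (for instance when
  the scalar is zero). The multiplicative fields of the record are not used by modules.\<close>

definition U_quot :: "Uenv set \<Rightarrow> Uenv set cmodule" where
  "U_quot J = \<lparr>
     carrier = range (\<lambda>u. u +o J),
     mult = undefined, one = undefined,
     zero = J,
     add = (+),
     smult = (\<lambda>c X. (U_const c *o X) + J),
     act = (\<lambda>x X. (U_gen x *o X) + J)\<rparr>"

lemma coset_add: "left_ideal J \<Longrightarrow> (u +o J) + (v +o J) = (u + v) +o J"
proof -
  assume J: "left_ideal J"
  have "J + J = J"
  proof
    show "J + J \<subseteq> J" using J by (auto simp: set_plus_def left_ideal_def)
    show "J \<subseteq> J + J"
    proof
      fix x assume "x \<in> J"
      then have "0 \<in> J" "x = 0 + x" using J by (auto simp: left_ideal_def)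
      then show "x \<in> J + J" using \<open>x \<in> J\<close> unfolding set_plus_def by blast
    qed
  qed
  then show ?thesis by (simp add: set_plus_rearrange)
qed

lemma coset_mult: "left_ideal J \<Longrightarrow> (a *o (u +o J)) + J = (a * u) +o J"
proof -
  assume J: "left_ideal J"
  show ?thesis
  proof (intro equalityI subsetI)
    fix x assume "x \<in> (a *o (u +o J)) + J"
    then obtain j k where "j \<in> J" "k \<in> J" "x = a * (u + j) + k"
      by (auto simp: elt_set_times_def elt_set_plus_def set_plus_def)
    then have "a * j + k \<in> J" "x = a * u + (a * j + k)"
      using J by (auto simp: left_ideal_def algebra_simps)
    then show "x \<in> (a * u) +o J" by (auto simp: elt_set_plus_def)
  next
    fix x assume "x \<in> (a * u) +o J"
    then obtain k where "k \<in> J" "x = a * (u + 0) + k" by (auto simp: elt_set_plus_def)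
    moreover have "0 \<in> J" using J by (simp add: left_ideal_def)
    ultimately show "x \<in> (a *o (u +o J)) + J"
      unfolding elt_set_times_def elt_set_plus_def set_plus_def by blast
  qed
qed

lemma vectorspace_U_quot:
  assumes J: "left_ideal J"
  shows "vectorspace C_field (U_quot J)"
proof -
  note [simp] = coset_add[OF J] coset_mult[OF J]
  have zero: "J = 0 +o J" by (simp add: elt_set_plus_def)
  have "abelian_group (U_quot J)"
  proof (rule abelian_groupI)
    fix x assume "x \<in> carrier (U_quot J)"
    then obtain u where u: "x = u +o J" by (auto simp: U_quot_def)
    show "\<exists>y\<in>carrier (U_quot J). y \<oplus>\<^bsub>U_quot J\<^esub> x = \<zero>\<^bsub>U_quot J\<^esub>"
      by (rule bexI[of _ "(- u) +o J"]) (use zero in \<open>auto simp: U_quot_def u\<close>)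
    show "\<zero>\<^bsub>U_quot J\<^esub> \<oplus>\<^bsub>U_quot J\<^esub> x = x"
      using coset_add[OF J, of 0 u] zero by (simp add: U_quot_def u)
  next
    show "\<zero>\<^bsub>U_quot J\<^esub> \<in> carrier (U_quot J)"
      by (simp add: U_quot_def) (rule range_eqI[where x = 0], rule zero)
  qed (auto simp: U_quot_def algebra_simps)
  moreover have "cring C_field"
    using field_C_field by (simp add: field_def domain_def)
  moreover have "module_axioms C_field (U_quot J)"
    by unfold_locales
       (auto simp: U_quot_def C_field_def U_const_add U_const_mult U_const_1
          distrib_left distrib_right mult.assoc)
  ultimately have "module C_field (U_quot J)"
    by (simp add: module_def)
  then show ?thesis
    by (simp add: vectorspace_def field_C_field)
qed

lemma left_ideal_hull: "left_ideal (left_ideal hull S)"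
  by (rule hull_in) (auto simp: left_ideal_def)

definition cmodule_iso :: "'a cmodule \<Rightarrow> 'b cmodule \<Rightarrow> bool" where
  "cmodule_iso V W \<longleftrightarrow>
     (\<exists>f \<in> module_hom C_field V W. bij_betw f (carrier V) (carrier W) \<and>
        (\<forall>x. \<forall>v\<in>carrier V. f (act V x v) = act W x (f v)))"

definition weight_space :: "'m cmodule \<Rightarrow> weight \<Rightarrow> 'm set" where
  "weight_space V \<mu> =
     {v \<in> carrier V. \<forall>a b. act V (cur (cartan a b) 0) v = wt_eval \<mu> a b \<odot>\<^bsub>V\<^esub> v}"

text \<open>Formal characters live in the group ring of the weight space. They are only meaningful for
  finite-dimensional modules, for which the multiplicity function has finite support.\<close>

definition fexp :: "weight \<Rightarrow> weight \<Rightarrow>\<^sub>0 int" where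
  "fexp \<mu> = Poly_Mapping.single \<mu> 1"

definition ch :: "'m cmodule \<Rightarrow> weight \<Rightarrow>\<^sub>0 int" where
  "ch V = Abs_poly_mapping
     (\<lambda>\<mu>. int (vectorspace.dim C_field (V\<lparr>carrier := weight_space V \<mu>\<rparr>)))"

text \<open>The character of the exterior algebra on \<open>sl_y1\<close> and \<open>sl_y3\<close>, whose weights are \<open>(0, 1)\<close> and
  \<open>(-1, -1)\<close>. The weight of \<open>sl_x2\<close> is \<open>(1, 2)\<close>, so that characters of the even part
  are expressed through multiples of \<open>(1/2, 1)\<close>.\<close>

definition ch_Lambda :: "weight \<Rightarrow>\<^sub>0 int" where
  "ch_Lambda = fexp (0, 0) + fexp (0, 1) + fexp (-1, -1) + fexp (-1, 0)"

section \<open>Local Weyl modules\<close>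

text \<open>In both modules the highest weight is \<open>(l1, of_nat l2)\<close>: weights in \<open>Pplus\<close> have a natural
  number as second coordinate.\<close>

definition weyl_rels :: "complex \<Rightarrow> nat \<Rightarrow> Uenv set" where
  "weyl_rels l1 l2 =
     {U_gen (tens sl_y1 f + tens sl_x2 g + tens sl_x3 k) |f g k. True} \<union>
     {U_gen (cur (cartan a b) r)
        - U_const (if r = 0 then wt_eval (l1, of_nat l2) a b else 0) |a b r. True} \<union>
     {U_gen (cur sl_y2 0) ^ (l2 + 1)}"

text \<open>\<open>sl_scale (monom 1 N)\<close> is multiplication by \<open>t^N\<close>.\<close>

definition weyl_trunc_rels :: "complex \<Rightarrow> nat \<Rightarrow> nat \<Rightarrow> Uenv set" where
  "weyl_trunc_rels l1 l2 N =
     weyl_rels l1 l2 \<union> {U_gen (sl_scale (monom 1 N) x) |x. True}"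

definition Weyl :: "complex \<Rightarrow> nat \<Rightarrow> Uenv set cmodule" where
  "Weyl l1 l2 = U_quot (left_ideal hull weyl_rels l1 l2)"

definition Weyl_trunc :: "complex \<Rightarrow> nat \<Rightarrow> nat \<Rightarrow> Uenv set cmodule" where
  "Weyl_trunc l1 l2 N = U_quot (left_ideal hull weyl_trunc_rels l1 l2 N)"

end

theory Submission
  imports Defs "HOL-Computational_Algebra.Formal_Power_Series" "HOL-Library.Function_Algebras"
begin

text \<open>
  Let \<open>J\<close> be the left ideal that defines the truncated local Weyl module, \<open>v\<close> the class of \<open>1\<close>,
  and let \<open>R(r,s)\<close> be the coefficient of \<open>z^s\<close> in the \<open>r\<close>-th power of the series
  \<open>\<Sum>j. y_2(j) z^j\<close> of commuting elements.

  \<^emph>\<open>Relations.\<close> Modulo the annihilator of a highest weight vector, \<open>x_2(1)\<close> maps \<open>R(r+1,s) v\<close> to a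
  nonzero multiple of \<open>R(r,s+1) v\<close>. Starting from \<open>y_2(0)^(l2+1) v = 0\<close> this gives Garland's
  relations \<open>R(r,s) v = 0\<close> for \<open>r \<ge> 1\<close> and \<open>r + s > l2\<close> (\<open>garland_relations\<close>). For \<open>r = 1\<close> they
  say that \<open>y_2(s) v = 0\<close> for \<open>s \<ge> l2\<close>; applying \<open>x_3\<close> and \<open>y_1\<close> kills \<open>x_1(s) v\<close> and \<open>y_3(s) v\<close> as
  well. So for \<open>N \<ge> l2\<close> truncation adds no relation, which is the isomorphism
  (\<open>weyl_trunc_hull\<close>). For \<open>N < l2\<close> the truncation also gives \<open>R(r,s) v = 0\<close> for \<open>r + s > N r\<close>, and
  both families together say \<open>R(r,s) v = 0\<close> whenever \<open>r + s > \<Sum>i. min r (\<nu> i)\<close>, where \<open>\<nu>\<close> is the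
  partition of \<open>l2\<close> into \<open>m\<close> parts \<open>q + 1\<close> and \<open>N - m\<close> parts \<open>q\<close> (\<open>near_rectangle_relations\<close>).

  \<^emph>\<open>Upper bound.\<close> Such relations for a partition \<open>\<nu>\<close> leave at most \<open>\<Prod>i. (\<nu> i + 1)\<close> independent
  polynomials in the \<open>y_2(j)\<close> (\<open>boson_bound\<close>). The odd generators \<open>y_3(j)\<close> and then \<open>x_1(j)\<close> are added
  one index at a time. Multiplying by such a generator yields a vector that satisfies the relations
  of \<open>\<nu>\<close> with the part \<open>\<nu> j\<close> lowered by one (\<open>extract_fermion\<close>), and the resulting recursion turns
  \<open>\<Prod>i. (\<nu> i + 1)\<close> into \<open>\<Prod>i. (2 \<nu> i + 1)\<close> and then into \<open>\<Prod>i. 4 \<nu> i\<close> (\<open>upper_bound\<close>).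

  \<^emph>\<open>Lower bound.\<close> The Kac module whose even top has dimension \<open>n\<close> has dimension \<open>4 n\<close>. Over the
  polynomial ring in a parameter \<open>c\<close>, evaluate Kac modules with \<open>n = \<nu> i\<close> at the points \<open>c i\<close> for
  \<open>i < N\<close> and take their tensor product. For generic \<open>c\<close> it is generated by the product of the
  highest weight vectors, so the lattice that this vector generates has full rank; at \<open>c = 0\<close> the
  vector satisfies the relations of \<open>J\<close>. Hence every weight space of the truncated module is at least
  as large as the number of basis vectors of the tensor product of that weight
  (\<open>weight_lower_bound\<close>). The sum of these numbers is \<open>\<Prod>i. 4 \<nu> i\<close>, the upper bound for the whole
  module, so that all weight multiplicities are equal to them (\<open>weight_multiplicities\<close>). The
  character is therefore the product of the characters of the Kac modules, and each of these is
  \<open>ch_Lambda\<close> times the geometric sum of a string of \<open>sl_2\<close>-weights (\<open>confs_character\<close>).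
\<close>

section \<open>Dimension modulo a subspace\<close>

text \<open>Two bounds have to be compared: an upper bound obtained by filtering the enveloping algebra, and a
lower bound obtained from a lattice. Both concern quotients \<open>A / B\<close> of subspaces, and it is
convenient to express them by generators in the ambient space: \<open>rdim A B d\<close> says that \<open>A\<close> is
spanned by at most \<open>d\<close> elements modulo \<open>B\<close>.\<close>

locale complex_space = vector_space scale
  for scale :: "complex \<Rightarrow> 'b::ab_group_add \<Rightarrow> 'b"
begin

definition rdim :: "'b set \<Rightarrow> 'b set \<Rightarrow> nat \<Rightarrow> bool" where
  "rdim A B d \<longleftrightarrow> (\<exists>S. finite S \<and> card S \<le> d \<and> A \<subseteq> span (S \<union> B))"

lemma rdim_mono:
  assumes "rdim A B d" "A' \<subseteq> A" "B \<subseteq> B'" "d \<le> d'"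
  shows "rdim A' B' d'"
proof -
  obtain S where S: "finite S" "card S \<le> d" "A \<subseteq> span (S \<union> B)" using assms(1) by (auto simp: rdim_def)
  have "span (S \<union> B) \<subseteq> span (S \<union> B')" using assms(3) by (intro span_mono) auto
  then show ?thesis using S assms unfolding rdim_def by (intro exI[of _ S]) auto
qed

lemma rdim_0: "A \<subseteq> span B \<Longrightarrow> rdim A B 0"
  unfolding rdim_def by (rule exI[of _ "{}"]) auto

lemma rdim_trans:
  assumes "rdim A B d" "rdim B C e"
  shows "rdim A C (d + e)"
proof -
  obtain S where S: "finite S" "card S \<le> d" "A \<subseteq> span (S \<union> B)" using assms(1) by (auto simp: rdim_def)
  obtain T where T: "finite T" "card T \<le> e" "B \<subseteq> span (T \<union> C)" using assms(2) by (auto simp: rdim_def)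
  have "B \<subseteq> span (S \<union> T \<union> C)" using T(3) span_mono[of "T \<union> C" "S \<union> T \<union> C"] by auto
  then have "S \<union> B \<subseteq> span (S \<union> T \<union> C)" by (auto intro: span_base)
  then have "span (S \<union> B) \<subseteq> span (S \<union> T \<union> C)" by (rule span_minimal) simp
  then show ?thesis using S T card_Un_le[of S T] unfolding rdim_def
    by (intro exI[of _ "S \<union> T"]) auto
qed

text \<open>Exchange arguments modulo \<open>J\<close> are transported to ordinary linear algebra by an endomorphism with
kernel \<open>J\<close>, which makes a quotient type unnecessary.\<close>

lemma quotient_projection:
  assumes J: "subspace J"
  obtains p where "Vector_Spaces.linear scale scale p" "\<And>x. p x = 0 \<longleftrightarrow> x \<in> J"
proof -
  interpret vector_space_pair scale scale ..
  obtain B where B: "B \<subseteq> J" "independent B" "J \<subseteq> span B"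
    using maximal_independent_subset[of J] by blast
  have spanB: "span B = J" using B J span_minimal by blast
  let ?E = "extend_basis B"
  have E: "independent ?E" "B \<subseteq> ?E" "span ?E = UNIV"
    using B by (auto simp: independent_extend_basis extend_basis_superset span_extend_basis)
  define p where "p = construct ?E (\<lambda>b. if b \<in> B then 0 else b)"
  have lin: "Vector_Spaces.linear scale scale p" unfolding p_def using E(1) by (rule linear_construct)
  then interpret p: Vector_Spaces.linear scale scale p .
  have pB: "p b = 0" if "b \<in> span B" for b
  proof (rule p.eq_0_on_span[OF _ that])
    fix x assume "x \<in> B"
    then have "x \<in> ?E" using E(2) by blast
    then show "p x = 0" using \<open>x \<in> B\<close> unfolding p_def by (subst construct_basis[OF E(1)]) auto
  qed
  have pC: "p b = b" if "b \<in> span (?E - B)" for b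
  proof -
    have "p x = id x" if "x \<in> ?E - B" for x
      unfolding p_def using that by (subst construct_basis[OF E(1)]) auto
    then have "p b = id b" using that lin linear_id linear_eq_on[of p id b "?E - B"] by blast
    then show ?thesis by simp
  qed
  have "p x = 0 \<longleftrightarrow> x \<in> J" for x
  proof -
    have "x \<in> span (B \<union> (?E - B))" using E by (simp add: Un_absorb1)
    then obtain y z where yz: "x = y + z" "y \<in> span B" "z \<in> span (?E - B)"
      unfolding span_Un by auto
    have px: "p x = z" using yz pB pC by (simp add: p.add)
    show ?thesis
    proof
      assume "p x = 0" then show "x \<in> J" using px yz spanB by simp
    next
      assume "x \<in> J" then show "p x = 0" using pB spanB by simp
    qed
  qed
  then show ?thesis using that lin by blast
qed

definition indep_mod :: "'b set \<Rightarrow> 'b set \<Rightarrow> bool" where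
  "indep_mod T J \<longleftrightarrow> (\<forall>c. (\<Sum>s\<in>T. scale (c s) s) \<in> J \<longrightarrow> (\<forall>s\<in>T. c s = 0))"

text \<open>The Steinitz bound, read modulo \<open>J\<close>.\<close>

lemma indep_mod_card_le:
  assumes J: "subspace J" and T: "finite T" "indep_mod T J" "T \<subseteq> A" and A: "rdim A J d"
  shows "card T \<le> d"
proof -
  obtain S where S: "finite S" "card S \<le> d" "A \<subseteq> span (S \<union> J)" using A by (auto simp: rdim_def)
  obtain p where lin: "Vector_Spaces.linear scale scale p" and ker: "\<And>x. p x = 0 \<longleftrightarrow> x \<in> J"
    using quotient_projection[OF J] by blast
  interpret p: Vector_Spaces.linear scale scale p by fact
  have inj: "inj_on p T"
  proof (rule inj_onI, rule ccontr)
    fix s t assume st: "s \<in> T" "t \<in> T" "p s = p t" "s \<noteq> t"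
    define c :: "'b \<Rightarrow> complex" where "c x = (if x = s then 1 else if x = t then -1 else 0)" for x
    have "(\<Sum>x\<in>T. scale (c x) x) = (\<Sum>x\<in>{s,t}. scale (c x) x)"
      using st T(1) by (intro sum.mono_neutral_right) (auto simp: c_def)
    also have "\<dots> = s - t" using st by (simp add: c_def)
    finally have "(\<Sum>x\<in>T. scale (c x) x) \<in> J" using st ker[of "s - t"] by (simp add: p.diff)
    then have "c s = 0" using T(2) st unfolding indep_mod_def by blast
    then show False by (simp add: c_def)
  qed
  have ind: "independent (p ` T)"
  proof (rule independent_if_scalars_zero)
    show "finite (p ` T)" using T by simp
    fix f x assume f: "(\<Sum>x\<in>p ` T. scale (f x) x) = 0" and x: "x \<in> p ` T"
    have "(\<Sum>x\<in>p ` T. scale (f x) x) = p (\<Sum>x\<in>T. scale (f (p x)) x)"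
      by (simp add: sum.reindex[OF inj] p.sum p.scale)
    then have "(\<Sum>x\<in>T. scale (f (p x)) x) \<in> J" using f ker by simp
    then have "\<forall>s\<in>T. f (p s) = 0"
      using T(2)[unfolded indep_mod_def, rule_format, of "\<lambda>x. f (p x)"] by blast
    then show "f x = 0" using x by auto
  qed
  have "p ` span (S \<union> J) = span (p ` (S \<union> J))" by (rule p.span_image[symmetric])
  moreover have "span (p ` (S \<union> J)) \<subseteq> span (p ` S)"
  proof (rule span_minimal)
    have "p x \<in> span (p ` S)" if "x \<in> J" for x
      using iffD2[OF ker that] by (simp add: span_zero)
    then show "p ` (S \<union> J) \<subseteq> span (p ` S)" by (auto intro: span_base)
  qed simp
  ultimately have "p ` T \<subseteq> span (p ` S)" using T(3) S(3) by blast
  then have "card (p ` T) \<le> card (p ` S)"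
    using independent_span_bound[of "p ` S" "p ` T"] S(1) ind by auto
  then show ?thesis using card_image[OF inj] card_image_le[OF S(1), of p] S(2) by linarith
qed

lemma indep_mod_insert:
  assumes J: "subspace J" and T: "finite T" "indep_mod T J" and a: "a \<notin> span (T \<union> J)"
  shows "indep_mod (insert a T) J"
  unfolding indep_mod_def
proof (intro allI impI)
  fix c assume c: "(\<Sum>s\<in>insert a T. scale (c s) s) \<in> J"
  have aT: "a \<notin> T" using a by (auto intro: span_base)
  have sum: "(\<Sum>s\<in>insert a T. scale (c s) s) = scale (c a) a + (\<Sum>s\<in>T. scale (c s) s)"
    using T(1) aT by simp
  have "c a = 0"
  proof (rule ccontr)
    assume ca: "c a \<noteq> 0"
    have "(\<Sum>s\<in>T. scale (c s) s) \<in> span (T \<union> J)"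
      by (intro span_sum span_scale span_base) auto
    moreover have "(\<Sum>s\<in>insert a T. scale (c s) s) \<in> span (T \<union> J)" using c by (auto intro: span_base)
    ultimately have "scale (c a) a \<in> span (T \<union> J)"
      using span_diff[of "\<Sum>s\<in>insert a T. scale (c s) s" "T \<union> J" "\<Sum>s\<in>T. scale (c s) s"] sum by simp
    then have "scale (inverse (c a)) (scale (c a) a) \<in> span (T \<union> J)" by (rule span_scale)
    then show False using a ca by simp
  qed
  then show "\<forall>s\<in>insert a T. c s = 0" using c sum T(2) unfolding indep_mod_def by auto
qed

lemma mod_basis_exists:
  assumes J: "subspace J" and A: "rdim A J d"
  obtains S where "S \<subseteq> A" "finite S" "indep_mod S J" "A \<subseteq> span (S \<union> J)" "card S \<le> d"
proof -
  define P where "P k \<longleftrightarrow> (\<exists>S. S \<subseteq> A \<and> finite S \<and> indep_mod S J \<and> card S = k)" for k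
  have P0: "P 0" unfolding P_def by (rule exI[of _ "{}"]) (auto simp: indep_mod_def)
  have Pb: "\<And>k. P k \<Longrightarrow> k \<le> d" unfolding P_def using indep_mod_card_le[OF J _ _ _ A] by blast
  obtain S where S: "S \<subseteq> A" "finite S" "indep_mod S J" and cS: "card S = (GREATEST k. P k)"
    using GreatestI_nat[of P 0 d, OF P0 Pb] unfolding P_def by blast
  have "A \<subseteq> span (S \<union> J)"
  proof (rule ccontr)
    assume "\<not> ?thesis"
    then obtain a where a: "a \<in> A" "a \<notin> span (S \<union> J)" by blast
    then have "a \<notin> S" by (auto intro: span_base)
    then have "P (Suc (card S))"
      unfolding P_def using indep_mod_insert[OF J S(2,3) a(2)] a(1) S
      by (intro exI[of _ "insert a S"]) auto
    then show False using Greatest_le_nat[of P _ d, OF _ Pb] cS by fastforce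
  qed
  then show ?thesis using that S indep_mod_card_le[OF J S(2,3,1) A] by blast
qed

end

locale complex_space_pair = V: complex_space s1 + W: complex_space s2
  for s1 :: "complex \<Rightarrow> 'b::ab_group_add \<Rightarrow> 'b" and s2 :: "complex \<Rightarrow> 'c::ab_group_add \<Rightarrow> 'c"
begin

lemma rdim_image:
  assumes "Vector_Spaces.linear s1 s2 f" "V.rdim A B d"
  shows "W.rdim (f ` A) (f ` B) d"
proof -
  interpret f: Vector_Spaces.linear s1 s2 f by fact
  obtain S where S: "finite S" "card S \<le> d" "A \<subseteq> V.span (S \<union> B)"
    using assms(2) by (auto simp: V.rdim_def)
  have "f ` A \<subseteq> W.span (f ` S \<union> f ` B)"
    using S(3) f.span_image[of "S \<union> B"] by (auto simp: image_Un)
  moreover have "card (f ` S) \<le> d" using card_image_le[OF S(1), of f] S(2) by linarith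
  ultimately show ?thesis unfolding W.rdim_def using S(1) by blast
qed

end

section \<open>Generators of the enveloping superalgebra\<close>

text \<open>The bracket of two basis elements is a short integer combination of basis elements; a list of
coefficients makes both the commutation rules of the enveloping algebra and the verification of
the module axioms for explicit operators a matter of simplification.\<close>

datatype gen = X1 | X2 | X3 | Y1 | Y2 | Y3 | H1 | H2

lemma UNIV_gen: "UNIV = {X1, X2, X3, Y1, Y2, Y3, H1, H2}"
  using gen.exhaust by blast

instance gen :: finite
  by standard (simp add: UNIV_gen)

lemma sum_gen: "(\<Sum>g\<in>UNIV. f g) = f X1 + f X2 + f X3 + f Y1 + f Y2 + f Y3 + f H1 + f H2"
  for f :: "gen \<Rightarrow> 'a::comm_monoid_add"
  by (simp add: UNIV_gen add.assoc)

fun basis_elt :: "gen \<Rightarrow> complex sl12" where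
  "basis_elt X1 = sl_x1" | "basis_elt X2 = sl_x2" | "basis_elt X3 = sl_x3" |
  "basis_elt Y1 = sl_y1" | "basis_elt Y2 = sl_y2" | "basis_elt Y3 = sl_y3" |
  "basis_elt H1 = sl_h1" | "basis_elt H2 = sl_h2"

fun odd_gen :: "gen \<Rightarrow> bool" where
  "odd_gen X1 = True" | "odd_gen X3 = True" | "odd_gen Y1 = True" | "odd_gen Y3 = True" |
  "odd_gen _ = False"

text \<open>Structure constants: \<open>[a, b]\<close> is the sum of \<open>c h\<close> over the pairs \<open>(c, h)\<close> in \<open>brk a b\<close>.\<close>

fun brk :: "gen \<Rightarrow> gen \<Rightarrow> (int \<times> gen) list" where
  "brk X1 X2 = [(1, X3)]" |
  "brk X1 Y1 = [(1, H1)]" |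
  "brk X1 Y3 = [(1, Y2)]" |
  "brk X1 H2 = [(1, X1)]" |
  "brk X2 X1 = [(-1, X3)]" |
  "brk X2 Y2 = [(1, H2)]" |
  "brk X2 Y3 = [(1, Y1)]" |
  "brk X2 H1 = [(-1, X2)]" |
  "brk X2 H2 = [(-2, X2)]" |
  "brk X3 Y1 = [(1, X2)]" |
  "brk X3 Y2 = [(1, X1)]" |
  "brk X3 Y3 = [(1, H1), (-1, H2)]" |
  "brk X3 H1 = [(-1, X3)]" |
  "brk X3 H2 = [(-1, X3)]" |
  "brk Y1 X1 = [(1, H1)]" |
  "brk Y1 X3 = [(1, X2)]" |
  "brk Y1 Y2 = [(-1, Y3)]" |
  "brk Y1 H2 = [(-1, Y1)]" |
  "brk Y2 X2 = [(-1, H2)]" |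
  "brk Y2 X3 = [(-1, X1)]" |
  "brk Y2 Y1 = [(1, Y3)]" |
  "brk Y2 H1 = [(1, Y2)]" |
  "brk Y2 H2 = [(2, Y2)]" |
  "brk Y3 X1 = [(1, Y2)]" |
  "brk Y3 X2 = [(-1, Y1)]" |
  "brk Y3 X3 = [(1, H1), (-1, H2)]" |
  "brk Y3 H1 = [(1, Y3)]" |
  "brk Y3 H2 = [(1, Y3)]" |
  "brk H1 X2 = [(1, X2)]" |
  "brk H1 X3 = [(1, X3)]" |
  "brk H1 Y2 = [(-1, Y2)]" |
  "brk H1 Y3 = [(-1, Y3)]" |
  "brk H2 X1 = [(-1, X1)]" |
  "brk H2 X2 = [(2, X2)]" |
  "brk H2 X3 = [(1, X3)]" |
  "brk H2 Y1 = [(1, Y1)]" |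
  "brk H2 Y2 = [(-2, Y2)]" |
  "brk H2 Y3 = [(-1, Y3)]" |
  "brk _ _ = []"

lift_definition entry :: "'a::comm_ring_1 sl12 \<Rightarrow> 3 \<Rightarrow> 3 \<Rightarrow> 'a" is "\<lambda>A i j. A $ i $ j" .

text \<open>Coordinates with respect to the eight basis elements. The entry in the middle of the diagonal is
determined by the other two, and \<open>H2\<close> is the only basis element with a nonzero last entry.\<close>

fun coef :: "gen \<Rightarrow> 'a::comm_ring_1 sl12 \<Rightarrow> 'a" where
  "coef X1 A = entry A 1 2" | "coef X2 A = entry A 2 3" | "coef X3 A = entry A 1 3" |
  "coef Y1 A = entry A 2 1" | "coef Y2 A = entry A 3 2" | "coef Y3 A = entry A 3 1" |
  "coef H1 A = entry A 1 1" | "coef H2 A = - entry A 3 3"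

lemma entry_diag: "entry A 1 1 = entry A 2 2 + entry A 3 3"
  by transfer (simp add: algebra_simps)

lemma sl12_eqI:
  assumes "\<And>g. coef g A = coef g B"
  shows "A = B"
proof -
  have "entry A i j = entry B i j" for i j
  proof -
    have "entry A 2 2 = entry B 2 2"
      using assms[of H1] assms[of H2] entry_diag[of A] entry_diag[of B] by simp
    moreover have "entry A i j = entry B i j" if "i \<noteq> 2 \<or> j \<noteq> 2"
      using that assms[of X1] assms[of X2] assms[of X3] assms[of Y1] assms[of Y2] assms[of Y3]
        assms[of H1] assms[of H2] exhaust_3[of i] exhaust_3[of j] by auto
    ultimately show ?thesis by metis
  qed
  then show ?thesis by transfer (simp add: vec_eq_iff)
qed

lemma entry_plus [simp]: "entry (A + B) i j = entry A i j + entry B i j" by transfer simp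
lemma entry_0 [simp]: "entry 0 i j = 0" by transfer simp
lemma entry_scale [simp]: "entry (sl_scale c A) i j = c * entry A i j" by transfer simp
lemma entry_tens [simp]: "entry (tens A f) i j = Polynomial.smult (entry A i j) f" by transfer simp

lemma coef_plus [simp]: "coef g (A + B) = coef g A + coef g B" by (cases g) auto
lemma coef_0 [simp]: "coef g 0 = 0" by (cases g) auto
lemma coef_scale [simp]: "coef g (sl_scale c A) = c * coef g A" by (cases g) auto
lemma coef_tens [simp]: "coef g (tens A f) = Polynomial.smult (coef g A) f" by (cases g) auto
lemma coef_sum [simp]: "coef g (sum F I) = (\<Sum>i\<in>I. coef g (F i))"
  by (induction I rule: infinite_finite_induct) auto

lemma entry_basis_elt [simp]:
  "entry sl_x1 i j = (if i = 1 \<and> j = 2 then 1 else 0)"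
  "entry sl_x2 i j = (if i = 2 \<and> j = 3 then 1 else 0)"
  "entry sl_x3 i j = (if i = 1 \<and> j = 3 then 1 else 0)"
  "entry sl_y1 i j = (if i = 2 \<and> j = 1 then 1 else 0)"
  "entry sl_y2 i j = (if i = 3 \<and> j = 2 then 1 else 0)"
  "entry sl_y3 i j = (if i = 3 \<and> j = 1 then 1 else 0)"
  "entry sl_h1 i j = (if i = 1 \<and> j = 1 then 1 else 0) + (if i = 2 \<and> j = 2 then 1 else 0)"
  "entry sl_h2 i j = (if i = 2 \<and> j = 2 then 1 else 0) - (if i = 3 \<and> j = 3 then 1 else 0)"
  by (transfer; auto simp: matrix_unit_def transpose_def)+

lemma coef_basis_elt: "coef g (basis_elt h) = (if g = h then 1 else 0)"
  by (cases h; cases g; simp)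

lemma coef_sbracket:
  fixes A B :: "'a::comm_ring_1 sl12"
  shows "coef g (sbracket A B) =
    (\<Sum>a\<in>UNIV. \<Sum>b\<in>UNIV. (\<Sum>(c, h)\<leftarrow>brk a b. if h = g then of_int c else 0) * (coef a A * coef b B))"
proof -
  have entry_br: "entry (sbracket A B) i j = (\<Sum>k\<in>UNIV.
      entry A i k * entry B k j - (if odd (block i + block k) \<and> odd (block k + block j) then -1 else 1) * (entry B i k * entry A k j))" for i j
    by transfer (auto simp: supercomm_def hpart_def matrix_matrix_mult_def sum_3 block_def)
  show ?thesis
    by (cases g; simp add: entry_br sum_3 block_def sum_gen entry_diag; simp add: algebra_simps)
qed

definition G :: "gen \<Rightarrow> nat \<Rightarrow> Uenv" where
  "G g m = U_gen (cur (basis_elt g) m)"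

lemma coef_cur: "coef g (cur (basis_elt h) m) = (if g = h then monom 1 m else 0)"
  by (simp add: cur_def coef_basis_elt)

lemma homogeneous_cur: "homogeneous (if odd_gen g then 1 else 0) (cur (basis_elt g) m)"
proof -
  have *: "homogeneous p A" if "\<And>i j. odd (block i + block j + p) \<Longrightarrow> entry A i j = 0"
    for p and A :: "complex poly sl12"
    using that by (auto simp: homogeneous.rep_eq hpart_def vec_eq_iff entry.rep_eq)
  have "\<forall>i j. odd (block i + block j + (if odd_gen g then 1 else 0)) \<longrightarrow> entry (cur (basis_elt g) m) i j = 0"
    by (cases g) (simp_all add: forall_3 block_def cur_def)
  then show ?thesis by (intro *) blast
qed

lemma sbracket_cur:
  "sbracket (cur (basis_elt a) m) (cur (basis_elt b) n) =
   (\<Sum>(c, h)\<leftarrow>brk a b. sl_scale [:of_int c:] (cur (basis_elt h) (m + n)))"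
proof (rule sl12_eqI)
  fix g
  have 1: "coef g (sbracket (cur (basis_elt a) m) (cur (basis_elt b) n)) =
     (\<Sum>(c, h)\<leftarrow>brk a b. if h = g then of_int c else 0) * monom 1 (m + n)"
    unfolding coef_sbracket coef_cur
    by (simp add: if_distrib[of "\<lambda>x. _ * (x * _)"] if_distrib[of "\<lambda>x. _ * (_ * x)"] mult_monom
        sum.delta cong: if_cong)
  have 2: "coef g (sum_list (map F xs)) = sum_list (map (\<lambda>x. coef g (F x)) xs)" for F :: "int \<times> gen \<Rightarrow> complex poly sl12" and xs
    by (induction xs) auto
  have 3: "(\<Sum>(c, h)\<leftarrow>xs. if h = g then of_int c else 0) * monom 1 (m + n) =
     (\<Sum>x\<leftarrow>xs. coef g (case x of (c, h) \<Rightarrow> sl_scale [:of_int c:] (cur (basis_elt h) (m + n))))" for xs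
    by (induction xs) (auto simp: coef_cur distrib_right of_int_poly)
  show "coef g (sbracket (cur (basis_elt a) m) (cur (basis_elt b) n)) =
     coef g (\<Sum>(c, h)\<leftarrow>brk a b. sl_scale [:of_int c:] (cur (basis_elt h) (m + n)))"
    unfolding 1 2 3 ..
qed

lemma abs_U_rels: "r \<in> U_rels \<Longrightarrow> abs_Uenv r = 0"
  unfolding U_ideal_def zero_Uenv.abs_eq by (simp add: Uenv.abs_eq_iff U_ideal_def hull_inc)

lemmas abs_Uenv_simps =
  plus_Uenv.abs_eq[symmetric] minus_Uenv.abs_eq[symmetric] times_Uenv.abs_eq[symmetric]
  U_gen.abs_eq[symmetric] U_const.abs_eq[symmetric]

lemma U_gen_add: "U_gen (x + y) = U_gen x + U_gen y"
proof -
  have "free_gen (x + y) - (free_gen x + free_gen y) \<in> U_rels"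
    unfolding U_rels_def by blast
  from abs_U_rels[OF this] show ?thesis by (simp add: abs_Uenv_simps)
qed

lemma U_gen_scale: "U_gen (sl_scale [:c:] x) = U_const c * U_gen x"
proof -
  have "free_gen (sl_scale [:c:] x) - free_const c * free_gen x \<in> U_rels"
    unfolding U_rels_def by blast
  from abs_U_rels[OF this] show ?thesis by (simp add: abs_Uenv_simps)
qed

lemma U_gen_bracket:
  assumes "homogeneous p x" "homogeneous q y" "p \<in> {0,1}" "q \<in> {0,1}"
  shows "U_gen x * U_gen y = U_const ((-1)^(p*q)) * U_gen y * U_gen x + U_gen (sbracket x y)"
proof -
  have "free_gen x * free_gen y - free_const ((-1) ^ (p * q)) * free_gen y * free_gen x
        - free_gen (sbracket x y) \<in> U_rels"
    unfolding U_rels_def using assms by blast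
  from abs_U_rels[OF this] show ?thesis by (simp add: abs_Uenv_simps algebra_simps)
qed

lemma U_const_0: "U_const 0 = 0" using U_const_add[of 0 0] by simp
lemma U_const_uminus: "U_const (- a) = - U_const a"
  using U_const_add[of a "-a"] by (simp add: U_const_0 add_eq_0_iff)
lemma U_const_of_nat: "U_const (of_nat n) = of_nat n"
  by (induction n) (simp_all add: U_const_0 U_const_add U_const_1)
lemma U_const_of_int: "U_const (of_int c) = of_int c"
  by (cases c rule: int_diff_cases)
     (metis U_const_add U_const_of_nat U_const_uminus diff_conv_add_uminus of_int_diff of_int_of_nat_eq)

lemma U_gen_0: "U_gen 0 = 0" using U_gen_add[of 0 0] by simp
lemma U_gen_sum_list: "U_gen (sum_list xs) = sum_list (map U_gen xs)"
  by (induction xs) (auto simp: U_gen_0 U_gen_add)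
lemma U_gen_sum: "U_gen (sum f I) = (\<Sum>i\<in>I. U_gen (f i))"
  by (induction I rule: infinite_finite_induct) (auto simp: U_gen_0 U_gen_add)

text \<open>All computations in the enveloping algebra use its relations only in this form.\<close>

lemma G_comm:
  "G a m * G b n = (if odd_gen a \<and> odd_gen b then -1 else 1) * (G b n * G a m)
     + (\<Sum>(c, h)\<leftarrow>brk a b. of_int c * G h (m + n))"
proof -
  have "U_gen (sbracket (cur (basis_elt a) m) (cur (basis_elt b) n)) = (\<Sum>(c, h)\<leftarrow>brk a b. of_int c * G h (m + n))"
    unfolding sbracket_cur U_gen_sum_list map_map
    by (intro arg_cong[of _ _ sum_list] map_cong)
      (auto simp: U_gen_scale G_def U_const_of_int)
  then show ?thesis
    unfolding G_def using U_gen_bracket[OF homogeneous_cur[of a m] homogeneous_cur[of b n]]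
    by (auto simp: U_const_1 U_const_uminus)
qed

lemma poly_mapping_decomp:
  fixes p :: "'a \<Rightarrow>\<^sub>0 'b::comm_monoid_add"
  shows "p = (\<Sum>k\<in>Poly_Mapping.keys p. Poly_Mapping.single k (Poly_Mapping.lookup p k))"
proof (rule poly_mapping_eqI)
  fix k
  have "(\<Sum>x\<in>Poly_Mapping.keys p. Poly_Mapping.lookup (Poly_Mapping.single x (Poly_Mapping.lookup p x)) k)
    = (\<Sum>x\<in>Poly_Mapping.keys p. if x = k then Poly_Mapping.lookup p k else 0)"
    by (intro sum.cong) (auto simp: lookup_single when_def)
  also have "\<dots> = Poly_Mapping.lookup p k" by (simp add: sum.delta in_keys_iff)
  finally show "Poly_Mapping.lookup p k =
     Poly_Mapping.lookup (\<Sum>k\<in>Poly_Mapping.keys p. Poly_Mapping.single k (Poly_Mapping.lookup p k)) k"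
    by (simp add: lookup_sum)
qed

lemma poly_mapping_induct_single:
  fixes p :: "'a \<Rightarrow>\<^sub>0 'b::comm_monoid_add"
  assumes "P 0" "\<And>k c. P (Poly_Mapping.single k c)" "\<And>p q. P p \<Longrightarrow> P q \<Longrightarrow> P (p + q)"
  shows "P p"
proof -
  have "P (\<Sum>k\<in>K. Poly_Mapping.single k (Poly_Mapping.lookup p k))" for K
    by (induction K rule: infinite_finite_induct) (auto intro: assms)
  then show ?thesis by (subst poly_mapping_decomp)
qed

text \<open>Scalars sit at the empty word, which is neutral for concatenation on both sides.\<close>

lemma U_const_commute: "U_const c * u = u * U_const c"
proof -
  have "free_const c * p = p * free_const c" for p
    by (induction p rule: poly_mapping_induct_single)
       (simp_all add: free_const_def mult_single distrib_left distrib_right mult.commute)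
  then show ?thesis by transfer (simp add: U_ideal_0)
qed

definition cscale :: "complex \<Rightarrow> Uenv \<Rightarrow> Uenv" where
  "cscale c u = U_const c * u"

interpretation U: complex_space cscale
  by unfold_locales
     (auto simp: cscale_def distrib_left distrib_right U_const_add U_const_mult U_const_1 mult.assoc)

lemma mult_cscale: "u * cscale c v = cscale c (u * v)"
  unfolding cscale_def by (metis U_const_commute mult.assoc)

lemma linear_mult_left: "Vector_Spaces.linear cscale cscale (\<lambda>v. u * v)"
  by unfold_locales (auto simp: distrib_left mult_cscale)

lemma tens_add: "tens x (f + g) = tens x f + tens x g"
  by (rule sl12_eqI) (simp add: smult_add_right)

lemma tens_monom: "tens x (monom c m) = sl_scale [:c:] (cur x m)"
  by (rule sl12_eqI) (simp add: cur_def smult_monom mult.commute)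

lemma tens_0: "tens x 0 = 0" by (rule sl12_eqI) simp

lemma U_gen_tens: "U_gen (tens (basis_elt g) f) = (\<Sum>i\<le>degree f. cscale (coeff f i) (G g i))"
proof -
  have "tens x (sum h I) = (\<Sum>i\<in>I. tens x (h i))" for x h and I :: "nat set"
    by (induction I rule: infinite_finite_induct) (auto simp: tens_0 tens_add)
  then have "tens (basis_elt g) f = (\<Sum>i\<le>degree f. tens (basis_elt g) (monom (coeff f i) i))"
    by (metis poly_as_sum_of_monoms)
  then show ?thesis
    by (simp add: U_gen_sum tens_monom U_gen_scale G_def cscale_def)
qed

lemma U_gen_decomp: "U_gen A = (\<Sum>g\<in>UNIV. U_gen (tens (basis_elt g) (coef g A)))"
proof -
  have "A = (\<Sum>g\<in>UNIV. tens (basis_elt g) (coef g A))"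
    by (rule sl12_eqI) (simp add: coef_basis_elt if_distrib[of "\<lambda>x. Polynomial.smult x _"] cong: if_cong)
  then show ?thesis by (metis U_gen_sum)
qed

lemma U_word: "abs_Uenv (Poly_Mapping.single (FWord xs) c) = cscale c (prod_list (map U_gen xs))"
proof -
  have gen: "abs_Uenv (free_gen x) = U_gen x" for x by (simp add: U_gen.abs_eq)
  have "abs_Uenv (Poly_Mapping.single (FWord xs) 1) = prod_list (map U_gen xs)"
  proof (induction xs)
    case Nil show ?case by (simp add: one_Uenv.abs_eq zero_fword_def flip: single_one)
  next
    case (Cons x xs)
    have "Poly_Mapping.single (FWord (x # xs)) 1 = free_gen x * Poly_Mapping.single (FWord xs) (1::complex)"
      by (simp add: free_gen_def mult_single)
    then show ?case using Cons by (simp flip: times_Uenv.abs_eq add: gen)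
  qed
  moreover have "Poly_Mapping.single (FWord xs) c = free_const c * Poly_Mapping.single (FWord xs) 1"
    by (simp add: free_const_def mult_single)
  ultimately show ?thesis by (simp flip: times_Uenv.abs_eq add: cscale_def U_const.abs_eq)
qed

text \<open>A subspace that contains \<open>1\<close> and is stable under the currents of the eight basis elements is
everything: an arbitrary current is a combination of these, and every element is a combination of
products of currents.\<close>

lemma Uenv_induct:
  assumes S: "U.subspace S" and one: "1 \<in> S" and mult: "\<And>g m u. u \<in> S \<Longrightarrow> G g m * u \<in> S"
  shows "u \<in> S"
proof -
  have gen: "U_gen A * v \<in> S" if "v \<in> S" for A v
  proof -
    have "U_gen A * v = (\<Sum>g\<in>UNIV. \<Sum>i\<le>degree (coef g A). cscale (coeff (coef g A) i) (G g i * v))"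
      by (subst U_gen_decomp) (simp add: U_gen_tens sum_distrib_right cscale_def mult.assoc)
    also have "\<dots> \<in> S" using that by (intro U.subspace_sum[OF S] U.subspace_scale[OF S] mult)
    finally show ?thesis .
  qed
  have word: "prod_list (map U_gen xs) \<in> S" for xs
    by (induction xs) (auto intro: one gen)
  have "abs_Uenv p \<in> S" for p
  proof (induction p rule: poly_mapping_induct_single)
    case 1 then show ?case using U.subspace_0[OF S] by (simp add: zero_Uenv.abs_eq)
  next
    case (2 k c) then show ?case by (cases k) (auto simp: U_word intro: U.subspace_scale[OF S] word)
  next
    case (3 p q) then show ?case using U.subspace_add[OF S] by (simp flip: plus_Uenv.abs_eq)
  qed
  then show ?thesis by (rule Uenv.abs_induct)
qed

section \<open>Polynomials in the lowering currents\<close>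

text \<open>The currents of \<open>y_2\<close> commute, so their products are values of polynomials in variables \<open>y_j\<close>.
Monomials are indexed by multisets of indices, and the linear extension of a map on monomials is
used to define operators on polynomials.\<close>

definition lin_ext :: "(complex \<Rightarrow> 'b \<Rightarrow> 'b) \<Rightarrow> ('k \<Rightarrow> 'b) \<Rightarrow> ('k \<Rightarrow>\<^sub>0 complex) \<Rightarrow> 'b::ab_group_add" where
  "lin_ext sc F p = (\<Sum>k\<in>Poly_Mapping.keys p. sc (Poly_Mapping.lookup p k) (F k))"

context complex_space
begin

lemma lin_ext_superset:
  assumes "finite K" "Poly_Mapping.keys p \<subseteq> K"
  shows "lin_ext scale F p = (\<Sum>k\<in>K. scale (Poly_Mapping.lookup p k) (F k))"
  unfolding lin_ext_def using assms by (intro sum.mono_neutral_left) (auto simp: in_keys_iff)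

lemma lin_ext_add: "lin_ext scale F (p + q) = lin_ext scale F p + lin_ext scale F q"
proof -
  let ?K = "Poly_Mapping.keys p \<union> Poly_Mapping.keys q"
  show ?thesis
    using Poly_Mapping.keys_add[of p q]
    by (simp add: lin_ext_superset[of ?K] lookup_add scale_left_distrib sum.distrib)
qed

lemma lin_ext_single: "lin_ext scale F (Poly_Mapping.single k c) = scale c (F k)"
  by (subst lin_ext_superset[of "{k}"]) auto

lemma lin_ext_0: "lin_ext scale F 0 = 0"
  by (simp add: lin_ext_def)

lemma lin_ext_uminus: "lin_ext scale F (- p) = - lin_ext scale F p"
  using lin_ext_add[of F p "-p"] by (simp add: lin_ext_0 add_eq_0_iff)

lemma lin_ext_diff: "lin_ext scale F (p - q) = lin_ext scale F p - lin_ext scale F q"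
  using lin_ext_add[of F p "-q"] by (simp add: lin_ext_uminus)

end

text \<open>This is \<open>R(r,s)\<close>. The coefficients may lie in a noncommutative ring, since \<open>y\<close> will also be the
family of the elements \<open>y_2(j)\<close> of the enveloping algebra.\<close>

definition rcoef :: "(nat \<Rightarrow> 'a::ring_1) \<Rightarrow> nat \<Rightarrow> nat \<Rightarrow> 'a" where
  "rcoef y r s = fps_nth (Abs_fps y ^ r) s"

lemma rcoef_0: "rcoef y 0 s = (if s = 0 then 1 else 0)"
  by (simp add: rcoef_def)

lemma rcoef_Suc: "rcoef y (Suc r) s = (\<Sum>i\<le>s. y i * rcoef y r (s - i))"
  by (simp add: rcoef_def fps_mult_nth atLeast0AtMost)

lemma rcoef_1: "rcoef y (Suc 0) s = y s"
  by (simp add: rcoef_def)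

lemma rcoef_s0: "rcoef y r 0 = y 0 ^ r"
  by (induction r) (simp_all add: rcoef_Suc rcoef_0)

type_synonym ypoly = "nat multiset \<Rightarrow>\<^sub>0 complex"

definition ymon :: "nat multiset \<Rightarrow> ypoly" where "ymon M = Poly_Mapping.single M 1"
definition yv :: "nat \<Rightarrow> ypoly" where "yv j = ymon {#j#}"
definition yscale :: "complex \<Rightarrow> ypoly \<Rightarrow> ypoly" where "yscale c f = Poly_Mapping.single 0 c * f"

interpretation Y: complex_space yscale
  by unfold_locales
     (auto simp: yscale_def distrib_left distrib_right single_add mult_single single_one simp flip: mult.assoc)

lemma mult_yscale: "f * yscale c g = yscale c (f * g)"
  by (simp add: yscale_def mult.left_commute)

lemma ymon_add_mset: "ymon (add_mset j M) = yv j * ymon M"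
  by (simp add: ymon_def yv_def mult_single)

lemma ymon_empty: "ymon {#} = 1"
  by (simp add: ymon_def zero_multiset_def[symmetric] flip: single_one)

lemma single_ymon: "Poly_Mapping.single M c = yscale c (ymon M)"
  by (simp add: ymon_def yscale_def mult_single)

lemma ypoly_induct:
  assumes S: "Y.subspace S" and one: "1 \<in> S" and mult: "\<And>j f. f \<in> S \<Longrightarrow> yv j * f \<in> S"
  shows "f \<in> S"
proof (induction f rule: poly_mapping_induct_single)
  case 1 show ?case by (rule Y.subspace_0[OF S])
next
  case (2 M c)
  have "ymon M \<in> S" by (induction M) (auto simp: ymon_empty ymon_add_mset one mult)
  then show ?case by (simp add: single_ymon Y.subspace_scale[OF S])
next
  case (3 p q) then show ?case by (rule Y.subspace_add[OF S])
qed

lemma of_nat_ypoly: "of_nat k * f = yscale (of_nat k) f"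
proof (induction k)
  case 0 show ?case by simp
next
  case (Suc k) then show ?case by (simp add: distrib_right Y.scale_left_distrib)
qed

lemma of_int_ypoly: "of_int k * f = yscale (of_int k) f"
  by (cases k) (simp_all add: of_nat_ypoly[of "Suc _", simplified] of_nat_ypoly left_diff_distrib Y.scale_left_diff_distrib)

text \<open>The operators by which the currents of \<open>h_2\<close> and \<open>x_2\<close> act on the polynomials in the
currents of \<open>y_2\<close>, applied to a vector that \<open>x_2(m)\<close> kills and on which \<open>h_2(0)\<close> acts by \<open>n\<close>
and \<open>h_2(m)\<close>, \<open>m > 0\<close>, by zero. Up to the factor \<open>- 2\<close> and the constant \<open>n\<close>, the first is \<open>Hop m\<close>, the
derivation \<open>y_i \<mapsto> y_(i+m)\<close>; the second is \<open>Xop n m\<close>, which has order two.\<close>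

definition Hop :: "nat \<Rightarrow> ypoly \<Rightarrow> ypoly" where
  "Hop m = lin_ext yscale (\<lambda>M. \<Sum>i\<in>#M. ymon (add_mset (i + m) (M - {#i#})))"

definition Xop :: "nat \<Rightarrow> nat \<Rightarrow> ypoly \<Rightarrow> ypoly" where
  "Xop n m = lin_ext yscale (\<lambda>M. (if m = 0 then of_nat (n * count M 0) * ymon (M - {#0#}) else 0)
     - (\<Sum>i\<in>#M. Hop (i + m) (ymon (M - {#i#}))))"

lemma Hop_add: "Hop m (f + g) = Hop m f + Hop m g" by (simp add: Hop_def Y.lin_ext_add)
lemma Xop_add: "Xop n m (f + g) = Xop n m f + Xop n m g" by (simp add: Xop_def Y.lin_ext_add)
lemma Hop_0: "Hop m 0 = 0" by (simp add: Hop_def Y.lin_ext_0)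
lemma Xop_0: "Xop n m 0 = 0" by (simp add: Xop_def Y.lin_ext_0)

lemma yscale_single: "yscale c (Poly_Mapping.single M d) = Poly_Mapping.single M (c * d)"
  by (simp add: yscale_def mult_single)

lemma lin_ext_yscale: "lin_ext yscale F (yscale c f) = yscale c (lin_ext yscale F f)"
  by (induction f rule: poly_mapping_induct_single)
     (simp_all add: Y.lin_ext_0 Y.lin_ext_add Y.lin_ext_single yscale_single Y.scale_right_distrib)

lemma Hop_yscale: "Hop m (yscale c f) = yscale c (Hop m f)" by (simp add: Hop_def lin_ext_yscale)
lemma Xop_yscale: "Xop n m (yscale c f) = yscale c (Xop n m f)" by (simp add: Xop_def lin_ext_yscale)

lemma Hop_ymon: "Hop m (ymon M) = (\<Sum>i\<in>#M. ymon (add_mset (i + m) (M - {#i#})))"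
  unfolding Hop_def by (subst (1) ymon_def) (simp add: Y.lin_ext_single)
lemma Xop_ymon: "Xop n m (ymon M) = (if m = 0 then of_nat (n * count M 0) * ymon (M - {#0#}) else 0)
     - (\<Sum>i\<in>#M. Hop (i + m) (ymon (M - {#i#})))"
  unfolding Xop_def by (subst (1) ymon_def) (simp add: Y.lin_ext_single)

lemma diff_add_mset: "i \<in># M \<Longrightarrow> add_mset j M - {#i#} = add_mset j (M - {#i#})"
  by (metis add_mset_remove_trivial add_mset_commute insert_DiffM)

lemma Hop_mult_ymon: "Hop m (yv j * ymon M) = yv j * Hop m (ymon M) + yv (j + m) * ymon M"
proof -
  have "(\<Sum>i\<in>#M. ymon (add_mset (i + m) (add_mset j M - {#i#}))) =
        (\<Sum>i\<in>#M. yv j * ymon (add_mset (i + m) (M - {#i#})))"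
    by (intro arg_cong[of _ _ sum_mset] image_mset_cong) (simp add: diff_add_mset ymon_add_mset mult.left_commute)
  then show ?thesis
    unfolding ymon_add_mset[symmetric] Hop_ymon
    by (simp add: sum_mset_distrib_left ymon_add_mset)
qed

lemma Hop_mult: "Hop m (yv j * f) = yv j * Hop m f + yv (j + m) * f"
proof (induction f rule: poly_mapping_induct_single)
  case (2 M c) then show ?case
    by (simp add: single_ymon mult_yscale Hop_yscale Hop_mult_ymon Y.scale_right_distrib)
qed (simp_all add: Hop_0 Hop_add distrib_left)

lemma Xop_mult_ymon: "Xop n m (yv j * ymon M) =
  yv j * Xop n m (ymon M) - 2 * Hop (m + j) (ymon M) + (if m = 0 \<and> j = 0 then of_nat n * ymon M else 0)"
proof -
  have 1: "(\<Sum>i\<in>#M. Hop (i + m) (ymon (add_mset j M - {#i#}))) =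
     yv j * (\<Sum>i\<in>#M. Hop (i + m) (ymon (M - {#i#}))) + Hop (m + j) (ymon M)"
  proof -
    have "(\<Sum>i\<in>#M. Hop (i + m) (ymon (add_mset j M - {#i#}))) =
      (\<Sum>i\<in>#M. yv j * Hop (i + m) (ymon (M - {#i#})) + ymon (add_mset (i + (m + j)) (M - {#i#})))"
      by (intro arg_cong[of _ _ sum_mset] image_mset_cong)
        (simp add: diff_add_mset ymon_add_mset Hop_mult add.left_commute add.commute)
    then show ?thesis by (simp add: sum_mset.distrib sum_mset_distrib_left Hop_ymon)
  qed
  have 2: "of_nat (n * count (add_mset j M) 0) * ymon (add_mset j M - {#0#}) =
     yv j * (of_nat (n * count M 0) * ymon (M - {#0#})) + (if j = 0 then of_nat n * ymon M else 0)"
  proof (cases "j = 0")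
    case True
    show ?thesis
    proof (cases "0 \<in># M")
      case T: True
      then have "yv 0 * ymon (M - {#0#}) = ymon M" by (simp flip: ymon_add_mset)
      then have "yv 0 * (c * ymon (M - {#0#})) = c * ymon M" for c by (simp add: mult.left_commute)
      then show ?thesis using True by (simp add: distrib_left distrib_right)
    next
      case False
      then have "count M 0 = 0" by (simp add: not_in_iff)
      then show ?thesis using True by simp
    qed
  next
    case False
    then have "add_mset j M - {#0#} = add_mset j (M - {#0#})"
      by (simp add: diff_add_mset_swap)
    then show ?thesis using False by (simp add: ymon_add_mset mult.left_commute)
  qed
  show ?thesis
    unfolding ymon_add_mset[symmetric] Xop_ymon
    using 1 2 by (simp add: algebra_simps)
qed

lemma Xop_mult: "Xop n m (yv j * f) =
  yv j * Xop n m f - 2 * Hop (m + j) f + (if m = 0 \<and> j = 0 then of_nat n * f else 0)"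
proof (induction f rule: poly_mapping_induct_single)
  case (2 M c)
  show ?case
    by (simp add: single_ymon mult_yscale Xop_yscale Hop_yscale Xop_mult_ymon Y.scale_right_distrib
      Y.scale_right_diff_distrib)
qed (simp_all add: Hop_0 Hop_add Xop_0 Xop_add distrib_left)

lemma Hop_1: "Hop m 1 = 0" using Hop_ymon[of m "{#}"] by (simp add: ymon_empty)
lemma Xop_1: "Xop n m 1 = 0" using Xop_ymon[of n m "{#}"] by (simp add: ymon_empty)
lemma Hop_yv: "Hop m (yv j) = yv (j + m)" using Hop_mult[of m j 1] by (simp add: Hop_1)
lemma Xop_yv: "Xop n m (yv j) = (if m = 0 \<and> j = 0 then of_nat n else 0)"
  using Xop_mult[of n m j 1] by (simp add: Hop_1 Xop_1)

lemma Hop_sum: "Hop m (sum f I) = (\<Sum>i\<in>I. Hop m (f i))"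
  by (induction I rule: infinite_finite_induct) (auto simp: Hop_0 Hop_add)
lemma Xop_sum: "Xop n m (sum f I) = (\<Sum>i\<in>I. Xop n m (f i))"
  by (induction I rule: infinite_finite_induct) (auto simp: Xop_0 Xop_add)

lemma fps_nth_of_nat_mult: "fps_nth (of_nat r * f) s = of_nat r * fps_nth f s"
  for f :: "'a::ring_1 fps"
  by (induction r) (simp_all add: distrib_right)

lemma fps_nth_numeral_mult: "fps_nth (numeral r * f) s = numeral r * fps_nth f s"
  for f :: "'a::ring_1 fps"
  using fps_nth_of_nat_mult[of "numeral r" f s] by simp

abbreviation Yf :: "ypoly fps" where "Yf \<equiv> Abs_fps yv"

lemma Hop_rcoef:
  "Hop m (rcoef yv r s) = of_nat r * (\<Sum>i\<le>s. yv (i + m) * rcoef yv (r - 1) (s - i))"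
proof -
  define HF where "HF f = Abs_fps (\<lambda>s. Hop m (fps_nth f s))" for f
  let ?Z = "Abs_fps (\<lambda>i. yv (i + m))"
  have step: "HF (Yf * f) = Yf * HF f + ?Z * f" for f
    by (rule fps_ext) (simp add: HF_def fps_mult_nth Hop_sum Hop_mult sum.distrib)
  have "HF (Yf ^ r) = of_nat r * (?Z * Yf ^ (r - 1))"
  proof (induction r)
    case 0
    show ?case by (rule fps_ext) (simp add: HF_def Hop_1 Hop_0)
  next
    case (Suc r) then show ?case using step[of 1] by (cases r) (simp_all add: step algebra_simps)
  qed
  then have "fps_nth (HF (Yf ^ r)) s = fps_nth (of_nat r * (?Z * Yf ^ (r - 1))) s" by simp
  then show ?thesis
    unfolding fps_nth_of_nat_mult by (simp add: HF_def rcoef_def fps_mult_nth atLeast0AtMost)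
qed

text \<open>A recursion in the exponent for the generating function of \<open>Xop n m (R(r,s))\<close>. The term with
\<open>Hop\<close> is a double sum in which one factor depends only on the sum of two indices, and counting the ways to
split that sum produces the factor \<open>s + 1\<close>, that is, a derivative of the generating series.\<close>

lemma Xop_rcoef_Suc_fps:
  "Abs_fps (\<lambda>s. Xop n m (rcoef yv (Suc r) s)) = Yf * Abs_fps (\<lambda>s. Xop n m (rcoef yv r s))
     - 2 * of_nat r * Yf ^ (r - 1) * Abs_fps (\<lambda>s. of_nat (Suc s) * yv (s + m))
     + (if m = 0 then of_nat n * Yf ^ r else 0)"
proof (rule fps_ext)
  fix s
  have "(\<Sum>j\<le>s. Hop (m + j) (rcoef yv r (s - j))) =
     of_nat r * (\<Sum>j\<le>s. \<Sum>i\<le>s-j. yv (i + (m + j)) * rcoef yv (r - 1) (s - j - i))"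
    by (simp add: Hop_rcoef sum_distrib_left)
  also have "(\<Sum>j\<le>s. \<Sum>i\<le>s-j. yv (i + (m + j)) * rcoef yv (r - 1) (s - j - i)) =
      (\<Sum>k\<le>s. \<Sum>j\<le>k. yv (k + m) * rcoef yv (r - 1) (s - k))"
  proof -
    have "(\<Sum>(j, i)\<in>{(j, i). j + i \<le> s}. yv (i + (m + j)) * rcoef yv (r - 1) (s - j - i)) =
       (\<Sum>k\<le>s. \<Sum>j\<le>k. yv (k - j + (m + j)) * rcoef yv (r - 1) (s - j - (k - j)))"
      by (rule sum.triangle_reindex_eq)
    moreover have "(\<Sum>(j, i)\<in>{(j, i). j + i \<le> s}. yv (i + (m + j)) * rcoef yv (r - 1) (s - j - i)) =
      (\<Sum>(j, i)\<in>(SIGMA j:{..s}. {..s-j}). yv (i + (m + j)) * rcoef yv (r - 1) (s - j - i))"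
      by (rule sum.cong) auto
    ultimately show ?thesis by (simp add: sum.Sigma add.commute)
  qed
  also have "\<dots> = (\<Sum>k\<le>s. (of_nat (Suc k) * yv (k + m)) * rcoef yv (r - 1) (s - k))"
    by (simp add: mult.assoc)
  also have "\<dots> = fps_nth (Abs_fps (\<lambda>s. of_nat (Suc s) * yv (s + m)) * Yf ^ (r - 1)) s"
    by (simp add: fps_mult_nth rcoef_def atLeast0AtMost)
  finally have H: "(\<Sum>j\<le>s. Hop (m + j) (rcoef yv r (s - j))) =
     of_nat r * fps_nth (Yf ^ (r - 1) * Abs_fps (\<lambda>s. of_nat (Suc s) * yv (s + m))) s"
    by (simp add: mult.commute)
  have D: "(\<Sum>j\<le>s. if m = 0 \<and> j = 0 then of_nat n * rcoef yv r (s - j) else 0) =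
    (if m = 0 then of_nat n * rcoef yv r s else 0)"
    by (auto simp: if_distrib sum.delta cong: if_cong)
  have "fps_nth (2 * of_nat r * Yf ^ (r - 1) * Abs_fps (\<lambda>s. of_nat (Suc s) * yv (s + m))) s =
     2 * (of_nat r * fps_nth (Yf ^ (r - 1) * Abs_fps (\<lambda>s. of_nat (Suc s) * yv (s + m))) s)"
    by (simp only: fps_nth_of_nat_mult fps_nth_numeral_mult mult.assoc)
  moreover have "fps_nth (of_nat n * Yf ^ r) s = of_nat n * rcoef yv r s"
    by (simp only: fps_nth_of_nat_mult rcoef_def)
  ultimately show "fps_nth (Abs_fps (\<lambda>s. Xop n m (rcoef yv (Suc r) s))) s =
    fps_nth (Yf * Abs_fps (\<lambda>s. Xop n m (rcoef yv r s))
     - 2 * of_nat r * Yf ^ (r - 1) * Abs_fps (\<lambda>s. of_nat (Suc s) * yv (s + m))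
     + (if m = 0 then of_nat n * Yf ^ r else 0)) s"
    using H D
    by (auto simp: rcoef_Suc Xop_sum Xop_mult sum.distrib sum_subtractf fps_mult_nth[of Yf]
       atLeast0AtMost simp flip: sum_distrib_left)
qed

lemma Yf_deriv: "fps_deriv Yf = Abs_fps (\<lambda>s. of_nat (Suc s) * yv (s + 1))"
  by (rule fps_ext) simp

lemma deriv_power_self: "f * fps_deriv (f ^ r) = of_nat r * f ^ r * fps_deriv f"
  for f :: "'a::comm_ring_1 fps"
proof (induction r)
  case (Suc r)
  have "f * fps_deriv (f ^ Suc r) = f * (f * fps_deriv (f ^ r)) + f * (fps_deriv f * f ^ r)"
    by (simp add: algebra_simps)
  then show ?case unfolding Suc by (simp add: algebra_simps)
qed simp

text \<open>The identity behind Garland's relations: \<open>Xop n 1\<close> maps \<open>R(r+1,s)\<close> to a nonzero multiple of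
\<open>R(r,s+1)\<close>. On generating functions it says that \<open>Xop n 1\<close> sends \<open>Y^(r+1)\<close> to \<open>- (r+1)\<close> times the
derivative of \<open>Y^r\<close>.\<close>

lemma Xop1_rcoef: "Xop n 1 (rcoef yv (Suc r) s) = - of_nat (Suc r) * of_nat (Suc s) * rcoef yv r (Suc s)"
proof -
  have "Abs_fps (\<lambda>s. Xop n 1 (rcoef yv (Suc r) s)) = - of_nat (Suc r) * fps_deriv (Yf ^ r)"
  proof (induction r)
    case 0
    have "Abs_fps (\<lambda>s. Xop n M (rcoef yv 0 s)) = 0" for M
      by (rule fps_ext) (simp add: rcoef_0 Xop_1 Xop_0)
    then show ?case unfolding Xop_rcoef_Suc_fps by simp
  next
    case (Suc r)
    have alg: "y * (- (1 + k) * e) - 2 * (1 + k) * f * d = - (2 + k) * (y * e + d * f)"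
      if "y * e = k * f * d" for y e k f d :: "ypoly fps"
    proof -
      have "y * (- (1 + k) * e) = - (1 + k) * (y * e)" by (simp add: algebra_simps)
      then show ?thesis unfolding that by (simp add: algebra_simps)
    qed
    show ?case
      unfolding Xop_rcoef_Suc_fps[of n 1 "Suc r"] Suc Yf_deriv[symmetric]
      using alg[OF deriv_power_self[of Yf r]] by (simp add: mult.commute add.commute)
  qed
  then have "fps_nth (Abs_fps (\<lambda>s. Xop n 1 (rcoef yv (Suc r) s))) s = fps_nth (- of_nat (Suc r) * fps_deriv (Yf ^ r)) s"
    by simp
  also have "\<dots> = - of_nat (Suc r) * fps_nth (fps_deriv (Yf ^ r)) s"
    by (simp only: fps_nth_of_nat_mult mult_minus_left fps_neg_nth)
  finally show ?thesis by (simp add: rcoef_def mult.assoc)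
qed

lemma Xop0_rcoef: "Xop n 0 (rcoef yv (Suc r) s) = of_int (int (Suc r) * (int n - int r - int s)) * rcoef yv r s"
proof -
  have Z: "Abs_fps (\<lambda>s. of_nat (Suc s) * yv (s + 0)) = Yf + fps_X * fps_deriv Yf"
    by (rule fps_ext) (auto simp: algebra_simps)
  have "Abs_fps (\<lambda>s. Xop n 0 (rcoef yv (Suc r) s)) =
     of_nat (Suc r) * ((of_nat n - of_nat r) * Yf ^ r - fps_X * fps_deriv (Yf ^ r))"
  proof (induction r)
    case 0
    have "Abs_fps (\<lambda>s. Xop n M (rcoef yv 0 s)) = 0" for M
      by (rule fps_ext) (simp add: rcoef_0 Xop_1 Xop_0)
    then show ?case unfolding Xop_rcoef_Suc_fps by simp
  next
    case (Suc r)
    have alg: "y * ((1 + k) * ((c - k) * f - x * e)) - 2 * (1 + k) * f * (y + x * d) + c * (y * f)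
        = (2 + k) * ((c - (1 + k)) * (y * f) - x * (y * e + d * f))"
      if "y * e = k * f * d" for y e k f d c x :: "ypoly fps"
    proof -
      have "y * ((1 + k) * ((c - k) * f - x * e)) = (1 + k) * ((c - k) * (y * f) - x * (y * e))"
        by (simp add: algebra_simps)
      then show ?thesis unfolding that by (simp add: algebra_simps)
    qed
    show ?case
      unfolding Xop_rcoef_Suc_fps[of n 0 "Suc r"] Suc Z
      using alg[OF deriv_power_self[of Yf r], of "of_nat n" fps_X] by (simp add: mult.commute add.commute)
  qed
  then have "fps_nth (Abs_fps (\<lambda>s. Xop n 0 (rcoef yv (Suc r) s))) s =
     fps_nth (of_nat (Suc r) * ((of_nat n - of_nat r) * Yf ^ r - fps_X * fps_deriv (Yf ^ r))) s"
    by simp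
  also have "\<dots> = of_nat (Suc r) * fps_nth ((of_nat n - of_nat r) * Yf ^ r - fps_X * fps_deriv (Yf ^ r)) s"
    by (simp only: fps_nth_of_nat_mult)
  also have "fps_nth ((of_nat n - of_nat r) * Yf ^ r - fps_X * fps_deriv (Yf ^ r)) s =
      (of_nat n - of_nat r) * rcoef yv r s - of_nat s * rcoef yv r s"
    by (cases s) (simp_all add: rcoef_def left_diff_distrib fps_nth_of_nat_mult)
  finally show ?thesis by (simp add: algebra_simps)
qed

section \<open>Polynomials modulo power coefficient relations\<close>

text \<open>For a family of pairwise commuting elements \<open>y\<close>, \<open>ev y\<close> is the algebra map with \<open>y_j \<mapsto> y j\<close>.
Without commutativity it is only the linear map given by sorted products, which keeps the definition
unconditional.\<close>

locale complex_algebra = complex_space scale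
  for scale :: "complex \<Rightarrow> 'b::ring_1 \<Rightarrow> 'b" +
  assumes mult_scale: "x * scale c y = scale c (x * y)"
    and scale_mult: "scale c x * y = scale c (x * y)"
begin

definition ev :: "(nat \<Rightarrow> 'b) \<Rightarrow> ypoly \<Rightarrow> 'b" where
  "ev y = lin_ext scale (\<lambda>M. prod_list (map y (sorted_list_of_multiset M)))"

lemma ev_add: "ev y (f + g) = ev y f + ev y g" by (simp add: ev_def lin_ext_add)
lemma ev_0: "ev y 0 = 0" by (simp add: ev_def lin_ext_0)
lemma ev_sum: "ev y (sum f I) = (\<Sum>i\<in>I. ev y (f i))"
  by (induction I rule: infinite_finite_induct) (auto simp: ev_0 ev_add)
lemma ev_single: "ev y (Poly_Mapping.single M c) = scale c (prod_list (map y (sorted_list_of_multiset M)))"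
  by (simp add: ev_def lin_ext_single)
lemma ev_1: "ev y 1 = 1"
  using ev_single[of y "{#}" 1] by (simp add: ymon_empty flip: ymon_def)

lemma ev_yscale: "ev y (yscale c f) = scale c (ev y f)"
  by (induction f rule: poly_mapping_induct_single)
     (simp_all add: ev_0 ev_add ev_single yscale_single Y.scale_right_distrib scale_right_distrib)

lemma ev_mult:
  assumes comm: "\<And>i j. y i * y j = y j * y i"
  shows "ev y (yv j * f) = y j * ev y f"
proof (induction f rule: poly_mapping_induct_single)
  case (2 M c)
  have "prod_list (map y (insort j xs)) = y j * prod_list (map y xs)" for xs
  proof (induction xs)
    case (Cons x xs)
    have "y x * (y j * p) = y j * (y x * p)" for p by (metis comm mult.assoc)
    then show ?case using Cons by simp
  qed simp
  then show ?case
    by (simp add: yv_def ymon_def mult_single ev_single mult_scale)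
qed (simp_all add: ev_0 ev_add distrib_left)

lemma ev_rcoef:
  assumes comm: "\<And>i j. y i * y j = y j * y i"
  shows "ev y (rcoef yv r s) = rcoef y r s"
proof (induction r arbitrary: s)
  case 0 show ?case by (simp add: rcoef_0 ev_0 ev_1)
next
  case (Suc r) then show ?case by (simp add: rcoef_Suc ev_sum ev_mult[OF comm])
qed

end

interpretation Y: complex_algebra yscale
  by unfold_locales (simp_all add: mult_yscale, simp add: yscale_def mult.assoc)

definition yideal :: "ypoly set \<Rightarrow> bool" where
  "yideal J \<longleftrightarrow> Y.subspace J \<and> (\<forall>j. \<forall>f\<in>J. yv j * f \<in> J)"

lemma yideal_subspace: "yideal J \<Longrightarrow> Y.subspace J" by (simp add: yideal_def)

lemma yideal_mult:
  assumes "yideal J" "f \<in> J" shows "g * f \<in> J"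
proof -
  have "g \<in> {g. g * f \<in> J}"
    by (rule ypoly_induct)
       (use assms in \<open>auto simp: yideal_def Y.subspace_def distrib_right mult.assoc yscale_def\<close>)
  then show ?thesis by simp
qed

lemma yideal_0: "yideal J \<Longrightarrow> 0 \<in> J"
  and yideal_add: "yideal J \<Longrightarrow> f \<in> J \<Longrightarrow> g \<in> J \<Longrightarrow> f + g \<in> J"
  and yideal_diff: "yideal J \<Longrightarrow> f \<in> J \<Longrightarrow> g \<in> J \<Longrightarrow> f - g \<in> J"
  and yideal_sum: "yideal J \<Longrightarrow> (\<And>i. i \<in> I \<Longrightarrow> h i \<in> J) \<Longrightarrow> sum h I \<in> J"
  unfolding yideal_def
  by (blast intro: Y.subspace_0 Y.subspace_add Y.subspace_diff Y.subspace_sum)+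

lemma yideal_of_int_cancel:
  assumes "yideal J" "of_int k * f \<in> J" "k \<noteq> 0"
  shows "f \<in> J"
proof -
  have "yscale (inverse (of_int k)) (yscale (of_int k) f) \<in> J"
    by (rule Y.subspace_scale[OF yideal_subspace[OF assms(1)]]) (use assms(2) in \<open>simp add: of_int_ypoly\<close>)
  then show ?thesis using assms(3) by simp
qed

text \<open>The ideal generated by Garland's relations for \<open>n\<close> and by the variables of index at least \<open>N\<close>. It is
stable under the operators \<open>Hop m\<close> and, for small \<open>m\<close>, under \<open>Xop n m\<close>; this turns representation theory of
\<open>sl_2\<close> into identities that hold in every ideal with these generators.\<close>

inductive_set garland_ideal :: "nat \<Rightarrow> nat \<Rightarrow> ypoly set" for n N where
  rcoef: "1 \<le> r \<Longrightarrow> n < r + s \<Longrightarrow> rcoef yv r s \<in> garland_ideal n N"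
| var: "N \<le> j \<Longrightarrow> yv j \<in> garland_ideal n N"
| zero: "0 \<in> garland_ideal n N"
| add: "f \<in> garland_ideal n N \<Longrightarrow> g \<in> garland_ideal n N \<Longrightarrow> f + g \<in> garland_ideal n N"
| scale: "f \<in> garland_ideal n N \<Longrightarrow> yscale c f \<in> garland_ideal n N"
| mult: "f \<in> garland_ideal n N \<Longrightarrow> yv j * f \<in> garland_ideal n N"

lemma yideal_garland: "yideal (garland_ideal n N)"
  unfolding yideal_def Y.subspace_def by (auto intro: garland_ideal.intros)

lemma garland_ideal_least:
  assumes "yideal J" "\<And>r s. 1 \<le> r \<Longrightarrow> n < r + s \<Longrightarrow> rcoef yv r s \<in> J" "\<And>j. N \<le> j \<Longrightarrow> yv j \<in> J"
  shows "garland_ideal n N \<subseteq> J"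
proof
  fix f assume "f \<in> garland_ideal n N"
  then show "f \<in> J"
    by induction (use assms in \<open>auto simp: yideal_def Y.subspace_def\<close>)
qed

text \<open>\<open>Hop m\<close> of \<open>R(r,s)\<close> is a multiple of a convolution that misses the first \<open>m\<close> terms of
\<open>R(r,s+m)\<close>; the missing terms lie in the ideal themselves.\<close>

lemma garland_Hop:
  assumes "f \<in> garland_ideal n N"
  shows "Hop m f \<in> garland_ideal n N"
  using assms
proof (induction arbitrary: m)
  case (rcoef r s)
  note id = yideal_garland[of n N]
  let ?J = "garland_ideal n N"
  have "(\<Sum>i\<le>s. yv (i + m) * rcoef yv (r - 1) (s - i)) =
        (\<Sum>i\<in>{m..s+m}. yv i * rcoef yv (r - 1) (s + m - i))"
    by (rule sum.reindex_bij_witness[of _ "\<lambda>i. i - m" "\<lambda>i. i + m"]) auto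
  also have "\<dots> = (\<Sum>i\<le>s + m. yv i * rcoef yv (r - 1) (s + m - i))
      - (\<Sum>i<m. yv i * rcoef yv (r - 1) (s + m - i))"
  proof -
    have "{..s+m} = {..<m} \<union> {m..s+m}" by auto
    then show ?thesis by (subst \<open>{..s+m} = _\<close>, subst sum.union_disjoint) auto
  qed
  also have "(\<Sum>i\<le>s + m. yv i * rcoef yv (r - 1) (s + m - i)) = rcoef yv r (s + m)"
    using rcoef by (cases r) (auto simp: rcoef_Suc)
  finally have eq: "(\<Sum>i\<le>s. yv (i + m) * rcoef yv (r - 1) (s - i)) =
     rcoef yv r (s + m) - (\<Sum>i<m. yv i * rcoef yv (r - 1) (s + m - i))" .
  have "yv i * rcoef yv (r - 1) (s + m - i) \<in> ?J" if "i < m" for i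
  proof (cases "r = 1")
    case True then show ?thesis using that by (simp add: rcoef_0 garland_ideal.zero)
  next
    case False
    then show ?thesis using rcoef that by (intro garland_ideal.mult garland_ideal.rcoef) auto
  qed
  then have "(\<Sum>i\<le>s. yv (i + m) * rcoef yv (r - 1) (s - i)) \<in> ?J"
    unfolding eq using rcoef by (intro yideal_diff[OF id] yideal_sum[OF id] garland_ideal.rcoef) auto
  then show ?case unfolding Hop_rcoef by (rule yideal_mult[OF id])
next
  case (var j) then show ?case by (simp add: Hop_yv garland_ideal.var)
qed (auto simp: Hop_0 Hop_add Hop_yscale Hop_mult intro: garland_ideal.intros yideal_mult[OF yideal_garland])

lemma garland_Xop:
  assumes "f \<in> garland_ideal n N" "m \<le> 1" "1 \<le> N"
  shows "Xop n m f \<in> garland_ideal n N"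
  using assms(1)
proof induction
  case (rcoef r s)
  then obtain q where r: "r = Suc q" by (cases r) auto
  note id = yideal_garland[of n N]
  show ?case
  proof (cases "m = 0")
    case True
    show ?thesis
    proof (cases "int n - int q - int s = 0")
      case True
      then show ?thesis using \<open>m = 0\<close> by (simp add: r Xop0_rcoef garland_ideal.zero del: of_nat_Suc)
    next
      case False
      then have "q + s > n" using rcoef r by auto
      moreover have "rcoef yv q s = 0" if "q = 0" using that \<open>q + s > n\<close> by (auto simp: rcoef_0)
      ultimately have "rcoef yv q s \<in> garland_ideal n N"
        by (cases q) (auto intro: garland_ideal.intros)
      then show ?thesis unfolding r \<open>m = 0\<close> Xop0_rcoef by (rule yideal_mult[OF id])
    qed
  next
    case False
    then have m: "m = 1" using assms by simp
    have "rcoef yv q (Suc s) \<in> garland_ideal n N"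
      using rcoef r by (cases q) (auto simp: rcoef_0 intro: garland_ideal.intros)
    then show ?thesis unfolding r m Xop1_rcoef by (rule yideal_mult[OF id])
  qed
next
  case (var j) then show ?case using assms by (auto simp: Xop_yv garland_ideal.zero)
next
  case (mult f j)
  then show ?case
    unfolding Xop_mult
    by (intro yideal_add yideal_diff yideal_garland yideal_mult[OF yideal_garland])
       (auto intro: garland_ideal.intros garland_Hop yideal_mult[OF yideal_garland])
qed (auto simp: Xop_0 Xop_add Xop_yscale intro: garland_ideal.intros)

lemma Hop_pow_degree: "Hop 0 (yv 0 ^ M * yv j ^ b) = of_nat (M + b) * (yv 0 ^ M * yv j ^ b)"
proof (induction M)
  case 0
  show ?case by (induction b) (simp_all add: Hop_1 Hop_mult algebra_simps)
next
  case (Suc M) then show ?case by (simp add: Hop_mult mult.assoc algebra_simps)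
qed

lemma Xop_weight:
  "Xop n 0 (yv 0 ^ M * yv j ^ b) = yv 0 ^ M * Xop n 0 (yv j ^ b)
     + of_int (int M * (int n - (int M - 1) - 2 * int b)) * (yv 0 ^ (M - 1) * yv j ^ b)"
proof (induction M)
  case (Suc M)
  have "of_int (int M * (int n - (int M - 1) - 2 * int b)) * (yv 0 * (yv 0 ^ (M - 1) * yv j ^ b)) =
    of_int (int M * (int n - (int M - 1) - 2 * int b)) * (yv 0 ^ M * yv j ^ b)"
    by (cases M) (auto simp: mult.assoc)
  then show ?case
    using Suc by (simp add: Xop_mult mult.assoc Hop_pow_degree) (simp add: algebra_simps)
qed simp

lemma Xop_top_power:
  assumes "2 \<le> N"
  shows "Xop n 0 (yv (N - 1) ^ b) \<in> garland_ideal n N"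
proof (induction b)
  case 0 show ?case by (simp add: Xop_1 garland_ideal.zero)
next
  case (Suc b)
  have "Hop (N - 1) (yv (N - 1) ^ b) \<in> garland_ideal n N" for b
  proof (induction b)
    case 0 show ?case by (simp add: Hop_1 garland_ideal.zero)
  next
    case (Suc b)
    have "yv (N - 1 + (N - 1)) * yv (N - 1) ^ b \<in> garland_ideal n N"
      using assms garland_ideal.var[of N "N - 1 + (N - 1)" n] yideal_mult[OF yideal_garland]
      by (metis (no_types, lifting) add_le_mono diff_add_inverse le_add_diff_inverse le_diff_conv mult.commute nat_le_linear one_add_one trans_le_add1)
    then show ?case using Suc by (auto simp: Hop_mult intro: garland_ideal.intros)
  qed
  then show ?case
    using Suc assms by (auto simp: Xop_mult intro: garland_ideal.mult yideal_diff[OF yideal_garland] yideal_mult[OF yideal_garland])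
qed

text \<open>Integrability: modulo the ideal, \<open>y_(N-1)^b\<close> is a vector killed by \<open>Xop n 0\<close> of weight \<open>n - 2 b\<close>, so the
\<open>sl_2\<close>-string through it under \<open>y_0\<close> has length at most \<open>n - 2 b + 1\<close>. The induction descends from
\<open>y_0^(n+1)\<close>, where Garland's relation applies directly.\<close>

lemma garland_integrable:
  assumes N: "2 \<le> N" and M: "n < M + 2 * b"
  shows "yv 0 ^ M * yv (N - 1) ^ b \<in> garland_ideal n N"
  using M
proof (induction "Suc n - M" arbitrary: M)
  case 0
  then have "rcoef yv M 0 \<in> garland_ideal n N" by (intro garland_ideal.rcoef) auto
  then show ?case using yideal_mult[OF yideal_garland] by (simp add: rcoef_s0 mult.commute)
next
  case (Suc k)
  note id = yideal_garland[of n N]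
  let ?f = "yv 0 ^ M * yv (N - 1) ^ b"
  have "yv 0 ^ Suc M * yv (N - 1) ^ b \<in> garland_ideal n N"
    using Suc by (intro Suc(1)) auto
  then have "Xop n 0 (yv 0 ^ Suc M * yv (N - 1) ^ b) \<in> garland_ideal n N"
    using N by (intro garland_Xop) auto
  moreover have "yv 0 ^ Suc M * Xop n 0 (yv (N - 1) ^ b) \<in> garland_ideal n N"
    by (intro yideal_mult[OF id] Xop_top_power N)
  ultimately have "of_int (int (Suc M) * (int n - (int (Suc M) - 1) - 2 * int b)) * (yv 0 ^ (Suc M - 1) * yv (N - 1) ^ b) \<in> garland_ideal n N"
    using yideal_diff[OF id] unfolding Xop_weight by fastforce
  then show ?case
    using Suc(3) by (intro yideal_of_int_cancel[OF id, of "int (Suc M) * (int n - (int (Suc M) - 1) - 2 * int b)" ?f]) auto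
qed

text \<open>\<open>Xop n 1\<close> commutes with multiplication by \<open>y_(N-1)\<close> modulo the ideal, since the correction \<open>Hop N\<close>
only produces variables of index at least \<open>N\<close>.\<close>

lemma Xop1_top_power:
  assumes "2 \<le> N"
  shows "Xop n 1 (yv (N - 1) ^ b * f) - yv (N - 1) ^ b * Xop n 1 f \<in> garland_ideal n N"
proof (induction b)
  case 0 show ?case by (simp add: garland_ideal.zero)
next
  case (Suc b)
  note id = yideal_garland[of n N]
  have H: "Hop N g \<in> garland_ideal n N" for g
  proof -
    have "g \<in> {g. Hop N g \<in> garland_ideal n N}"
    proof (rule ypoly_induct)
      show "Y.subspace {g. Hop N g \<in> garland_ideal n N}"
        by (auto simp: Y.subspace_def Hop_0 Hop_add Hop_yscale intro: garland_ideal.intros)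
      fix j f assume "f \<in> {g. Hop N g \<in> garland_ideal n N}"
      moreover have "yv (j + N) * f \<in> garland_ideal n N"
        using yideal_mult[OF id garland_ideal.var[of N "j + N"], of f] by (simp add: mult.commute)
      ultimately show "yv j * f \<in> {g. Hop N g \<in> garland_ideal n N}"
        by (auto simp: Hop_mult intro: garland_ideal.intros)
    qed (simp add: Hop_1 garland_ideal.zero)
    then show ?thesis by simp
  qed
  have N1: "1 + (N - 1) = N" using assms by simp
  have "Xop n 1 (yv (N - 1) ^ Suc b * f) - yv (N - 1) ^ Suc b * Xop n 1 f =
     yv (N - 1) * (Xop n 1 (yv (N - 1) ^ b * f) - yv (N - 1) ^ b * Xop n 1 f) - 2 * Hop N (yv (N - 1) ^ b * f)"
    using Xop_mult[of n 1 "N - 1" "yv (N - 1) ^ b * f"] N1 by (simp add: algebra_simps)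
  also have "\<dots> \<in> garland_ideal n N"
    by (intro yideal_diff[OF id] garland_ideal.mult Suc yideal_mult[OF id] H)
  finally show ?case .
qed

text \<open>Dividing by \<open>y_(N-1)^b\<close> improves Garland's relations for \<open>n\<close> to those for \<open>n - 2 b\<close>: Garland's
argument starts from \<open>garland_integrable\<close> in place of the power of \<open>y_0\<close>.\<close>

lemma garland_top_power:
  assumes N: "2 \<le> N"
  shows "n < r + s + 2 * b \<Longrightarrow> yv (N - 1) ^ b * rcoef yv r s \<in> garland_ideal n N"
proof (induction s arbitrary: r)
  case 0
  then show ?case using garland_integrable[OF N, of n r b] by (simp add: rcoef_s0 mult.commute)
next
  case (Suc s)
  note id = yideal_garland[of n N]
  have "yv (N - 1) ^ b * rcoef yv (Suc r) s \<in> garland_ideal n N"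
    using Suc by auto
  then have "Xop n 1 (yv (N - 1) ^ b * rcoef yv (Suc r) s) \<in> garland_ideal n N"
    using N by (intro garland_Xop) auto
  from yideal_diff[OF id this Xop1_top_power[OF N, of n b "rcoef yv (Suc r) s"]]
  have "yv (N - 1) ^ b * Xop n 1 (rcoef yv (Suc r) s) \<in> garland_ideal n N" by simp
  moreover have "yv (N - 1) ^ b * Xop n 1 (rcoef yv (Suc r) s) =
      of_int (- (int (Suc r) * int (Suc s))) * (yv (N - 1) ^ b * rcoef yv r (Suc s))"
  proof -
    have c: "of_int (- (int (Suc r) * int (Suc s))) = (- of_nat (Suc r) * of_nat (Suc s) :: ypoly)"
      by (simp del: of_nat_Suc)
    show ?thesis unfolding Xop1_rcoef c by (rule mult.left_commute)
  qed
  ultimately have "of_int (- (int (Suc r) * int (Suc s))) * (yv (N - 1) ^ b * rcoef yv r (Suc s)) \<in> garland_ideal n N"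
    by (simp only:)
  then show ?case by (rule yideal_of_int_cancel[OF id]) simp
qed

text \<open>The number of boxes in the first \<open>r\<close> columns of the diagram with rows \<open>\<mu> i\<close>, \<open>i < N\<close>. The
relations of a partition require \<open>R(r,s)\<close> to vanish as soon as \<open>r + s\<close> exceeds it; the predicate is a
parameter because the vanishing is wanted in ideals of polynomials and, applied to a vector, modulo
subspaces of the enveloping algebra.\<close>

definition truncated_size :: "nat \<Rightarrow> (nat \<Rightarrow> nat) \<Rightarrow> nat \<Rightarrow> nat" where
  "truncated_size N \<mu> r = (\<Sum>i<N. min r (\<mu> i))"

definition cv_rels :: "nat \<Rightarrow> (nat \<Rightarrow> nat) \<Rightarrow> (nat \<Rightarrow> nat \<Rightarrow> bool) \<Rightarrow> bool" where
  "cv_rels N \<mu> P \<longleftrightarrow> (\<forall>r s. 1 \<le> r \<longrightarrow> truncated_size N \<mu> r < s + r \<longrightarrow> P r s)"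

lemma cv_relsD: "cv_rels N \<mu> P \<Longrightarrow> 1 \<le> r \<Longrightarrow> truncated_size N \<mu> r < s + r \<Longrightarrow> P r s"
  by (simp add: cv_rels_def)

lemma truncated_size_le:
  assumes "k \<le> N"
  shows "truncated_size N \<mu> r \<le> k * r + (\<Sum>i\<in>{k..<N}. \<mu> i)"
proof -
  have "truncated_size N \<mu> r = (\<Sum>i<k. min r (\<mu> i)) + (\<Sum>i\<in>{k..<N}. min r (\<mu> i))"
    unfolding truncated_size_def using assms
    by (subst sum.union_disjoint[symmetric]) (auto intro: sum.cong)
  also have "\<dots> \<le> (\<Sum>i<k. r) + (\<Sum>i\<in>{k..<N}. \<mu> i)"
    by (intro add_mono sum_mono) auto
  finally show ?thesis by simp
qed

lemma truncated_size_eq: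
  assumes anti: "\<And>i j. i \<le> j \<Longrightarrow> j < N \<Longrightarrow> \<mu> j \<le> \<mu> i"
  obtains k where "k \<le> N" "truncated_size N \<mu> r = k * r + (\<Sum>i\<in>{k..<N}. \<mu> i)"
proof -
  define k where "k = (LEAST i. i = N \<or> \<mu> i < r)"
  have k: "k = N \<or> \<mu> k < r" unfolding k_def by (rule LeastI[of _ N]) simp
  have kN: "k \<le> N" unfolding k_def by (rule Least_le) simp
  have less: "r \<le> \<mu> i" if "i < k" for i
    using not_less_Least[of i "\<lambda>i. i = N \<or> \<mu> i < r"] that by (auto simp: k_def)
  have ge: "\<mu> i \<le> r" if "i \<in> {k..<N}" for i
    using k anti[of k i] that by auto
  have "truncated_size N \<mu> r = (\<Sum>i<k. min r (\<mu> i)) + (\<Sum>i\<in>{k..<N}. min r (\<mu> i))"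
    unfolding truncated_size_def using kN
    by (subst sum.union_disjoint[symmetric]) (auto intro: sum.cong)
  also have "(\<Sum>i<k. min r (\<mu> i)) = (\<Sum>i<k. r)" using less by (intro sum.cong) (auto simp: min_def)
  also have "(\<Sum>i\<in>{k..<N}. min r (\<mu> i)) = (\<Sum>i\<in>{k..<N}. \<mu> i)"
    using ge by (intro sum.cong) (simp_all add: min.absorb2)
  finally show ?thesis using that kN by simp
qed

lemma fps_low_power_nth:
  assumes "\<And>i. k \<le> i \<Longrightarrow> fps_nth A i = 0" "k * m < d + m"
  shows "fps_nth (A ^ m) d = (0 :: 'a::ring_1)"
  using assms(2)
proof (induction m arbitrary: d)
  case 0 then show ?case by simp
next
  case (Suc m)
  have "fps_nth A i * fps_nth (A ^ m) (d - i) = 0" for i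
  proof (cases "k \<le> i")
    case True then show ?thesis using assms(1) by simp
  next
    case False
    then have "k * m < d - i + m" using Suc.prems by auto
    then show ?thesis using Suc.IH by simp
  qed
  then show ?case by (simp add: fps_mult_nth)
qed

lemma fps_mult_low_nth_in:
  assumes J: "yideal J" and A: "\<And>i. k \<le> i \<Longrightarrow> fps_nth A i = 0"
    and Q: "\<And>t. k * i + n < t + i \<Longrightarrow> fps_nth Q t \<in> J"
    and s: "k * (i + m) + n < s + (i + m)"
  shows "fps_nth (A ^ m * Q) s \<in> J"
  unfolding fps_mult_nth
proof (rule yideal_sum[OF J])
  fix d assume d: "d \<in> {0..s}"
  show "fps_nth (A ^ m) d * fps_nth Q (s - d) \<in> J"
  proof (cases "k * m < d + m")
    case True then show ?thesis using fps_low_power_nth[of k A m d] A yideal_0[OF J] by simp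
  next
    case False
    then have "k * i + n < s - d + i" using s d by (simp add: distrib_left)
    then show ?thesis using Q yideal_mult[OF J] by blast
  qed
qed

lemma binomial_nth_in:
  assumes J: "yideal J" and A: "\<And>i. k \<le> i \<Longrightarrow> fps_nth A i = 0"
    and Q: "\<And>i t. 1 \<le> i \<Longrightarrow> k * i + n < t + i \<Longrightarrow> fps_nth (Q ^ i) t \<in> J"
    and s: "k * r + n < s + r"
  shows "fps_nth ((A + Q) ^ r) s \<in> J"
proof -
  have "fps_nth (Q ^ i) t \<in> J" if "k * i + n < t + i" for i t
    using Q[of i t] that yideal_0[OF J] by (cases i) auto
  then have "fps_nth (A ^ m * Q ^ i) s \<in> J" if "i + m = r" for i m
    using that s by (intro fps_mult_low_nth_in[OF J A]) auto
  then have "fps_nth (of_nat (r choose m) * A ^ m * Q ^ (r - m)) s \<in> J" if "m \<le> r" for m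
    using that yideal_mult[OF J] by (simp add: mult.assoc fps_nth_of_nat_mult)
  then show ?thesis unfolding binomial_ring fps_sum_nth by (intro yideal_sum[OF J]) auto
qed

abbreviation yshift :: "nat \<Rightarrow> nat \<Rightarrow> ypoly" where "yshift k \<equiv> \<lambda>i. yv (i + k)"

lemma Yf_split: "Yf = Abs_fps (\<lambda>i. if i < k then yv i else 0) + fps_X ^ k * Abs_fps (yshift k)"
  by (rule fps_ext) (simp add: fps_X_power_mult_nth)

lemma shift_power_nth: "fps_nth ((fps_X ^ k * Abs_fps (yshift k)) ^ r) (s + k * r) = rcoef (yshift k) r s"
  by (simp add: power_mult_distrib power_mult[symmetric] fps_X_power_mult_nth rcoef_def)

lemma shift_power_nth_low: "t < k * r \<Longrightarrow> fps_nth ((fps_X ^ k * Abs_fps (yshift k)) ^ r) t = 0"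
  by (simp add: power_mult_distrib power_mult[symmetric] fps_X_power_mult_nth)

text \<open>Relations with a bound of the form \<open>k r + n\<close> are relations with bound \<open>n\<close> for the variables of index
at least \<open>k\<close>. Splitting off the first \<open>k\<close> terms of the generating series and expanding by the binomial
theorem, each term has either a high coefficient of a power of the short part, which is zero, or a
coefficient for which the relations apply.\<close>

lemma rcoef_shift_in:
  assumes J: "yideal J" and R: "\<And>i t. 1 \<le> i \<Longrightarrow> k * i + n < t + i \<Longrightarrow> rcoef yv i t \<in> J"
    and s: "n < s + r"
  shows "rcoef (yshift k) r s \<in> J"
proof -
  let ?A = "Abs_fps (\<lambda>i. if i < k then yv i else 0)"
  have "fps_X ^ k * Abs_fps (yshift k) = - ?A + Yf"
    using Yf_split[of k] by (simp add: algebra_simps)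
  moreover have "fps_nth ((- ?A + Yf) ^ r) (s + k * r) \<in> J"
    by (rule binomial_nth_in[OF J, where k = k and n = n]) (use R s in \<open>auto simp: rcoef_def\<close>)
  ultimately show ?thesis using shift_power_nth[of k r s] by metis
qed

lemma rcoef_unshift_in:
  assumes J: "yideal J" and R: "\<And>i t. 1 \<le> i \<Longrightarrow> n < t + i \<Longrightarrow> rcoef (yshift k) i t \<in> J"
    and s: "k * r + n < s + r"
  shows "rcoef yv r s \<in> J"
proof -
  let ?Q = "fps_X ^ k * Abs_fps (yshift k)"
  have "fps_nth (?Q ^ i) t \<in> J" if "1 \<le> i" "k * i + n < t + i" for i t
  proof (cases "t < k * i")
    case True then show ?thesis using yideal_0[OF J] by (simp add: shift_power_nth_low)
  next
    case False
    then show ?thesis using shift_power_nth[of k i "t - k * i"] R[of i "t - k * i"] that by simp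
  qed
  then have "fps_nth ((Abs_fps (\<lambda>i. if i < k then yv i else 0) + ?Q) ^ r) s \<in> J"
    by (intro binomial_nth_in[OF J, where k = k and n = n] s) auto
  then show ?thesis unfolding rcoef_def using Yf_split[of k] by metis
qed

text \<open>A monomial of degree \<open>r + i\<close> whose index sum is so large must, if the variables beyond \<open>y_N\<close> vanish,
contain \<open>y_N\<close> at least \<open>c\<close> times.\<close>

lemma top_power_in:
  assumes J: "yideal J" and hi: "\<And>j. N < j \<Longrightarrow> yv j \<in> J" and top: "yv N ^ c \<in> J"
  shows "N * r + c \<le> s + i + r \<Longrightarrow> yv N ^ i * rcoef yv r s \<in> J"
proof (induction r arbitrary: s i)
  case 0
  have "yv N ^ (c + k) \<in> J" for k
    using yideal_mult[OF J top, of "yv N ^ k"] by (simp add: power_add mult.commute)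
  then show ?case using 0 yideal_0[OF J] le_Suc_ex[of c i] by (auto simp: rcoef_0)
next
  case (Suc r)
  have "yv N ^ i * (yv j * rcoef yv r (s - j)) \<in> J" if "j \<le> s" for j
  proof -
    consider "j < N" | "j = N" | "N < j" by linarith
    then show ?thesis
    proof cases
      case 1
      then have "yv N ^ i * rcoef yv r (s - j) \<in> J" using Suc.prems that by (intro Suc.IH) auto
      from yideal_mult[OF J this, of "yv j"] show ?thesis by (simp add: mult.left_commute)
    next
      case 2
      then have "yv N ^ Suc i * rcoef yv r (s - j) \<in> J" using Suc.prems that by (intro Suc.IH) auto
      then show ?thesis using 2 by (simp add: mult.assoc mult.left_commute)
    next
      case 3
      from yideal_mult[OF J hi[OF this], of "yv N ^ i * rcoef yv r (s - j)"]
      show ?thesis by (simp add: mult.assoc mult.left_commute mult.commute)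
    qed
  qed
  then show ?case unfolding rcoef_Suc sum_distrib_left by (intro yideal_sum[OF J]) auto
qed

lemma top_coefficient:
  assumes J: "yideal J" and hi: "\<And>j. N < j \<Longrightarrow> yv j \<in> J"
  shows "N * r < s \<Longrightarrow> rcoef yv r s \<in> J" and "rcoef yv r (N * r) - yv N ^ r \<in> J"
proof -
  show 1: "rcoef yv r s \<in> J" if "N * r < s" for r s
    using that
  proof (induction r arbitrary: s)
    case 0 then show ?case using yideal_0[OF J] by (simp add: rcoef_0)
  next
    case (Suc r)
    have "yv j * rcoef yv r (s - j) \<in> J" if "j \<le> s" for j
    proof (cases "j \<le> N")
      case True
      then have "rcoef yv r (s - j) \<in> J" using Suc.prems by (intro Suc.IH) auto
      then show ?thesis by (rule yideal_mult[OF J])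
    next
      case False
      then show ?thesis using yideal_mult[OF J hi[of j], of "rcoef yv r (s - j)"] by (simp add: mult.commute)
    qed
    then show ?case unfolding rcoef_Suc by (intro yideal_sum[OF J]) auto
  qed
  show "rcoef yv r (N * r) - yv N ^ r \<in> J"
  proof (induction r)
    case 0 show ?case using yideal_0[OF J] by (simp add: rcoef_0)
  next
    case (Suc r)
    have "rcoef yv (Suc r) (N * Suc r) = yv N * rcoef yv r (N * r)
        + (\<Sum>j\<in>{..N * Suc r} - {N}. yv j * rcoef yv r (N * Suc r - j))"
      unfolding rcoef_Suc by (subst sum.remove[of _ N]) auto
    moreover have "yv j * rcoef yv r (N * Suc r - j) \<in> J" if "j \<in> {..N * Suc r} - {N}" for j
    proof (cases "j < N")
      case True then show ?thesis using that by (intro yideal_mult[OF J] 1) auto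
    next
      case False
      then show ?thesis using that yideal_mult[OF J hi[of j], of "rcoef yv r (N * Suc r - j)"] by (simp add: mult.commute)
    qed
    ultimately have "rcoef yv (Suc r) (N * Suc r) - yv N ^ Suc r - yv N * (rcoef yv r (N * r) - yv N ^ r) \<in> J"
      by (auto simp: algebra_simps intro!: yideal_sum[OF J])
    from yideal_add[OF J this yideal_mult[OF J Suc, of "yv N"]] show ?case by simp
  qed
qed

lemma sum_fun_upd:
  fixes f \<mu> :: "nat \<Rightarrow> nat"
  assumes "p < N"
  shows "(\<Sum>i<N. f ((\<mu>(p := x)) i)) + f (\<mu> p) = (\<Sum>i<N. f (\<mu> i)) + f x"
proof -
  have "(\<Sum>i\<in>{..<N} - {p}. f ((\<mu>(p := x)) i)) = (\<Sum>i\<in>{..<N} - {p}. f (\<mu> i))"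
    by (rule sum.cong) auto
  then show ?thesis
    using assms sum.remove[of "{..<N}" p "\<lambda>i. f ((\<mu>(p := x)) i)"] sum.remove[of "{..<N}" p "\<lambda>i. f (\<mu> i)"] by simp
qed

lemma prod_fun_upd:
  fixes f \<mu> :: "nat \<Rightarrow> nat"
  assumes "p < N"
  shows "(\<Prod>i<N. f ((\<mu>(p := x)) i)) * f (\<mu> p) = (\<Prod>i<N. f (\<mu> i)) * f x"
proof -
  have "(\<Prod>i\<in>{..<N} - {p}. f ((\<mu>(p := x)) i)) = (\<Prod>i\<in>{..<N} - {p}. f (\<mu> i))"
    by (rule prod.cong) auto
  then show ?thesis
    using assms prod.remove[of "{..<N}" p "\<lambda>i. f ((\<mu>(p := x)) i)"] prod.remove[of "{..<N}" p "\<lambda>i. f (\<mu> i)"] by simp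
qed

interpretation YY: complex_space_pair yscale yscale ..

text \<open>The exact sequence \<open>0 \<rightarrow> S / (J : h) \<rightarrow> S / J \<rightarrow> S / (J + h S) \<rightarrow> 0\<close> for \<open>S\<close> the polynomial ring.\<close>

lemma ideal_quotient_step:
  assumes J: "yideal J" and J1: "Y.rdim UNIV {f + g * h |f g. f \<in> J} d1"
    and J2: "Y.rdim UNIV {f. h * f \<in> J} d2"
  shows "Y.rdim UNIV J (d1 + d2)"
proof -
  have "Vector_Spaces.linear yscale yscale (\<lambda>f. h * f)"
    by unfold_locales (auto simp: distrib_left mult_yscale)
  from YY.rdim_image[OF this J2]
  have "Y.rdim (range (\<lambda>f. h * f)) J d2" by (rule Y.rdim_mono) auto
  then obtain S where S: "finite S" "card S \<le> d2" "range (\<lambda>f. h * f) \<subseteq> Y.span (S \<union> J)"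
    by (auto simp: Y.rdim_def)
  have "{f + g * h |f g. f \<in> J} \<subseteq> Y.span (S \<union> J)"
  proof clarify
    fix f g assume f: "f \<in> J"
    have "g * h \<in> Y.span (S \<union> J)" using S(3) by (auto simp: mult.commute[of g])
    then show "f + g * h \<in> Y.span (S \<union> J)" using f by (intro Y.span_add) (auto intro: Y.span_base)
  qed
  then have "Y.rdim {f + g * h |f g. f \<in> J} J d2" using S unfolding Y.rdim_def by blast
  then show ?thesis by (rule Y.rdim_trans[OF J1])
qed

lemma yideal_adjoin:
  assumes "yideal J" shows "yideal {f + g * h |f g. f \<in> J}"
proof -
  have "0 \<in> {f + g * h |f g. f \<in> J}" using yideal_0[OF assms] by (intro CollectI exI[of _ 0]) auto
  moreover have "x + y \<in> {f + g * h |f g. f \<in> J}"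
    if "x \<in> {f + g * h |f g. f \<in> J}" "y \<in> {f + g * h |f g. f \<in> J}" for x y
  proof -
    from that obtain f g f' g' where "x = f + g * h" "y = f' + g' * h" "f \<in> J" "f' \<in> J" by blast
    then show ?thesis using yideal_add[OF assms, of f f']
      by (intro CollectI exI[of _ "f + f'"] exI[of _ "g + g'"]) (simp add: algebra_simps)
  qed
  moreover have "k * x \<in> {f + g * h |f g. f \<in> J}" if "x \<in> {f + g * h |f g. f \<in> J}" for k x
  proof -
    from that obtain f g where "x = f + g * h" "f \<in> J" by blast
    then show ?thesis using yideal_mult[OF assms, of f k]
      by (intro CollectI exI[of _ "k * f"] exI[of _ "k * g"]) (simp add: algebra_simps)
  qed
  ultimately show ?thesis unfolding yideal_def Y.subspace_def yscale_def by blast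
qed

lemma yideal_colon:
  assumes "yideal J" shows "yideal {f. h * f \<in> J}"
proof -
  have "h * yscale c f \<in> J" if "h * f \<in> J" for c f
    using that Y.subspace_scale[OF yideal_subspace[OF assms]] by (simp add: mult_yscale)
  moreover have "h * (yv j * f) \<in> J" if "h * f \<in> J" for j f
    using yideal_mult[OF assms that, of "yv j"] by (simp add: mult.left_commute)
  ultimately show ?thesis
    using yideal_0[OF assms] yideal_add[OF assms] by (auto simp: yideal_def Y.subspace_def distrib_left)
qed

lemma yideal_preimage_shift:
  assumes "yideal J" shows "yideal {f. Y.ev (yshift k) f \<in> J}"
proof -
  have "Y.ev (yshift k) (yv j * f) = yshift k j * Y.ev (yshift k) f" for j f
    by (rule Y.ev_mult) (simp add: mult.commute)
  then show ?thesis
    using assms yideal_0[OF assms] yideal_add[OF assms]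
    by (auto simp: yideal_def Y.subspace_def Y.ev_0 Y.ev_add Y.ev_yscale)
qed

text \<open>Adjoining the power \<open>y_N^(\<mu> N)\<close> moves one box from the last row to a row that is shortest among the
others, or deletes it if there is no other row: the bound drops only for those \<open>r\<close> for which every monomial of \<open>R(r,s)\<close> contains the adjoined
power.\<close>

lemma cv_rels_plus:
  assumes J: "yideal J" and rel: "cv_rels (Suc N) \<mu> (\<lambda>r s. rcoef yv r s \<in> J)"
    and b: "\<mu> N = Suc b" and hi: "\<And>j. N < j \<Longrightarrow> yv j \<in> J"
    and a: "\<And>i. i < N \<Longrightarrow> a \<le> \<mu> i" and p: "0 < N \<Longrightarrow> p < N \<and> \<mu> p = a"
    and mu': "\<mu>' = (if N = 0 then \<mu>(N := b) else \<mu>(p := Suc a, N := b))"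
  shows "cv_rels (Suc N) \<mu>' (\<lambda>r s. rcoef yv r s \<in> {f + g * yv N ^ Suc b |f g. f \<in> J})"
  unfolding cv_rels_def
proof (intro allI impI)
  fix r s :: nat assume r: "1 \<le> r" and s: "truncated_size (Suc N) \<mu>' r < s + r"
  let ?J = "{f + g * yv N ^ Suc b |f g. f \<in> J}"
  have sub: "J \<subseteq> ?J"
  proof
    fix x assume "x \<in> J" then show "x \<in> ?J" by (intro CollectI exI[of _ x] exI[of _ 0]) auto
  qed
  have S': "truncated_size (Suc N) \<mu>' r + (if 0 < N then min r a else 0) + min r (Suc b) =
     truncated_size (Suc N) \<mu> r + (if 0 < N then min r (Suc a) else 0) + min r b"
  proof (cases "N = 0")
    case True then show ?thesis using b mu' by (simp add: truncated_size_def)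
  next
    case False
    have "(\<Sum>i<N. min r (\<mu>' i)) = (\<Sum>i<N. min r ((\<mu>(p := Suc a)) i))"
      using mu' False by (intro sum.cong) auto
    then show ?thesis using sum_fun_upd[of p N "min r" \<mu> "Suc a"] p False b mu'
      by (simp add: truncated_size_def)
  qed
  show "rcoef yv r s \<in> ?J"
  proof (cases "truncated_size (Suc N) \<mu> r < s + r")
    case True then show ?thesis using cv_relsD[OF rel r] sub by blast
  next
    case False
    then have rb: "Suc b \<le> r" and ra: "0 < N \<longrightarrow> r \<le> a" using s S' by (auto split: if_splits)
    have "min r (\<mu> i) = r" if "i < N" for i using a[OF that] ra that by auto
    then have "truncated_size (Suc N) \<mu> r = N * r + Suc b"
      using rb b by (simp add: truncated_size_def)
    moreover have "truncated_size (Suc N) \<mu>' r + 1 = truncated_size (Suc N) \<mu> r"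
      using S' rb ra by (auto simp: min_def split: if_splits)
    ultimately have s: "N * r + Suc b \<le> s + 0 + r" using s by linarith
    have "yv N ^ 0 * rcoef yv r s \<in> ?J"
    proof (rule top_power_in[OF yideal_adjoin[OF J] _ _ s])
      show "yv N ^ Suc b \<in> ?J" using yideal_0[OF J] by (intro CollectI exI[of _ 0] exI[of _ 1]) auto
    qed (use sub hi in auto)
    then show ?thesis by simp
  qed
qed

text \<open>Dividing by \<open>y_N^b\<close>, \<open>b = \<mu> N\<close>, deletes the last row and removes \<open>b\<close> boxes from the row above. If the
bound for \<open>r\<close> cuts the rows from \<open>k\<close> on, then after a shift by \<open>k\<close> the relations are Garland's relations for
the number of boxes in these rows, and \<open>garland_top_power\<close> lowers that number by \<open>2 b\<close>.\<close>

lemma cv_rels_minus: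
  assumes J: "yideal J" and rel: "cv_rels (Suc N) \<mu> (\<lambda>r s. rcoef yv r s \<in> J)"
    and b: "\<mu> N = b" and hi: "\<And>j. N < j \<Longrightarrow> yv j \<in> J"
    and anti: "\<And>i j. i \<le> j \<Longrightarrow> j < Suc N \<Longrightarrow> \<mu> j \<le> \<mu> i"
  shows "cv_rels N (\<mu>(N - 1 := \<mu> (N - 1) - b)) (\<lambda>r s. rcoef yv r s \<in> {f. yv N ^ b * f \<in> J})"
  unfolding cv_rels_def
proof (intro allI impI)
  fix r s :: nat
  let ?\<mu> = "\<mu>(N - 1 := \<mu> (N - 1) - b)"
  let ?J2 = "{f. yv N ^ b * f \<in> J}"
  assume r: "1 \<le> r" and s: "truncated_size N ?\<mu> r < s + r"
  have anti': "?\<mu> j \<le> ?\<mu> i" if "i \<le> j" "j < N" for i j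
    using anti[of i j] anti[of i "N - 1"] that by (cases "j = N - 1") auto
  obtain k where k: "k \<le> N" "truncated_size N ?\<mu> r = k * r + (\<Sum>i\<in>{k..<N}. ?\<mu> i)"
    using truncated_size_eq[of N ?\<mu> r] anti' by blast
  show "rcoef yv r s \<in> ?J2"
  proof (cases "k = N")
    case True
    have "truncated_size (Suc N) \<mu> (Suc b) \<le> N * Suc b + b"
      using truncated_size_le[of N "Suc N" \<mu> "Suc b"] b by simp
    then have "rcoef yv (Suc b) (N * Suc b) \<in> J" by (intro cv_relsD[OF rel]) auto
    from yideal_diff[OF J this top_coefficient(2)[OF J hi, of N "Suc b"]]
    have "yv N ^ Suc b \<in> J" by simp
    moreover have "N * r + Suc b \<le> s + b + r" using s k True by simp
    ultimately show ?thesis using top_power_in[OF J, of N "Suc b" r s b] hi by simp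
  next
    case False
    then have kN: "k < N" using k by simp
    define n where "n = (\<Sum>i\<in>{k..<Suc N}. \<mu> i)"
    define n' where "n' = (\<Sum>i\<in>{k..<N}. ?\<mu> i)"
    have n: "n = n' + 2 * b"
    proof -
      obtain M where M: "N = Suc M" using kN by (cases N) auto
      have "b \<le> \<mu> M" using anti[of M N] b M by simp
      moreover have "(\<Sum>i\<in>{k..<M}. ?\<mu> i) = (\<Sum>i\<in>{k..<M}. \<mu> i)" by (rule sum.cong) (auto simp: M)
      ultimately show ?thesis using b kN by (simp add: n_def n'_def M)
    qed
    let ?J' = "{f. Y.ev (yshift k) f \<in> J}"
    have comm: "yshift k i * yshift k j = yshift k j * yshift k i" for i j by (simp add: mult.commute)
    have "garland_ideal n (Suc N - k) \<subseteq> ?J'"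
    proof (rule garland_ideal_least[OF yideal_preimage_shift[OF J]])
      fix r s :: nat assume rs: "1 \<le> r" "n < r + s"
      have "rcoef yv i t \<in> J" if "1 \<le> i" "k * i + n < t + i" for i t
        using truncated_size_le[of k "Suc N" \<mu> i] that kN by (intro cv_relsD[OF rel]) (auto simp: n_def)
      then have "rcoef (yshift k) r s \<in> J"
        using rs by (intro rcoef_shift_in[OF J, where n = n]) auto
      then show "rcoef yv r s \<in> ?J'" using Y.ev_rcoef[where y = "yshift k", OF comm] by simp
    next
      fix j assume "Suc N - k \<le> j"
      moreover have "Y.ev (yshift k) (yv j) = yshift k j"
        using Y.ev_mult[where y = "yshift k" and j = j and f = 1, OF comm] by (simp add: Y.ev_1)
      ultimately show "yv j \<in> ?J'" using hi by simp
    qed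
    then have *: "rcoef (yshift k) i t \<in> ?J2" if "n' < t + i" for i t
    proof -
      have "yv (Suc N - k - 1) ^ b * rcoef yv i t \<in> garland_ideal n (Suc N - k)"
        using that kN n by (intro garland_top_power) auto
      then have "Y.ev (yshift k) (yv (N - k) ^ b * rcoef yv i t) \<in> J"
        using \<open>garland_ideal n (Suc N - k) \<subseteq> ?J'\<close> by auto
      moreover have "Y.ev (yshift k) (yv j ^ b * f) = yshift k j ^ b * Y.ev (yshift k) f" for j b f
        by (induction b) (simp_all add: mult.assoc Y.ev_mult[where y = "yshift k", OF comm])
      ultimately show ?thesis using kN by (simp add: Y.ev_rcoef[where y = "yshift k", OF comm])
    qed
    show ?thesis
      by (rule rcoef_unshift_in[OF yideal_colon[OF J], where k = k and n = n'])
         (use * s k in \<open>auto simp: n'_def\<close>)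
  qed
qed

text \<open>By induction on the number of rows and on the length of the last row: with \<open>b + 1\<close> the last row and
\<open>a\<close> the row above, the two steps leave \<open>(a + 2)(b + 1)\<close> and \<open>a - b\<close> in place of \<open>(a + 1)(b + 2)\<close>,
and \<open>(a + 2)(b + 1) + (a - b) = (a + 1)(b + 2)\<close>.\<close>

theorem boson_bound:
  assumes "yideal J" "\<And>i j. i \<le> j \<Longrightarrow> j < N \<Longrightarrow> \<mu> j \<le> \<mu> i" "cv_rels N \<mu> (\<lambda>r s. rcoef yv r s \<in> J)"
  shows "Y.rdim UNIV J (\<Prod>i<N. \<mu> i + 1)"
  using assms
proof (induction N arbitrary: \<mu> J)
  case 0
  note J = 0(1)
  have "yv j \<in> J" for j using cv_relsD[OF 0(3), of 1 j] by (simp add: truncated_size_def rcoef_1)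
  have "f \<in> Y.span ({1} \<union> J)" for f
  proof (rule ypoly_induct)
    fix j f assume "f \<in> Y.span ({1} \<union> J)"
    have "f * yv j \<in> J" using yideal_mult[OF J \<open>yv j \<in> J\<close>] .
    then show "yv j * f \<in> Y.span ({1} \<union> J)" by (auto simp: mult.commute intro: Y.span_base)
  qed (auto intro: Y.span_base)
  then show ?case unfolding Y.rdim_def by (intro exI[of _ "{1}"]) auto
next
  case (Suc N)
  note outer_IH = Suc.IH
  from Suc.prems show ?case
  proof (induction "\<mu> N" arbitrary: \<mu> J)
    case 0
    have "cv_rels N \<mu> (\<lambda>r s. rcoef yv r s \<in> J)"
      using 0(4) \<open>0 = \<mu> N\<close>[symmetric] by (simp add: cv_rels_def truncated_size_def)
    then have "Y.rdim UNIV J (\<Prod>i<N. \<mu> i + 1)" using 0(2,3) by (intro outer_IH) auto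
    then show ?case using \<open>0 = \<mu> N\<close>[symmetric] by simp
  next
    case (Suc b)
    note J = Suc.prems(1) and anti = Suc.prems(2) and rel = Suc.prems(3)
    have b: "\<mu> N = Suc b" using Suc.hyps(2) by simp
    have hi: "yv j \<in> J" if "N < j" for j
    proof -
      have "truncated_size (Suc N) \<mu> 1 \<le> Suc N" using truncated_size_le[of "Suc N" "Suc N" \<mu> 1] by simp
      then show ?thesis using cv_relsD[OF rel, of 1 j] that by (simp add: rcoef_1)
    qed
    define a where "a = \<mu> (N - 1)"
    \<comment> \<open>the first of the rows of length \<open>a\<close>, so that adding a box there keeps the rows decreasing\<close>

    define p where "p = (LEAST i. \<mu> i = a)"
    have p: "p < N \<and> \<mu> p = a" if "0 < N"
      using LeastI[of "\<lambda>i. \<mu> i = a" "N - 1"] Least_le[of "\<lambda>i. \<mu> i = a" "N - 1"] that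
      by (auto simp: p_def a_def)
    have pless: "\<mu> i \<noteq> a" if "i < p" for i using not_less_Least[of i "\<lambda>i. \<mu> i = a"] that by (auto simp: p_def)
    have a: "a \<le> \<mu> i" if "i < N" for i using anti[of i "N - 1"] that by (auto simp: a_def)
    define \<mu>' where "\<mu>' = (if N = 0 then \<mu>(N := b) else \<mu>(p := Suc a, N := b))"
    define \<mu>2 where "\<mu>2 = \<mu>(N - 1 := \<mu> (N - 1) - Suc b)"
    have "Y.rdim UNIV {f + g * yv N ^ Suc b |f g. f \<in> J} (\<Prod>i<Suc N. \<mu>' i + 1)"
    proof (rule Suc.hyps(1))
      show "b = \<mu>' N" by (simp add: \<mu>'_def)
      show "\<mu>' j \<le> \<mu>' i" if ij: "i \<le> j" "j < Suc N" for i j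
      proof -
        have "b \<le> \<mu> i" using anti[of i N] ij b by simp
        moreover have "Suc a \<le> \<mu> i" if "i < p" "0 < N" using pless[OF that(1)] a[of i] p that by auto
        moreover have "\<mu> j \<le> \<mu> i" using anti ij by blast
        moreover have "b \<le> a" using anti[of "N - 1" N] b by (simp add: a_def)
        moreover have "\<mu> j \<le> a" if "p \<le> j" "0 < N" using anti[of p j] ij that p by auto
        ultimately show ?thesis using ij p unfolding \<mu>'_def by (auto split: if_splits)
      qed
      show "cv_rels (Suc N) \<mu>' (\<lambda>r s. rcoef yv r s \<in> {f + g * yv N ^ Suc b |f g. f \<in> J})"
        by (rule cv_rels_plus[OF J rel b hi a p]) (auto simp: \<mu>'_def)
    qed (rule yideal_adjoin[OF J])
    moreover have "Y.rdim UNIV {f. yv N ^ Suc b * f \<in> J} (\<Prod>i<N. \<mu>2 i + 1)"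
    proof (rule outer_IH)
      show "cv_rels N \<mu>2 (\<lambda>r s. rcoef yv r s \<in> {f. yv N ^ Suc b * f \<in> J})"
        unfolding \<mu>2_def by (rule cv_rels_minus[OF J rel b hi anti])
      show "\<mu>2 j \<le> \<mu>2 i" if "i \<le> j" "j < N" for i j
        using anti[of i j] anti[of i "N - 1"] that by (cases "j = N - 1") (auto simp: \<mu>2_def)
    qed (rule yideal_colon[OF J])
    ultimately have "Y.rdim UNIV J ((\<Prod>i<Suc N. \<mu>' i + 1) + (\<Prod>i<N. \<mu>2 i + 1))"
      by (rule ideal_quotient_step[OF J])
    moreover have "(\<Prod>i<Suc N. \<mu>' i + 1) + (\<Prod>i<N. \<mu>2 i + 1) = (\<Prod>i<Suc N. \<mu> i + 1)"
    proof (cases N)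
      case 0 then show ?thesis using b by (simp add: \<mu>'_def)
    next
      case (Suc M)
      define P where "P = (\<Prod>i<M. \<mu> i + 1)"
      have aM: "\<mu> M = a" "p < N" "\<mu> p = a" using p Suc by (auto simp: a_def)
      have ba: "Suc b \<le> a" using anti[of M N] Suc b aM by simp
      have "(\<Prod>i<N. \<mu>2 i + 1) = P * (a - Suc b + 1)"
        unfolding Suc prod.lessThan_Suc P_def by (intro arg_cong2[of _ _ _ _ "(*)"] prod.cong) (auto simp: \<mu>2_def Suc aM)
      moreover have "(\<Prod>i<Suc N. \<mu>' i + 1) = (\<Prod>i<N. (\<mu>(p := Suc a)) i + 1) * (b + 1)"
        unfolding prod.lessThan_Suc by (intro arg_cong2[of _ _ _ _ "(*)"] prod.cong) (auto simp: \<mu>'_def Suc)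
      moreover have "(\<Prod>i<N. (\<mu>(p := Suc a)) i + 1) * (a + 1) = P * (a + 1) * (a + 2)"
        using prod_fun_upd[of p N "\<lambda>x. x + 1" \<mu> "Suc a"] aM by (simp add: Suc P_def)
      then have "(\<Prod>i<N. (\<mu>(p := Suc a)) i + 1) = P * (a + 2)"
        by (metis mult.assoc mult.commute mult_cancel2 add_is_0 one_neq_zero)
      moreover have "(\<Prod>i<Suc N. \<mu> i + 1) = P * (a + 1) * (b + 2)"
        using b aM by (simp add: Suc P_def)
      moreover obtain c where "a = Suc b + c" using ba le_Suc_ex by blast
      ultimately show ?thesis by (simp add: algebra_simps)
    qed
    ultimately show ?case by metis
  qed
qed

section \<open>Garland's relations\<close>

interpretation U: complex_algebra cscale
  by unfold_locales (simp_all add: mult_cscale, simp add: cscale_def mult.assoc)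

lemma left_ideal_subspace: "left_ideal J \<Longrightarrow> U.subspace J"
  by (auto simp: left_ideal_def U.subspace_def cscale_def)

lemma left_ideal_mult: "left_ideal J \<Longrightarrow> u \<in> J \<Longrightarrow> r * u \<in> J"
  by (simp add: left_ideal_def)

lemma of_int_cscale: "of_int c * u = cscale (of_int c) u"
  by (simp add: cscale_def U_const_of_int)

lemma of_nat_cscale: "of_nat c * u = cscale (of_nat c) u"
  by (simp add: cscale_def U_const_of_nat)

lemma subspace_of_int: "U.subspace T \<Longrightarrow> u \<in> T \<Longrightarrow> of_int c * u \<in> T"
  by (simp add: of_int_cscale U.subspace_scale)

lemma subspace_of_nat_cancel:
  assumes "U.subspace T" "of_nat c * u \<in> T" "c \<noteq> 0" shows "u \<in> T"
proof -
  have "cscale (inverse (of_nat c)) (cscale (of_nat c) u) \<in> T"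
    by (rule U.subspace_scale[OF assms(1)]) (use assms(2) in \<open>simp add: of_nat_cscale\<close>)
  then show ?thesis using assms(3) by simp
qed

lemma subspace_sum_list: "U.subspace T \<Longrightarrow> (\<And>x. x \<in> set xs \<Longrightarrow> f x \<in> T) \<Longrightarrow> sum_list (map f xs) \<in> T"
  by (induction xs) (auto intro: U.subspace_0 U.subspace_add)

lemma G_comm_assoc:
  "G a m * (G b n * u) = (if odd_gen a \<and> odd_gen b then -1 else 1) * (G b n * (G a m * u))
     + (\<Sum>(c, h)\<leftarrow>brk a b. of_int c * (G h (m + n) * u))"
proof -
  have "G a m * (G b n * u) = (G a m * G b n) * u" by (simp add: mult.assoc)
  also have "\<dots> = ((if odd_gen a \<and> odd_gen b then -1 else 1) * (G b n * G a m)
     + (\<Sum>(c, h)\<leftarrow>brk a b. of_int c * G h (m + n))) * u"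
    by (subst G_comm) (rule refl)
  also have "\<dots> = (if odd_gen a \<and> odd_gen b then -1 else 1) * (G b n * (G a m * u))
     + (\<Sum>(c, h)\<leftarrow>brk a b. of_int c * G h (m + n)) * u"
    by (simp only: distrib_right mult.assoc)
  also have "(\<Sum>(c, h)\<leftarrow>xs. of_int c * G h (m + n)) * u = (\<Sum>(c, h)\<leftarrow>xs. of_int c * (G h (m + n) * u))" for xs
    by (induction xs) (auto simp: distrib_right mult.assoc)
  finally show ?thesis .
qed

text \<open>The form in which brackets are used to show membership: it suffices to treat the product in the other
order and the terms of the bracket.\<close>

lemma comm_in:
  assumes T: "U.subspace T" and "G b n * (G a m * u) \<in> T"
    and "\<And>c h. (c, h) \<in> set (brk a b) \<Longrightarrow> G h (m + n) * u \<in> T"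
  shows "G a m * (G b n * u) \<in> T"
proof -
  have "(if odd_gen a \<and> odd_gen b then -1 else 1) * (G b n * (G a m * u)) \<in> T"
    using assms(2) U.subspace_neg[OF T] by auto
  moreover have "(\<Sum>(c, h)\<leftarrow>brk a b. of_int c * (G h (m + n) * u)) \<in> T"
    using assms(3) by (intro subspace_sum_list[OF T]) (auto intro: subspace_of_int[OF T])
  ultimately show ?thesis by (subst G_comm_assoc) (rule U.subspace_add[OF T])
qed

abbreviation "Rr \<equiv> rcoef (G Y2)"
abbreviation "evU \<equiv> U.ev (G Y2)"

lemma Y2_commute: "G Y2 i * G Y2 j = G Y2 j * G Y2 i"
  using G_comm[of Y2 i Y2 j] by simp

lemma evU_mult: "evU (yv j * f) = G Y2 j * evU f"
  by (rule U.ev_mult) (rule Y2_commute)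

lemma evU_rcoef: "evU (rcoef yv r s) = Rr r s"
  by (rule U.ev_rcoef) (rule Y2_commute)

lemma evU_commute:
  assumes "\<And>j. x * G Y2 j = G Y2 j * x"
  shows "x * evU f = evU f * x"
proof -
  have "f \<in> {f. x * evU f = evU f * x}"
  proof (rule ypoly_induct)
    show "Y.subspace {f. x * evU f = evU f * x}"
      by (auto simp: Y.subspace_def U.ev_0 U.ev_add U.ev_yscale distrib_left distrib_right mult_cscale U.scale_mult)
    fix j f assume "f \<in> {f. x * evU f = evU f * x}"
    then have "x * (G Y2 j * evU f) = G Y2 j * (evU f * x)"
      using assms[of j] by (metis (mono_tags, lifting) mem_Collect_eq mult.assoc)
    then show "yv j * f \<in> {f. x * evU f = evU f * x}" by (simp add: evU_mult mult.assoc)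
  qed (simp add: U.ev_1)
  then show ?thesis by simp
qed

lemma evU_closed:
  assumes B: "U.subspace B" "\<And>m u. u \<in> B \<Longrightarrow> G Y2 m * u \<in> B" and u: "u \<in> B"
  shows "evU f * u \<in> B"
proof -
  have "f \<in> {f. evU f * u \<in> B}"
    by (rule ypoly_induct)
      (use B u U.subspace_0[OF B(1)] U.subspace_add[OF B(1)] U.subspace_scale[OF B(1)] in
        \<open>auto simp: Y.subspace_def U.ev_0 U.ev_add U.ev_yscale U.ev_1 evU_mult distrib_right U.scale_mult mult.assoc\<close>)
  then show ?thesis by simp
qed

text \<open>Modulo a left ideal that makes \<open>1\<close> a highest weight vector, the currents of \<open>h_2\<close> and \<open>x_2\<close> act on
polynomials in the currents of \<open>y_2\<close> by the operators \<open>Hop\<close> and \<open>Xop\<close>. Both statements are proved together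
since \<open>[x_2(m), y_2(j)] = h_2(m + j)\<close>.\<close>

lemma verma_action:
  assumes J: "left_ideal J" and X2: "\<And>m. G X2 m \<in> J"
    and H2: "\<And>m. G H2 m - (if m = 0 then of_nat n else 0) \<in> J"
  shows "(\<forall>m. G H2 m * evU f - evU ((if m = 0 then of_nat n * f else 0) - 2 * Hop m f) \<in> J) \<and>
    (\<forall>m. G X2 m * evU f - evU (Xop n m f) \<in> J)"
    (is "?P f")
proof -
  note sub = left_ideal_subspace[OF J]
  have ev_diff: "evU (f - g) = evU f - evU g" for f g
    using U.ev_add[of "G Y2" "f - g" g] by simp
  have ev_nat: "evU (of_nat k * f) = of_nat k * evU f" for k f
    by (simp add: of_nat_ypoly of_nat_cscale U.ev_yscale)
  have ev_2: "evU (2 * f) = 2 * evU f" for f using ev_nat[of 2 f] by simp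
  have nat_comm: "G g m * (of_nat k * u) = of_nat k * (G g m * u)" for g m k u
    by (simp add: of_nat_cscale mult_cscale)
  have two_comm: "G g m * (2 * u) = 2 * (G g m * u)" for g m u
    using nat_comm[of g m 2 u] by simp
  have "f \<in> {f. ?P f}"
  proof (rule ypoly_induct)
    have PH: "?P f \<longleftrightarrow> (\<forall>m. G H2 m * evU f - (if m = 0 then of_nat n * evU f else 0) + 2 * evU (Hop m f) \<in> J) \<and>
       (\<forall>m. G X2 m * evU f - evU (Xop n m f) \<in> J)" for f
    proof -
      have *: "evU ((if m = 0 then of_nat n * f else 0) - 2 * Hop m f) =
         (if m = 0 then of_nat n * evU f else 0) - 2 * evU (Hop m f)" for m
        by (simp add: ev_diff ev_nat ev_2 U.ev_0)
      show ?thesis unfolding * by (simp add: algebra_simps)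
    qed
    show "Y.subspace {f. ?P f}"
      unfolding PH Y.subspace_def
    proof (intro conjI ballI allI, goal_cases)
      case 1 then show ?case using U.subspace_0[OF sub] by (simp add: U.ev_0 Hop_0 Xop_0)
    next
      case (2 f g)
      have "G H2 m * evU (f + g) - (if m = 0 then of_nat n * evU (f + g) else 0) + 2 * evU (Hop m (f + g))
         = (G H2 m * evU f - (if m = 0 then of_nat n * evU f else 0) + 2 * evU (Hop m f))
         + (G H2 m * evU g - (if m = 0 then of_nat n * evU g else 0) + 2 * evU (Hop m g))" for m
        by (simp add: Hop_add U.ev_add algebra_simps)
      moreover have "G X2 m * evU (f + g) - evU (Xop n m (f + g))
         = (G X2 m * evU f - evU (Xop n m f)) + (G X2 m * evU g - evU (Xop n m g))" for m
        by (simp add: Xop_add U.ev_add algebra_simps)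
      ultimately show ?case using 2 U.subspace_add[OF sub] by simp
    next
      case (3 c f)
      have "G H2 m * evU (yscale c f) - (if m = 0 then of_nat n * evU (yscale c f) else 0) + 2 * evU (Hop m (yscale c f))
         = cscale c (G H2 m * evU f - (if m = 0 then of_nat n * evU f else 0) + 2 * evU (Hop m f))" for m
        by (simp add: Hop_yscale U.ev_yscale mult_cscale U.scale_right_distrib U.scale_right_diff_distrib)
      moreover have "G X2 m * evU (yscale c f) - evU (Xop n m (yscale c f)) = cscale c (G X2 m * evU f - evU (Xop n m f))" for m
        by (simp only: Xop_yscale U.ev_yscale mult_cscale U.scale_right_diff_distrib)
      ultimately show ?case using 3 U.subspace_scale[OF sub] by simp
    qed
    show "1 \<in> {f. ?P f}"
    proof -
      have "G H2 m \<in> J" if "0 < m" for m using H2[of m] that by simp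
      then show ?thesis
        unfolding mem_Collect_eq PH using X2 H2[of 0] by (simp add: U.ev_1 U.ev_0 Hop_1 Xop_1)
    qed
    fix j f assume "f \<in> {f. ?P f}"
    then have h: "\<And>m. G H2 m * evU f - (if m = 0 then of_nat n * evU f else 0) + 2 * evU (Hop m f) \<in> J"
      and x: "\<And>m. G X2 m * evU f - evU (Xop n m f) \<in> J"
      by (auto simp: PH)
    show "yv j * f \<in> {f. ?P f}"
      unfolding PH mem_Collect_eq
    proof (intro conjI allI)
      fix m
      have e1: "G H2 m * (G Y2 j * evU f) = G Y2 j * (G H2 m * evU f) - 2 * (G Y2 (m + j) * evU f)"
        by (subst G_comm_assoc) simp
      have e2: "evU (Hop m (yv j * f)) = G Y2 j * evU (Hop m f) + G Y2 (m + j) * evU f"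
        by (simp add: evU_mult Hop_mult U.ev_add add.commute)
      have e3: "(if m = 0 then of_nat n * (G Y2 j * evU f) else 0) = G Y2 j * (if m = 0 then of_nat n * evU f else 0)"
        by (simp add: nat_comm)
      have lin: "a - 2 * c - d + 2 * (b + c) = a - d + 2 * b" for a b c d :: Uenv
        by (simp add: algebra_simps)
      have "G H2 m * evU (yv j * f) - (if m = 0 then of_nat n * evU (yv j * f) else 0) + 2 * evU (Hop m (yv j * f)) =
         G Y2 j * (G H2 m * evU f - (if m = 0 then of_nat n * evU f else 0) + 2 * evU (Hop m f))"
        unfolding evU_mult e1 e2 e3 lin by (simp only: distrib_left right_diff_distrib two_comm)
      then show "G H2 m * evU (yv j * f) - (if m = 0 then of_nat n * evU (yv j * f) else 0) + 2 * evU (Hop m (yv j * f)) \<in> J"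
        using left_ideal_mult[OF J h] by simp
      have e1: "G X2 m * (G Y2 j * evU f) = G Y2 j * (G X2 m * evU f) + G H2 (m + j) * evU f"
        by (subst G_comm_assoc) simp
      have e2: "evU (Xop n m (yv j * f)) = G Y2 j * evU (Xop n m f) - 2 * evU (Hop (m + j) f)
          + (if m + j = 0 then of_nat n * evU f else 0)"
        by (auto simp: evU_mult Xop_mult U.ev_add ev_diff ev_nat ev_2 U.ev_0)
      have lin: "a + h - (b - 2 * c + d) = (a - b) + (h - d + 2 * c)" for a b c d h :: Uenv
        by (simp add: algebra_simps)
      have "G X2 m * evU (yv j * f) - evU (Xop n m (yv j * f)) =
         G Y2 j * (G X2 m * evU f - evU (Xop n m f)) +
         (G H2 (m + j) * evU f - (if m + j = 0 then of_nat n * evU f else 0) + 2 * evU (Hop (m + j) f))"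
        unfolding evU_mult e1 e2 lin by (simp only: right_diff_distrib)
      then show "G X2 m * evU (yv j * f) - evU (Xop n m (yv j * f)) \<in> J"
        using U.subspace_add[OF sub left_ideal_mult[OF J x] h] by metis
    qed
  qed
  then show ?thesis by simp
qed

lemma garland_relations:
  assumes J: "left_ideal J" and X2: "\<And>m. G X2 m \<in> J"
    and H2: "\<And>m. G H2 m - (if m = 0 then of_nat n else 0) \<in> J"
    and pow: "G Y2 0 ^ (n + 1) \<in> J"
  shows "1 \<le> r \<Longrightarrow> n < r + s \<Longrightarrow> Rr r s \<in> J"
proof (induction s arbitrary: r)
  case 0
  then have "r - (n + 1) + (n + 1) = r" by simp
  then have "G Y2 0 ^ r = G Y2 0 ^ (r - (n + 1)) * G Y2 0 ^ (n + 1)"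
    by (metis power_add)
  then show ?case using left_ideal_mult[OF J pow] by (simp add: rcoef_s0)
next
  case (Suc s)
  note sub = left_ideal_subspace[OF J]
  have "Rr (Suc r) s \<in> J" using Suc by auto
  then have "G X2 1 * evU (rcoef yv (Suc r) s) \<in> J" unfolding evU_rcoef by (rule left_ideal_mult[OF J])
  moreover have "G X2 1 * evU (rcoef yv (Suc r) s) - evU (Xop n 1 (rcoef yv (Suc r) s)) \<in> J"
    using verma_action[OF J X2 H2] by blast
  ultimately have *: "evU (Xop n 1 (rcoef yv (Suc r) s)) \<in> J"
    using U.subspace_diff[OF sub, of "G X2 1 * evU (rcoef yv (Suc r) s)" "G X2 1 * evU (rcoef yv (Suc r) s) - evU (Xop n 1 (rcoef yv (Suc r) s))"]
    by simp
  have "Xop n 1 (rcoef yv (Suc r) s) = - (of_nat (Suc r * Suc s) * rcoef yv r (Suc s))"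
    unfolding Xop1_rcoef of_nat_mult by (simp only: mult_minus_left)
  also have "\<dots> = yscale (- of_nat (Suc r * Suc s)) (rcoef yv r (Suc s))"
    unfolding of_nat_ypoly by (simp only: Y.scale_minus_left)
  finally have "evU (Xop n 1 (rcoef yv (Suc r) s)) = - (of_nat (Suc r * Suc s) * Rr r (Suc s))"
    by (simp only: U.ev_yscale evU_rcoef U.scale_minus_left of_nat_cscale)
  then have "of_nat (Suc r * Suc s) * Rr r (Suc s) \<in> J"
    using * U.subspace_neg[OF sub] by fastforce
  then show ?case by (rule subspace_of_nat_cancel[OF sub]) simp
qed

lemma Rr_commute: "(\<And>j. x * G Y2 j = G Y2 j * x) \<Longrightarrow> x * Rr r s = Rr r s * x"
  using evU_commute[of x "rcoef yv r s"] by (simp add: evU_rcoef)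

text \<open>If \<open>s > r (N - 1)\<close>, every product of \<open>r\<close> factors with index sum \<open>s\<close> has a factor of index at least \<open>N\<close>.\<close>

lemma pigeonhole_relations:
  assumes J: "left_ideal J" and Y: "\<And>j. N \<le> j \<Longrightarrow> G Y2 j \<in> J"
  shows "N * r < s + r \<Longrightarrow> Rr r s \<in> J"
proof (induction r arbitrary: s)
  case 0 then show ?case using U.subspace_0[OF left_ideal_subspace[OF J]] by (simp add: rcoef_0)
next
  case (Suc r)
  have "G Y2 j * Rr r (s - j) \<in> J" for j
  proof (cases "j < N")
    case True
    then have "Rr r (s - j) \<in> J" using Suc.prems by (intro Suc.IH) auto
    then show ?thesis by (rule left_ideal_mult[OF J])
  next
    case False
    then show ?thesis using Rr_commute[of "G Y2 j" r "s - j", OF Y2_commute] left_ideal_mult[OF J Y] by simp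
  qed
  then show ?case unfolding rcoef_Suc by (intro U.subspace_sum[OF left_ideal_subspace[OF J]])
qed

text \<open>For \<open>r \<le> q\<close> the first \<open>r\<close> columns of the partition are full and the pigeonhole bound applies; for larger
\<open>r\<close> all boxes lie in the first \<open>r\<close> columns and Garland's bound applies.\<close>

lemma near_rectangle_relations:
  assumes J: "left_ideal J" and X2: "\<And>m. G X2 m \<in> J"
    and H2: "\<And>m. G H2 m - (if m = 0 then of_nat n else 0) \<in> J"
    and pow: "G Y2 0 ^ (n + 1) \<in> J"
    and Y: "\<And>j. N \<le> j \<Longrightarrow> G Y2 j \<in> J" and n: "n = q * N + m" "m < N"
  shows "cv_rels N (\<lambda>i. if i < m then q + 1 else q) (\<lambda>r s. Rr r s \<in> J)"
  unfolding cv_rels_def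
proof (intro allI impI)
  fix r s :: nat assume r: "1 \<le> r" and s: "truncated_size N (\<lambda>i. if i < m then q + 1 else q) r < s + r"
  show "Rr r s \<in> J"
  proof (cases "r \<le> q")
    case True
    then have "truncated_size N (\<lambda>i. if i < m then q + 1 else q) r = (\<Sum>i<N. r)"
      unfolding truncated_size_def by (intro sum.cong) auto
    then show ?thesis using s by (intro pigeonhole_relations[OF J Y]) auto
  next
    case False
    then have "truncated_size N (\<lambda>i. if i < m then q + 1 else q) r = (\<Sum>i<N. q + (if i < m then 1 else 0))"
      unfolding truncated_size_def by (intro sum.cong) auto
    also have "\<dots> = q * N + card ({..<N} \<inter> {i. i < m})"
      by (simp add: sum.distrib sum.If_cases)
    also have "{..<N} \<inter> {i. i < m} = {..<m}" using n by auto
    finally show ?thesis using s r n by (intro garland_relations[OF J X2 H2 pow]) auto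
  qed
qed

section \<open>Partitions with one box removed\<close>

definition antitone_below :: "nat \<Rightarrow> (nat \<Rightarrow> nat) \<Rightarrow> bool" where
  "antitone_below N \<mu> \<longleftrightarrow> (\<forall>i j. i \<le> j \<longrightarrow> j < N \<longrightarrow> \<mu> j \<le> \<mu> i)"

lemma antitone_belowD: "antitone_below N \<mu> \<Longrightarrow> i \<le> j \<Longrightarrow> j < N \<Longrightarrow> \<mu> j \<le> \<mu> i"
  by (simp add: antitone_below_def)

text \<open>To lower the part \<open>\<mu> j\<close> without destroying monotonicity, the box is taken from the last row of the
same length. The multiset of parts does not depend on this choice.\<close>

definition last_equal :: "nat \<Rightarrow> (nat \<Rightarrow> nat) \<Rightarrow> nat \<Rightarrow> nat" where
  "last_equal N \<mu> j = (GREATEST i. i < N \<and> \<mu> i = \<mu> j)"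

definition dec :: "nat \<Rightarrow> (nat \<Rightarrow> nat) \<Rightarrow> nat \<Rightarrow> nat \<Rightarrow> nat" where
  "dec N \<mu> j = \<mu>(last_equal N \<mu> j := \<mu> j - 1)"

lemma last_equal:
  assumes "j < N"
  shows "last_equal N \<mu> j < N" "\<mu> (last_equal N \<mu> j) = \<mu> j" "j \<le> last_equal N \<mu> j"
    and "\<And>i. last_equal N \<mu> j < i \<Longrightarrow> i < N \<Longrightarrow> \<mu> i \<noteq> \<mu> j"
proof -
  have b: "\<And>y. y < N \<and> \<mu> y = \<mu> j \<Longrightarrow> y \<le> N" by simp
  show "last_equal N \<mu> j < N" "\<mu> (last_equal N \<mu> j) = \<mu> j"
    using GreatestI_nat[of "\<lambda>i. i < N \<and> \<mu> i = \<mu> j" j N, OF _ b] assms by (auto simp: last_equal_def)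
  show "j \<le> last_equal N \<mu> j" unfolding last_equal_def
    using Greatest_le_nat[of "\<lambda>i. i < N \<and> \<mu> i = \<mu> j" j N, OF _ b] assms by auto
  show "\<mu> i \<noteq> \<mu> j" if "last_equal N \<mu> j < i" "i < N" for i
  proof
    assume "\<mu> i = \<mu> j"
    then have "i \<le> last_equal N \<mu> j" unfolding last_equal_def
      using Greatest_le_nat[of "\<lambda>i. i < N \<and> \<mu> i = \<mu> j" i N, OF _ b] that by auto
    then show False using that by simp
  qed
qed

lemma antitone_dec:
  assumes anti: "antitone_below N \<mu>" and j: "j < N"
  shows "antitone_below N (dec N \<mu> j)"
  unfolding antitone_below_def
proof (intro allI impI)
  fix i k assume ik: "i \<le> k" "k < N"
  let ?p = "last_equal N \<mu> j"
  note p = last_equal[OF j, of \<mu>]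
  have le: "\<mu> k \<le> \<mu> i" using antitone_belowD[OF anti ik] .
  have "\<mu> k < \<mu> j" if "?p < k"
    using antitone_belowD[OF anti, of ?p k] p(2) p(4)[OF that ik(2)] that ik by simp
  then show "dec N \<mu> j k \<le> dec N \<mu> j i"
    using le ik p(2) unfolding dec_def by (cases "i = ?p"; cases "k = ?p") auto
qed

lemma truncated_size_dec:
  assumes "j < N" "\<mu> j \<noteq> 0"
  shows "truncated_size N (dec N \<mu> j) r + (if \<mu> j \<le> r then 1 else 0) = truncated_size N \<mu> r"
  using sum_fun_upd[OF last_equal(1)[OF assms(1), of \<mu>], of "min r" \<mu> "\<mu> j - 1"]
    last_equal(2)[OF assms(1), of \<mu>] assms(2)
  by (auto simp: dec_def truncated_size_def min_def split: if_splits)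

lemma truncated_size_Suc_le:
  assumes anti: "antitone_below N \<mu>" and j: "j < N" and r: "\<mu> j \<le> r"
  shows "truncated_size N \<mu> (Suc r) \<le> truncated_size N \<mu> r + j"
proof -
  have "truncated_size N \<mu> (Suc r) \<le> (\<Sum>i<N. min r (\<mu> i) + (if i < j then 1 else 0))"
    unfolding truncated_size_def
  proof (rule sum_mono)
    fix i assume "i \<in> {..<N}"
    then show "min (Suc r) (\<mu> i) \<le> min r (\<mu> i) + (if i < j then 1 else 0)"
      using antitone_belowD[OF anti, of j i] r by (cases "i < j") auto
  qed
  also have "\<dots> = truncated_size N \<mu> r + card ({..<N} \<inter> {i. i < j})"
    by (simp add: sum.distrib truncated_size_def sum.If_cases)
  also have "{..<N} \<inter> {i. i < j} = {..<j}" using j by auto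
  finally show ?thesis by simp
qed

text \<open>The bounds produced by adding the odd generators with indices \<open>j - 1, \<dots>, 0\<close> one at a time: each of
them is either absent, or present and lowers a part. If the part is zero, the generator acts by zero. The
second function records the number \<open>e\<close> of generators that are present.\<close>

fun fermion_count :: "nat \<Rightarrow> ((nat \<Rightarrow> nat) \<Rightarrow> nat) \<Rightarrow> nat \<Rightarrow> (nat \<Rightarrow> nat) \<Rightarrow> nat" where
  "fermion_count N base 0 \<mu> = base \<mu>"
| "fermion_count N base (Suc j) \<mu> = fermion_count N base j \<mu> + (if \<mu> j = 0 then 0 else fermion_count N base j (dec N \<mu> j))"

fun fermion_count_at :: "nat \<Rightarrow> ((nat \<Rightarrow> nat) \<Rightarrow> nat) \<Rightarrow> nat \<Rightarrow> nat \<Rightarrow> (nat \<Rightarrow> nat) \<Rightarrow> nat" where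
  "fermion_count_at N base 0 e \<mu> = (if e = 0 then base \<mu> else 0)"
| "fermion_count_at N base (Suc j) e \<mu> = fermion_count_at N base j e \<mu> +
     (if e = 0 \<or> \<mu> j = 0 then 0 else fermion_count_at N base j (e - 1) (dec N \<mu> j))"

lemma fermion_count_at_0: "j < e \<Longrightarrow> fermion_count_at N base j e \<mu> = 0"
  by (induction j arbitrary: e \<mu>) auto

lemma sum_fermion_count_at: "j \<le> M \<Longrightarrow> (\<Sum>e\<le>M. fermion_count_at N base j e \<mu>) = fermion_count N base j \<mu>"
proof (induction j arbitrary: M \<mu>)
  case 0 then show ?case by (simp add: sum.delta)
next
  case (Suc j)
  then obtain M' where M: "M = Suc M'" by (cases M) auto
  have "(\<Sum>e\<le>M. if e = 0 \<or> \<mu> j = 0 then 0 else fermion_count_at N base j (e - 1) (dec N \<mu> j)) =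
     (if \<mu> j = 0 then 0 else \<Sum>e\<le>M'. fermion_count_at N base j e (dec N \<mu> j))"
    unfolding M by (subst sum.atMost_Suc_shift) simp
  moreover have "(\<Sum>e\<le>M. fermion_count_at N base j e \<mu>) = fermion_count N base j \<mu>"
    "(\<Sum>e\<le>M'. fermion_count_at N base j e (dec N \<mu> j)) = fermion_count N base j (dec N \<mu> j)"
    by (rule Suc.IH, use Suc.prems M in simp)+
  ultimately show ?case by (simp only: fermion_count_at.simps(2) fermion_count.simps(2) sum.distrib)
qed

text \<open>Each part \<open>c\<close> contributes \<open>f c\<close> when its generator is absent and \<open>f (c - 1)\<close> when it is present, so a
product over the parts remains a product.\<close>

lemma fermion_count_closed_form:
  assumes f: "\<And>c. 0 < f c" and h: "h 0 = f 0" "\<And>c. h (Suc c) = f (Suc c) + f c"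
  shows "antitone_below N \<mu> \<Longrightarrow> j \<le> N \<Longrightarrow>
    fermion_count N (\<lambda>\<mu>. \<Prod>i<N. f (\<mu> i)) j \<mu> = (\<Prod>i<j. h (\<mu> i)) * (\<Prod>i\<in>{j..<N}. f (\<mu> i))"
proof (induction j arbitrary: \<mu>)
  case 0 then show ?case by (simp add: atLeast0LessThan)
next
  case (Suc j)
  define R where "R = (\<Prod>i\<in>{Suc j..<N}. f (\<mu> i))"
  define P where "P = (\<Prod>i<j. h (\<mu> i))"
  have split: "{j..<N} = insert j {Suc j..<N}" using Suc.prems by auto
  have 1: "fermion_count N (\<lambda>\<mu>. \<Prod>i<N. f (\<mu> i)) j \<mu> = P * (f (\<mu> j) * R)"
    using Suc by (simp add: P_def R_def split)
  show ?case
  proof (cases "\<mu> j = 0")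
    case True then show ?thesis using 1 h(1) by (simp add: P_def R_def)
  next
    case False
    let ?p = "last_equal N \<mu> j"
    have jN: "j < N" using Suc.prems by simp
    note p = last_equal[OF jN, of \<mu>]
    have "fermion_count N (\<lambda>\<mu>. \<Prod>i<N. f (\<mu> i)) j (dec N \<mu> j) =
      (\<Prod>i<j. h (dec N \<mu> j i)) * (\<Prod>i\<in>{j..<N}. f (dec N \<mu> j i))"
      using Suc.prems antitone_dec[OF _ jN] by (intro Suc.IH) auto
    also have "(\<Prod>i<j. h (dec N \<mu> j i)) = P"
      unfolding P_def using p(3) by (intro prod.cong) (auto simp: dec_def)
    also have "(\<Prod>i\<in>{j..<N}. f (dec N \<mu> j i)) = f (\<mu> j - 1) * R"
    proof -
      have "(\<Prod>i\<in>{j..<N}. f (dec N \<mu> j i)) = f (\<mu> j - 1) * (\<Prod>i\<in>{j..<N} - {?p}. f (\<mu> i))"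
        using p by (subst prod.remove[of _ ?p]) (auto simp: dec_def intro!: prod.cong)
      moreover have e1: "(\<Prod>i\<in>{j..<N}. f (\<mu> i)) = f (\<mu> j) * (\<Prod>i\<in>{j..<N} - {?p}. f (\<mu> i))"
        using p by (subst prod.remove[of _ ?p]) auto
      have e2: "(\<Prod>i\<in>{j..<N}. f (\<mu> i)) = f (\<mu> j) * R" by (simp add: split R_def)
      have "f (\<mu> j) * (\<Prod>i\<in>{j..<N} - {?p}. f (\<mu> i)) = f (\<mu> j) * R" by (rule trans[OF sym[OF e1] e2])
      then have "(\<Prod>i\<in>{j..<N} - {?p}. f (\<mu> i)) = R"
        using f[of "\<mu> j"] by (metis less_numeral_extra(3) mult_cancel1)
      ultimately show ?thesis by simp
    qed
    finally have "fermion_count N (\<lambda>\<mu>. \<Prod>i<N. f (\<mu> i)) (Suc j) \<mu> = P * (f (\<mu> j) * R) + P * (f (\<mu> j - 1) * R)"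
      using 1 False by simp
    moreover have "h (\<mu> j) = f (\<mu> j) + f (\<mu> j - 1)" using h(2)[of "\<mu> j - 1"] False by simp
    ultimately show ?thesis by (simp add: P_def[symmetric] R_def[symmetric] algebra_simps)
  qed
qed

section \<open>Adding one odd generator\<close>

text \<open>The set \<open>A\<close> consists of the currents of a subalgebra: the induction over odd generators needs submodules
under the part of the algebra for which the bound is known already, not left ideals.\<close>

inductive_set op_closure :: "Uenv set \<Rightarrow> Uenv set \<Rightarrow> Uenv set" for A S where
  base: "u \<in> S \<Longrightarrow> u \<in> op_closure A S"
| zero: "0 \<in> op_closure A S"
| add: "u \<in> op_closure A S \<Longrightarrow> v \<in> op_closure A S \<Longrightarrow> u + v \<in> op_closure A S"
| scale: "u \<in> op_closure A S \<Longrightarrow> cscale c u \<in> op_closure A S"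
| act: "a \<in> A \<Longrightarrow> u \<in> op_closure A S \<Longrightarrow> a * u \<in> op_closure A S"

lemma subspace_op_closure: "U.subspace (op_closure A S)"
  by (auto simp: U.subspace_def intro: op_closure.intros)

lemma op_closure_minimal:
  assumes "U.subspace T" "S \<subseteq> T" "\<And>a u. a \<in> A \<Longrightarrow> u \<in> T \<Longrightarrow> a * u \<in> T"
  shows "op_closure A S \<subseteq> T"
proof
  fix u assume "u \<in> op_closure A S" then show "u \<in> T"
    by induction (use assms in \<open>auto simp: U.subspace_def\<close>)
qed

lemma op_closure_mono: "S \<subseteq> T \<Longrightarrow> op_closure A S \<subseteq> op_closure A T"
  by (rule op_closure_minimal) (auto intro: subspace_op_closure op_closure.intros)

lemma rdim_op_closure:
  assumes B: "U.subspace B" "\<And>a u. a \<in> A \<Longrightarrow> u \<in> B \<Longrightarrow> a * u \<in> B" and d: "U.rdim (op_closure A S) B d"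
  shows "U.rdim (op_closure A (B \<union> S)) B d"
proof -
  obtain T where T: "finite T" "card T \<le> d" "op_closure A S \<subseteq> U.span (T \<union> B)" using d by (auto simp: U.rdim_def)
  have "op_closure A (B \<union> S) \<subseteq> {x + y |x y. x \<in> B \<and> y \<in> op_closure A S}"
  proof (rule op_closure_minimal)
    show "U.subspace {x + y |x y. x \<in> B \<and> y \<in> op_closure A S}"
      by (rule U.subspace_sums[OF B(1) subspace_op_closure])
    show "B \<union> S \<subseteq> {x + y |x y. x \<in> B \<and> y \<in> op_closure A S}"
    proof
      fix u assume "u \<in> B \<union> S"
      then show "u \<in> {x + y |x y. x \<in> B \<and> y \<in> op_closure A S}"
      proof
        assume "u \<in> B" then show ?thesis
          by (intro CollectI exI[of _ u] exI[of _ 0]) (auto intro: op_closure.zero)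
      next
        assume "u \<in> S" then show ?thesis
          by (intro CollectI exI[of _ 0] exI[of _ u]) (auto intro: op_closure.base U.subspace_0[OF B(1)])
      qed
    qed
    fix a u assume "a \<in> A" "u \<in> {x + y |x y. x \<in> B \<and> y \<in> op_closure A S}"
    then show "a * u \<in> {x + y |x y. x \<in> B \<and> y \<in> op_closure A S}"
      using B(2) op_closure.act by (fastforce simp: distrib_left)
  qed
  also have "\<dots> \<subseteq> U.span (T \<union> B)"
    using T(3) by (auto intro!: U.span_add intro: U.span_base)
  finally show ?thesis using T unfolding U.rdim_def by blast
qed

text \<open>Commuting with \<open>D\<close> acts on the generating series of \<open>y\<close> as a derivation with values \<open>\<xi>\<close>.\<close>

lemma rcoef_derivation:
  fixes y \<xi> :: "nat \<Rightarrow> 'a::ring_1"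
  assumes D: "\<And>i. D * y i = y i * D + \<xi> i" and comm: "\<And>i k. \<xi> i * y k = y k * \<xi> i"
  shows "D * rcoef y (Suc r) s = rcoef y (Suc r) s * D + of_nat (Suc r) * (\<Sum>i\<le>s. \<xi> i * rcoef y r (s - i))"
proof -
  let ?D = "fps_const D" and ?y = "Abs_fps y" and ?x = "Abs_fps \<xi>"
  have Dy: "?D * ?y = ?y * ?D + ?x" by (rule fps_ext) (simp add: D)
  have xy: "?x * ?y = ?y * ?x"
  proof (rule fps_ext)
    fix n
    have "(\<Sum>i=0..n. \<xi> i * y (n - i)) = (\<Sum>i=0..n. y i * \<xi> (n - i))"
      by (rule sum.reindex_bij_witness[of _ "\<lambda>i. n - i" "\<lambda>i. n - i"]) (auto simp: comm)
    then show "fps_nth (?x * ?y) n = fps_nth (?y * ?x) n" by (simp add: fps_mult_nth)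
  qed
  have "?D * ?y ^ Suc r = ?y ^ Suc r * ?D + of_nat (Suc r) * (?x * ?y ^ r)"
  proof (induction r)
    case 0 show ?case by (simp add: Dy)
  next
    case (Suc r)
    have "?D * ?y ^ Suc (Suc r) = (?D * ?y) * ?y ^ Suc r" by (simp add: mult.assoc)
    also have "\<dots> = ?y * (?D * ?y ^ Suc r) + ?x * ?y ^ Suc r" by (simp only: Dy distrib_right mult.assoc)
    also have "\<dots> = ?y * (?y ^ Suc r * ?D) + (?y * (of_nat (Suc r) * (?x * ?y ^ r)) + ?x * ?y ^ Suc r)"
      unfolding Suc by (simp only: distrib_left add.assoc)
    also have "?y * (of_nat (Suc r) * (?x * ?y ^ r)) = of_nat (Suc r) * ((?y * ?x) * ?y ^ r)"
      by (metis (no_types, lifting) mult.assoc mult_of_nat_commute)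
    also have "(?y * ?x) * ?y ^ r = ?x * ?y ^ Suc r" by (simp add: xy[symmetric] mult.assoc)
    also have "of_nat (Suc r) * (?x * ?y ^ Suc r) + ?x * ?y ^ Suc r = of_nat (Suc (Suc r)) * (?x * ?y ^ Suc r)"
      by (simp add: distrib_right add.assoc)
    also have "?y * (?y ^ Suc r * ?D) = ?y ^ Suc (Suc r) * ?D" by (simp add: mult.assoc)
    finally show ?case .
  qed
  then have "fps_nth (?D * ?y ^ Suc r) s = fps_nth (?y ^ Suc r * ?D + of_nat (Suc r) * (?x * ?y ^ r)) s"
    by simp
  then show ?thesis
    unfolding fps_add_nth fps_nth_of_nat_mult fps_mult_left_const_nth fps_mult_right_const_nth
      fps_mult_nth[of ?x] rcoef_def atLeast0AtMost by simp
qed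

text \<open>Applying \<open>D\<close> to the relation \<open>R(r+1,s) w = 0\<close> gives the mixed relations
\<open>\<Sum>i. \<xi>_i R(r,s-i) w = 0\<close>. In the one with \<open>s + j\<close> in place of \<open>s\<close>, the terms with \<open>i > j\<close> vanish by
assumption, those with \<open>i < j\<close> by the relations for \<open>w\<close>, and \<open>R(r,s) \<xi>_j w = 0\<close> remains. Compared with
the relations for \<open>w\<close>, this gains one in the bound for all \<open>r \<ge> \<mu> j\<close>, which is the effect of removing
a box from a row of length \<open>\<mu> j\<close>.\<close>

lemma extract_fermion:
  assumes B: "U.subspace B" and anti: "antitone_below N \<mu>" and j: "j < N"
    and D: "\<And>i. D * G Y2 i = G Y2 i * D + \<xi> i" and comm: "\<And>i k. \<xi> i * G Y2 k = G Y2 k * \<xi> i"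
    and a: "\<And>r s. 1 \<le> r \<Longrightarrow> truncated_size N \<mu> r < s + r \<Longrightarrow> D * (Rr r s * w) \<in> B"
    and a': "\<And>r s. Rr r s * (D * w) \<in> B"
    and b: "\<And>i r s. 1 \<le> r \<Longrightarrow> truncated_size N \<mu> r < s + r \<Longrightarrow> \<xi> i * (Rr r s * w) \<in> B"
    and c: "\<And>i r s. j < i \<Longrightarrow> \<xi> i * (Rr r s * w) \<in> B"
  shows "\<mu> j \<noteq> 0 \<Longrightarrow> cv_rels N (dec N \<mu> j) (\<lambda>r s. Rr r s * (\<xi> j * w) \<in> B)"
    and "\<mu> j = 0 \<Longrightarrow> \<xi> j * w \<in> B"
proof -
  have mixed: "(\<Sum>i\<le>s. \<xi> i * (Rr r (s - i) * w)) \<in> B" if "truncated_size N \<mu> (Suc r) < s + Suc r" for r s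
  proof -
    have "D * (Rr (Suc r) s * w) = Rr (Suc r) s * (D * w) + of_nat (Suc r) * (\<Sum>i\<le>s. \<xi> i * (Rr r (s - i) * w))"
    proof -
      have "D * (Rr (Suc r) s * w) = (D * Rr (Suc r) s) * w" by (simp only: mult.assoc)
      also have "\<dots> = (Rr (Suc r) s * D + of_nat (Suc r) * (\<Sum>i\<le>s. \<xi> i * Rr r (s - i))) * w"
        by (simp only: rcoef_derivation[of D "G Y2" \<xi> r s, OF D comm])
      finally show ?thesis by (simp only: distrib_right mult.assoc sum_distrib_right)
    qed
    then have "of_nat (Suc r) * (\<Sum>i\<le>s. \<xi> i * (Rr r (s - i) * w)) = D * (Rr (Suc r) s * w) - Rr (Suc r) s * (D * w)"
      by simp
    also have "\<dots> \<in> B" using a[of "Suc r" s] a' that by (intro U.subspace_diff[OF B]) auto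
    finally show ?thesis by (rule subspace_of_nat_cancel[OF B]) simp
  qed
  have step: "\<xi> j * (Rr r s * w) \<in> B"
    if "\<mu> j \<le> r" "truncated_size N \<mu> r < Suc s + r" "r = 0 \<Longrightarrow> s = 0" for r s
  proof -
    have "truncated_size N \<mu> (Suc r) < (s + j) + Suc r"
      using truncated_size_Suc_le[OF anti j that(1)] that(2) by simp
    from mixed[OF this]
    have "\<xi> j * (Rr r s * w) + (\<Sum>i\<in>{..s+j} - {j}. \<xi> i * (Rr r (s + j - i) * w)) \<in> B"
      by (subst (asm) sum.remove[of _ j]) auto
    moreover have "\<xi> i * (Rr r (s + j - i) * w) \<in> B" if "i \<in> {..s+j} - {j}" for i
    proof (cases "i < j")
      case True
      show ?thesis
      proof (cases "r = 0")
        case True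
        then show ?thesis using \<open>i < j\<close> U.subspace_0[OF B] by (simp add: rcoef_0)
      next
        case False
        then show ?thesis using \<open>i < j\<close> \<open>truncated_size N \<mu> r < Suc s + r\<close> by (intro b) auto
      qed
    next
      case False then show ?thesis using that by (intro c) auto
    qed
    then have "(\<Sum>i\<in>{..s+j} - {j}. \<xi> i * (Rr r (s + j - i) * w)) \<in> B" by (intro U.subspace_sum[OF B])
    ultimately have "(\<xi> j * (Rr r s * w) + (\<Sum>i\<in>{..s+j} - {j}. \<xi> i * (Rr r (s + j - i) * w)))
        - (\<Sum>i\<in>{..s+j} - {j}. \<xi> i * (Rr r (s + j - i) * w)) \<in> B" by (rule U.subspace_diff[OF B])
    then show ?thesis by simp
  qed
  show "\<xi> j * w \<in> B" if "\<mu> j = 0"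
    using step[of 0 0] that by (simp add: rcoef_0 truncated_size_def)
  show "cv_rels N (dec N \<mu> j) (\<lambda>r s. Rr r s * (\<xi> j * w) \<in> B)" if "\<mu> j \<noteq> 0"
    unfolding cv_rels_def
  proof (intro allI impI)
    fix r s :: nat assume rs: "1 \<le> r" "truncated_size N (dec N \<mu> j) r < s + r"
    have "\<xi> j * (Rr r s * w) \<in> B"
    proof (cases "truncated_size N \<mu> r < s + r")
      case True then show ?thesis using rs by (intro b) auto
    next
      case False
      then have "\<mu> j \<le> r" using truncated_size_dec[of j N \<mu> r, OF j that] rs by (auto split: if_splits)
      then show ?thesis using truncated_size_dec[of j N \<mu> r, OF j that] rs by (intro step) (auto split: if_splits)
    qed
    then show "Rr r s * (\<xi> j * w) \<in> B"
      using Rr_commute[of "\<xi> j" r s] comm[of j] by (simp add: mult.assoc[symmetric])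
  qed
qed

lemma odd_square_in:
  assumes B: "U.subspace B" and a: "odd_gen a" "brk a a = []"
  shows "G a m * (G a m * u) \<in> B"
proof -
  define x where "x = G a m * (G a m * u)"
  have "x = - x" unfolding x_def by (subst (1) G_comm_assoc) (simp add: a)
  then have "x + x = 0" by (metis add.right_inverse)
  then have "of_nat 2 * x = 0" by (simp add: mult_2)
  then have "of_nat 2 * x \<in> B" using U.subspace_0[OF B] by simp
  then show ?thesis unfolding x_def by (rule subspace_of_nat_cancel[OF B]) simp
qed

section \<open>The upper bound\<close>

definition Y_ops :: "Uenv set" where
  "Y_ops = {G g m |g m. g \<in> {Y2, Y3}}"

definition par_ops :: "Uenv set" where
  "par_ops = {G g m |g m. g \<in> {Y1, Y2, Y3, X2, H1, H2}}"

definition base1 :: "nat \<Rightarrow> (nat \<Rightarrow> nat) \<Rightarrow> nat" where "base1 N \<mu> = (\<Prod>i<N. \<mu> i + 1)"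
definition base2 :: "nat \<Rightarrow> (nat \<Rightarrow> nat) \<Rightarrow> nat" where "base2 N \<mu> = fermion_count N (base1 N) N \<mu>"

interpretation YU: complex_space_pair yscale cscale ..

lemma boson_layer:
  assumes B: "U.subspace B" "\<And>m u. u \<in> B \<Longrightarrow> G Y2 m * u \<in> B"
    and anti: "antitone_below N \<mu>" and rel: "cv_rels N \<mu> (\<lambda>r s. Rr r s * w \<in> B)"
  shows "U.rdim {evU f * w |f. True} B (base1 N \<mu>)"
proof -
  have "yideal {f. evU f * w \<in> B}"
    using U.subspace_0[OF B(1)] U.subspace_add[OF B(1)] U.subspace_scale[OF B(1)] B(2)
    by (auto simp: yideal_def Y.subspace_def U.ev_0 U.ev_add U.ev_yscale evU_mult distrib_right U.scale_mult mult.assoc)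
  then have "Y.rdim UNIV {f. evU f * w \<in> B} (base1 N \<mu>)"
    unfolding base1_def
    by (rule boson_bound) (use anti rel in \<open>auto simp: antitone_below_def evU_rcoef\<close>)
  moreover have "Vector_Spaces.linear yscale cscale (\<lambda>f. evU f * w)"
    by unfold_locales (auto simp: U.ev_add distrib_right U.ev_yscale U.scale_mult)
  ultimately have "U.rdim (range (\<lambda>f. evU f * w)) ((\<lambda>f. evU f * w) ` {f. evU f * w \<in> B}) (base1 N \<mu>)"
    by (intro YU.rdim_image)
  then show ?thesis by (rule U.rdim_mono) auto
qed

lemma Y_ops_closed:
  assumes T: "U.subspace T" and S: "\<And>u. u \<in> S \<Longrightarrow> u \<in> T \<and> G Y1 0 * u \<in> T"
    and TY: "\<And>a u. a \<in> Y_ops \<Longrightarrow> u \<in> T \<Longrightarrow> a * u \<in> T"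
    and u: "u \<in> op_closure Y_ops S"
  shows "u \<in> T \<and> G Y1 0 * u \<in> T"
  using u
proof induction
  case (act a u)
  then have uT: "u \<in> T" "G Y1 0 * u \<in> T" by auto
  have TY': "G g m * v \<in> T" if "g \<in> {Y2, Y3}" "v \<in> T" for g m v
    using TY[of "G g m" v] that by (auto simp: Y_ops_def)
  obtain g m where a: "a = G g m" "g \<in> {Y2, Y3}" using act(1) by (auto simp: Y_ops_def)
  have "G Y1 0 * (G g m * u) \<in> T"
    by (rule comm_in[OF T]) (use a uT TY' in auto)
  then show ?case using a uT TY' by auto
qed (use S U.subspace_0[OF T] U.subspace_add[OF T] U.subspace_scale[OF T] in \<open>auto simp: distrib_left mult_cscale\<close>)

text \<open>The bound for the span of products of currents of \<open>y_2\<close> and \<open>y_3\<close> applied to \<open>w\<close>. If \<open>y_3(i) w\<close> vanishes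
modulo \<open>B\<close> for \<open>i > j\<close>, then modulo the submodule generated by \<open>y_3(j) w\<close> it vanishes for \<open>i \<ge> j\<close>, and
the vector \<open>y_3(j) w\<close> is again killed by \<open>y_3(i)\<close>, \<open>i \<ge> j\<close>, because odd elements square to zero.
The derivation with values \<open>- y_3(i)\<close> is the bracket with \<open>y_1(0)\<close>.\<close>

lemma inner_layer:
  assumes "U.subspace B" "\<And>a u. a \<in> Y_ops \<Longrightarrow> u \<in> B \<Longrightarrow> a * u \<in> B" "\<And>u. u \<in> B \<Longrightarrow> G Y1 0 * u \<in> B"
    and "antitone_below N \<mu>" "G Y1 0 * w \<in> B" "\<And>i. j \<le> i \<Longrightarrow> G Y3 i * w \<in> B"
    and "cv_rels N \<mu> (\<lambda>r s. Rr r s * w \<in> B)" "j \<le> N"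
  shows "U.rdim (op_closure Y_ops {w}) B (fermion_count N (base1 N) j \<mu>)"
  using assms
proof (induction j arbitrary: w \<mu> B)
  case 0
  note B = 0(1) and BY = 0(2)
  have BY': "G g m * v \<in> B" if "g \<in> {Y2, Y3}" "v \<in> B" for g m v
    using BY[of "G g m" v] that by (auto simp: Y_ops_def)
  obtain T where T: "finite T" "card T \<le> base1 N \<mu>" "{evU f * w |f. True} \<subseteq> U.span (T \<union> B)"
    using boson_layer[OF B _ 0(4) 0(7)] BY' by (auto simp: U.rdim_def)
  let ?T = "{x + y |x y. x \<in> {evU f * w |f. True} \<and> y \<in> B}"
  have sub: "U.subspace {evU f * w |f. True}"
    unfolding U.subspace_def
  proof (intro conjI ballI allI)
    show "0 \<in> {evU f * w |f. True}" by (intro CollectI exI[of _ 0]) (simp add: U.ev_0)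
    fix x y assume "x \<in> {evU f * w |f. True}" "y \<in> {evU f * w |f. True}"
    then obtain f g where "x = evU f * w" "y = evU g * w" by auto
    then show "x + y \<in> {evU f * w |f. True}"
      by (intro CollectI exI[of _ "f + g"]) (simp add: U.ev_add distrib_right)
  next
    fix c x assume "x \<in> {evU f * w |f. True}"
    then obtain f where "x = evU f * w" by auto
    then show "cscale c x \<in> {evU f * w |f. True}"
      by (intro CollectI exI[of _ "yscale c f"]) (simp add: U.ev_yscale U.scale_mult)
  qed
  have "op_closure Y_ops {w} \<subseteq> ?T"
  proof (rule op_closure_minimal)
    show "U.subspace ?T" by (rule U.subspace_sums[OF sub B])
    have "w + 0 \<in> ?T" using U.subspace_0[OF B] U.ev_1[of "G Y2"] by (metis (mono_tags, lifting) mem_Collect_eq mult_1)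
    then show "{w} \<subseteq> ?T" by simp
    fix a u assume "a \<in> Y_ops" "u \<in> ?T"
    then obtain g m f y where a: "a = G g m" "g \<in> {Y2, Y3}" and u: "u = evU f * w + y" "y \<in> B"
      by (auto simp: Y_ops_def)
    have y: "a * y \<in> B" using a u BY' by simp
    show "a * u \<in> ?T"
    proof (cases "g = Y2")
      case True
      then have "a * u = evU (yv m * f) * w + a * y" using a u by (simp add: evU_mult distrib_left mult.assoc)
      then show ?thesis using y by blast
    next
      case False
      then have g: "g = Y3" using a by simp
      have c: "G Y3 m * G Y2 j = G Y2 j * G Y3 m" for j using G_comm[of Y3 m Y2 j] by simp
      have "a * (evU f * w) = evU f * (G Y3 m * w)"
        using evU_commute[of "G Y3 m" f, OF c] a g by (simp add: mult.assoc[symmetric])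
      moreover have "evU f * (G Y3 m * w) \<in> B" using 0(6) BY' by (intro evU_closed[OF B]) auto
      ultimately have "a * u \<in> B" using u y U.subspace_add[OF B] by (simp add: distrib_left)
      moreover have "a * u = evU 0 * w + a * u" by (simp add: U.ev_0)
      ultimately show ?thesis by blast
    qed
  qed
  also have "?T \<subseteq> U.span (T \<union> B)" using T(3) by (auto intro!: U.span_add intro: U.span_base)
  finally show ?case using T unfolding U.rdim_def by auto
next
  case (Suc j)
  note B = Suc.prems(1) and BY = Suc.prems(2) and BY1 = Suc.prems(3) and anti = Suc.prems(4)
  note w1 = Suc.prems(5) and w3 = Suc.prems(6) and rel = Suc.prems(7)
  have jN: "j < N" using Suc.prems(8) by simp
  have BY': "G g m * v \<in> B" if "g \<in> {Y2, Y3}" "v \<in> B" for g m v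
    using BY[of "G g m" v] that by (auto simp: Y_ops_def)
  have c: "G Y3 m * G Y2 j = G Y2 j * G Y3 m" for m j using G_comm[of Y3 m Y2 j] by simp
  have Rr_closed: "Rr r s * u \<in> B" if "u \<in> B" for r s u
    using evU_closed[OF B _ that, of "rcoef yv r s"] BY' by (simp add: evU_rcoef)
  have ex: "\<mu> j \<noteq> 0 \<Longrightarrow> cv_rels N (dec N \<mu> j) (\<lambda>r s. Rr r s * (- G Y3 j * w) \<in> B)"
    "\<mu> j = 0 \<Longrightarrow> - G Y3 j * w \<in> B"
  proof -
    have D: "G Y1 0 * G Y2 i = G Y2 i * G Y1 0 + - G Y3 i" for i using G_comm[of Y1 0 Y2 i] by simp
    have comm: "- G Y3 i * G Y2 k = G Y2 k * - G Y3 i" for i k by (simp add: c)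
    have b: "- G Y3 i * (Rr r s * w) \<in> B" if "Rr r s * w \<in> B" for i r s
      using U.subspace_neg[OF B] BY' that by simp
    have cc: "- G Y3 i * (Rr r s * w) \<in> B" if "j < i" for i r s
    proof -
      have "G Y3 i * (Rr r s * w) = Rr r s * (G Y3 i * w)"
        using Rr_commute[of "G Y3 i" r s, OF c] by (simp add: mult.assoc[symmetric])
      then show ?thesis using U.subspace_neg[OF B] Rr_closed w3[of i] that by simp
    qed
    show "\<mu> j \<noteq> 0 \<Longrightarrow> cv_rels N (dec N \<mu> j) (\<lambda>r s. Rr r s * (- G Y3 j * w) \<in> B)"
      by (rule extract_fermion(1)[OF B anti jN D comm]) (use BY1 Rr_closed w1 b cc cv_relsD[OF rel] in auto)
    show "\<mu> j = 0 \<Longrightarrow> - G Y3 j * w \<in> B"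
      by (rule extract_fermion(2)[OF B anti jN D comm]) (use BY1 Rr_closed w1 b cc cv_relsD[OF rel] in auto)
  qed
  show ?case
  proof (cases "\<mu> j = 0")
    case True
    then have "G Y3 j * w \<in> B" using ex(2) U.subspace_neg[OF B] by fastforce
    then have "G Y3 i * w \<in> B" if "j \<le> i" for i using w3[of i] that by (cases "i = j") auto
    then have "U.rdim (op_closure Y_ops {w}) B (fermion_count N (base1 N) j \<mu>)"
      using B BY BY1 anti w1 rel Suc.prems(8) by (intro Suc.IH) auto
    then show ?thesis using True by simp
  next
    case False
    let ?w = "G Y3 j * w"
    have "U.rdim (op_closure Y_ops {?w}) B (fermion_count N (base1 N) j (dec N \<mu> j))"
    proof (rule Suc.IH[OF B BY BY1 antitone_dec[OF anti jN]])
      show "G Y1 0 * ?w \<in> B"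
      proof (rule comm_in[OF B])
        show "G Y3 j * (G Y1 0 * w) \<in> B" using BY' w1 by simp
      qed simp
      show "G Y3 i * ?w \<in> B" if "j \<le> i" for i
      proof (cases "i = j")
        case True
        then show ?thesis using odd_square_in[OF B, of Y3 j w] by simp
      next
        case False
        show ?thesis
        proof (rule comm_in[OF B])
          show "G Y3 j * (G Y3 i * w) \<in> B" using BY' w3[of i] False that by simp
        qed simp
      qed
      have "Rr r s * ?w \<in> B" if "Rr r s * (- G Y3 j * w) \<in> B" for r s
        using that U.subspace_neg[OF B, of "Rr r s * (- G Y3 j * w)"] by simp
      then show "cv_rels N (dec N \<mu> j) (\<lambda>r s. Rr r s * ?w \<in> B)"
        using ex(1)[OF False] by (auto simp: cv_rels_def)
    qed (use jN in auto)
    then have r1: "U.rdim (op_closure Y_ops (B \<union> {?w})) B (fermion_count N (base1 N) j (dec N \<mu> j))"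
      using BY by (intro rdim_op_closure[OF B])
    let ?B = "op_closure Y_ops (B \<union> {?w})"
    have BB: "B \<subseteq> ?B" by (auto intro: op_closure.base)
    have r2: "U.rdim (op_closure Y_ops {w}) ?B (fermion_count N (base1 N) j \<mu>)"
    proof (rule Suc.IH[OF subspace_op_closure op_closure.act _ anti])
      fix u assume u: "u \<in> ?B"
      have "G Y1 0 * ?w \<in> B"
      proof (rule comm_in[OF B])
        show "G Y3 j * (G Y1 0 * w) \<in> B" using BY' w1 by simp
      qed simp
      then have "v \<in> B \<union> {?w} \<Longrightarrow> v \<in> ?B \<and> G Y1 0 * v \<in> ?B" for v
        using BB BY1 by (auto intro: op_closure.base)
      then show "G Y1 0 * u \<in> ?B"
        using Y_ops_closed[OF subspace_op_closure[of Y_ops "B \<union> {?w}"] _ op_closure.act u] by blast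
    next
      show "G Y1 0 * w \<in> ?B" using w1 BB by blast
      show "G Y3 i * w \<in> ?B" if "j \<le> i" for i
        using w3[of i] BB that by (cases "i = j") (auto intro: op_closure.base)
      show "cv_rels N \<mu> (\<lambda>r s. Rr r s * w \<in> ?B)" using rel BB by (auto simp: cv_rels_def)
    qed (use jN in auto)
    show ?thesis using U.rdim_trans[OF r2 r1] False by simp
  qed
qed

abbreviation par_closure :: "Uenv set \<Rightarrow> Uenv set" where "par_closure \<equiv> op_closure par_ops"

text \<open>The generators listed in \<open>par_ops\<close> span a parabolic subalgebra, the even part together with \<open>y_1\<close> and \<open>y_3\<close>.\<close>

definition par_stable :: "Uenv set \<Rightarrow> bool" where
  "par_stable B \<longleftrightarrow> U.subspace B \<and> (\<forall>a\<in>par_ops. \<forall>u\<in>B. a * u \<in> B)"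

lemma par_stableD: "par_stable B \<Longrightarrow> U.subspace B" "par_stable B \<Longrightarrow> g \<in> {Y1, Y2, Y3, X2, H1, H2} \<Longrightarrow> u \<in> B \<Longrightarrow> G g m * u \<in> B"
  by (auto simp: par_stable_def par_ops_def)

lemma par_stable_par_closure: "par_stable (par_closure S)"
  by (auto simp: par_stable_def subspace_op_closure intro: op_closure.act)

lemma par_closure_minimal: "par_stable T \<Longrightarrow> S \<subseteq> T \<Longrightarrow> par_closure S \<subseteq> T"
  by (rule op_closure_minimal) (auto simp: par_stable_def)

lemma par_stable_Rr:
  assumes "par_stable B" "u \<in> B" shows "Rr r s * u \<in> B"
  using evU_closed[OF par_stableD(1)[OF assms(1)] _ assms(2), of "rcoef yv r s"] par_stableD(2)[OF assms(1)]
  by (simp add: evU_rcoef)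

text \<open>On a highest weight vector, the currents of \<open>y_1\<close>, \<open>x_2\<close> and the Cartan elements produce nothing new, so the
closure under the whole parabolic part is the closure under \<open>y_2\<close> and \<open>y_3\<close>.\<close>

lemma inner_layer_par_closure:
  assumes B: "par_stable B" and anti: "antitone_below N \<mu>"
    and Y1: "\<And>m. G Y1 m * w \<in> B" and X2: "\<And>m. G X2 m * w \<in> B"
    and H: "\<And>m. G H1 m * w \<in> U.span (insert w B)" "\<And>m. G H2 m * w \<in> U.span (insert w B)"
    and rel: "cv_rels N \<mu> (\<lambda>r s. Rr r s * w \<in> B)"
  shows "U.rdim (par_closure {w}) B (base2 N \<mu>)"
proof -
  note sub = par_stableD(1)[OF B] and act = par_stableD(2)[OF B]
  have Y2: "G Y2 i * w \<in> B" if "N \<le> i" for i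
  proof -
    have "truncated_size N \<mu> 1 \<le> N" using truncated_size_le[of N N \<mu> 1] by simp
    then show ?thesis using cv_relsD[OF rel, of 1 i] that by (simp add: rcoef_1)
  qed
  have Y3: "G Y3 i * w \<in> B" if "N \<le> i" for i
  proof -
    have "G Y1 0 * (G Y2 i * w) = G Y2 i * (G Y1 0 * w) - G Y3 i * w" by (subst G_comm_assoc) simp
    then have "G Y3 i * w = G Y2 i * (G Y1 0 * w) - G Y1 0 * (G Y2 i * w)" by simp
    also have "\<dots> \<in> B" using act Y1 Y2[OF that] by (intro U.subspace_diff[OF sub]) auto
    finally show ?thesis .
  qed
  have d: "U.rdim (op_closure Y_ops {w}) B (base2 N \<mu>)"
    unfolding base2_def using act Y1 Y3 anti rel sub
    by (intro inner_layer) (auto simp: Y_ops_def)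
  have YB: "a * u \<in> B" if "a \<in> Y_ops" "u \<in> B" for a u using that act by (auto simp: Y_ops_def)
  let ?T = "op_closure Y_ops (B \<union> {w})"
  have T: "U.subspace ?T" by (rule subspace_op_closure)
  have BT: "B \<subseteq> ?T" "w \<in> ?T" by (auto intro: op_closure.base)
  have TY: "G g m * u \<in> ?T" if "g \<in> {Y2, Y3}" "u \<in> ?T" for g m u
    using that by (auto simp: Y_ops_def intro: op_closure.act)
  have spanT: "U.span (insert w B) \<subseteq> ?T" using BT by (intro U.span_minimal T) auto
  have "\<forall>g\<in>{Y1, X2, H1, H2}. \<forall>m. G g m * u \<in> ?T" if "u \<in> ?T" for u
    using that
  proof induction
    case (base u)
    then show ?case
    proof
      assume "u \<in> B" then show ?thesis using act BT by auto
    next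
      assume "u \<in> {w}" then show ?thesis using Y1 X2 H BT spanT by auto
    qed
  next
    case (act a u)
    obtain h k where a: "a = G h k" "h \<in> {Y2, Y3}" using act(1) by (auto simp: Y_ops_def)
    have "G g m * (G h k * u) \<in> ?T" if "g \<in> {Y1, X2, H1, H2}" for g m
      by (rule comm_in[OF T]) (use that a act TY in auto)
    then show ?case using a by simp
  qed (auto simp: distrib_left mult_cscale intro: op_closure.intros)
  then have "par_closure {w} \<subseteq> ?T"
    using TY BT by (intro op_closure_minimal T) (auto simp: par_ops_def)
  moreover have "U.rdim ?T B (base2 N \<mu>)" using YB d by (intro rdim_op_closure[OF sub])
  ultimately show ?thesis using U.rdim_mono by blast
qed

definition xmon :: "nat list \<Rightarrow> Uenv" where "xmon is = prod_list (map (G X1) is)"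
definition xmons :: "nat \<Rightarrow> Uenv \<Rightarrow> Uenv set" where "xmons e w = {xmon is * w |is. length is = e}"

lemma xmon_Nil: "xmon [] = 1" and xmon_Cons: "xmon (i # is) = G X1 i * xmon is"
  by (simp_all add: xmon_def)

text \<open>The module is filtered by the number of currents of \<open>x_1\<close>, which lie outside the parabolic part
together with those of \<open>x_3\<close>. The index of \<open>below\<close> is shifted so that step zero is \<open>J\<close> itself.\<close>

definition layer :: "Uenv set \<Rightarrow> nat \<Rightarrow> Uenv set" where
  "layer J d = par_closure (J \<union> {xmon is |is. length is \<le> d})"

fun below :: "Uenv set \<Rightarrow> nat \<Rightarrow> Uenv set" where
  "below J 0 = J" | "below J (Suc d) = layer J d"

lemma g1_par_closure:
  assumes T: "par_stable T" and S: "\<And>u m. u \<in> S \<Longrightarrow> u \<in> T \<and> G X1 m * u \<in> T \<and> G X3 m * u \<in> T"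
    and u: "u \<in> par_closure S"
  shows "u \<in> T \<and> (\<forall>m. G X1 m * u \<in> T \<and> G X3 m * u \<in> T)"
  using u
proof induction
  case (act a u)
  note sub = par_stableD(1)[OF T] and cl = par_stableD(2)[OF T]
  obtain h k where a: "a = G h k" "h \<in> {Y1, Y2, Y3, X2, H1, H2}" using act(1) by (auto simp: par_ops_def)
  have "G g m * (G h k * u) \<in> T" if "g \<in> {X1, X3}" for g m
    by (rule comm_in[OF sub]) (use that a act cl in auto)
  then show ?case using a act cl by auto
qed (use S par_stableD[OF T] U.subspace_0 U.subspace_add U.subspace_scale in \<open>auto simp: distrib_left mult_cscale\<close>)

lemma xmon_X3:
  assumes "\<And>d u m. u \<in> B d \<Longrightarrow> G X1 m * u \<in> B (Suc d)" "\<And>d. U.subspace (B d)"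
    and "\<And>m. G X3 m * u \<in> B d"
  shows "G X3 m * (xmon is * u) \<in> B (d + length is)"
proof (induction "is")
  case Nil then show ?case using assms by (simp add: xmon_Nil)
next
  case (Cons i "is")
  have "G X3 m * (G X1 i * (xmon is * u)) \<in> B (Suc (d + length is))"
    by (rule comm_in[OF assms(2)]) (use assms(1)[OF Cons] in auto)
  then show ?case by (simp add: xmon_Cons mult.assoc)
qed

lemma xmon_in:
  assumes "\<And>d u m. u \<in> B d \<Longrightarrow> G X1 m * u \<in> B (Suc d)" "u \<in> B d"
  shows "xmon is * u \<in> B (d + length is)"
  by (induction "is") (use assms in \<open>auto simp: xmon_Nil xmon_Cons mult.assoc\<close>)

lemma par_stable_layer: "par_stable (layer J d)" unfolding layer_def by (rule par_stable_par_closure)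

lemma xmon_in_layer:
  assumes X1: "\<And>d u m. u \<in> layer J d \<Longrightarrow> G X1 m * u \<in> layer J (Suc d)" and "w \<in> layer J c"
  shows "xmons e w \<subseteq> layer J (c + e)"
  using xmon_in[of "layer J" w c, OF X1 assms(2)] by (auto simp: xmons_def)

lemma layer_X:
  assumes J: "left_ideal J" and X3: "\<And>m. G X3 m \<in> J"
  shows "u \<in> layer J d \<Longrightarrow> G X1 m * u \<in> layer J (Suc d) \<and> G X3 m * u \<in> layer J (Suc d)"
proof -
  have JL: "J \<subseteq> layer J e" for e unfolding layer_def by (auto intro: op_closure.base)
  have mono: "u \<in> layer J (Suc d) \<and> G X1 m * u \<in> layer J (Suc d) \<and> G X3 m * u \<in> layer J (Suc d)"
    if "u \<in> J \<union> {xmon is |is. length is \<le> d}" for u m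
  proof -
    from that consider "u \<in> J" | "is" where "u = xmon is" "length is \<le> d" by blast
    then show ?thesis
    proof cases
      case 1 then show ?thesis using JL left_ideal_mult[OF J] by blast
    next
      case 2
      have "G X1 m * u = xmon (m # is)" using 2 by (simp add: xmon_Cons)
      then have "G X1 m * u \<in> layer J (Suc d)" using 2 unfolding layer_def
        by (intro op_closure.base UnI2 CollectI exI[of _ "m # is"]) auto
      moreover have "u \<in> layer J (Suc d)" using 2 unfolding layer_def
        by (intro op_closure.base UnI2 CollectI exI[of _ "is"]) auto
      moreover have "G X3 m * (xmon is * 1) \<in> (\<lambda>_. J) (0 + length is)"
        by (rule xmon_X3[of "\<lambda>_. J"]) (use X3 left_ideal_mult[OF J] left_ideal_subspace[OF J] in auto)
      ultimately show ?thesis using 2 JL by auto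
    qed
  qed
  assume "u \<in> layer J d"
  then have "u \<in> par_closure (J \<union> {xmon is |is. length is \<le> d})" by (simp add: layer_def)
  from g1_par_closure[OF par_stable_layer mono this] show ?thesis by blast
qed

text \<open>The same recursion as in \<open>inner_layer\<close>, for \<open>x_1\<close> in place of \<open>y_3\<close> and with the bracket with \<open>x_3(0)\<close> as
derivation. As \<open>x_1(i) w\<close> lies one step higher in the filtration, a single subspace \<open>B\<close> does not
suffice: the bound is relative to a family \<open>B d\<close> lying between two consecutive filtration steps.\<close>

lemma outer_layer:
  assumes J: "left_ideal J" and JX3: "\<And>m. G X3 m \<in> J"
    and "\<And>d. par_stable (B d)" "\<And>d. below J d \<subseteq> B d" "\<And>d. B d \<subseteq> layer J d"
    and "\<And>d u m. u \<in> B d \<Longrightarrow> G X1 m * u \<in> B (Suc d) \<and> G X3 m * u \<in> B (Suc d)"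
    and "w \<in> layer J c" "\<And>m. G X3 m * w \<in> B (Suc c)"
    and "\<And>m. G Y1 m * w \<in> B c" "\<And>m. G X2 m * w \<in> B c"
    and "\<And>m. G H1 m * w \<in> U.span (insert w (B c))" "\<And>m. G H2 m * w \<in> U.span (insert w (B c))"
    and "\<And>i. j \<le> i \<Longrightarrow> G X1 i * w \<in> B (Suc c)"
    and "cv_rels N \<mu> (\<lambda>r s. Rr r s * w \<in> B c)" "antitone_below N \<mu>" "j \<le> N"
  shows "U.rdim (par_closure (xmons e w)) (B (c + e)) (fermion_count_at N (base2 N) j e \<mu>)"
  using assms(3-)
proof (induction j arbitrary: w c \<mu> B e)
  case 0
  note B = 0(1) and BX = 0(4)
  show ?case
  proof (cases e)
    case 0
    have "xmons 0 w = {w}" by (simp add: xmons_def xmon_Nil)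
    then show ?thesis using \<open>e = 0\<close> 0 inner_layer_par_closure[OF B[of c] \<open>antitone_below N \<mu>\<close>, of w] \<open>\<And>m. G Y1 m * w \<in> B c\<close>
        \<open>\<And>m. G X2 m * w \<in> B c\<close> \<open>\<And>m. G H1 m * w \<in> U.span (insert w (B c))\<close>
        \<open>\<And>m. G H2 m * w \<in> U.span (insert w (B c))\<close> \<open>cv_rels N \<mu> (\<lambda>r s. Rr r s * w \<in> B c)\<close> by simp
  next
    case (Suc e')
    have "xmon is * w \<in> B (c + e)" if len: "length is = e" for "is"
    proof -
      obtain js i where js: "is = js @ [i]" using len Suc by (cases "is" rule: rev_cases) auto
      have "xmon js * (G X1 i * w) \<in> B (Suc c + length js)"
        by (rule xmon_in[of B]) (use BX \<open>\<And>i. 0 \<le> i \<Longrightarrow> G X1 i * w \<in> B (Suc c)\<close> in auto)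
      then show ?thesis using len js by (auto simp: xmon_def mult.assoc)
    qed
    then have "par_closure (xmons e w) \<subseteq> B (c + e)" by (intro par_closure_minimal B) (auto simp: xmons_def)
    then have "par_closure (xmons e w) \<subseteq> U.span (B (c + e))" using U.span_superset by blast
    then show ?thesis using Suc U.rdim_0 by simp
  qed
next
  case (Suc j)
  note B = Suc.prems(1) and BL = Suc.prems(2) and BU = Suc.prems(3) and BX = Suc.prems(4)
    and w = Suc.prems(5) and X3w = Suc.prems(6) and Y1w = Suc.prems(7) and X2w = Suc.prems(8)
    and H1w = Suc.prems(9) and H2w = Suc.prems(10) and X1w = Suc.prems(11) and rel = Suc.prems(12)
    and anti = Suc.prems(13)
  have jN: "j < N" using Suc.prems(14) by simp
  note sub = par_stableD(1)[OF B] and act = par_stableD(2)[OF B]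
  have up: "u \<in> B (Suc d)" if "u \<in> B d" for u d
    using BL[of "Suc d"] BU[of d] that by auto
  have c12: "G X1 m * G Y2 k = G Y2 k * G X1 m" for m k using G_comm[of X1 m Y2 k] by simp
  have ex: "\<mu> j \<noteq> 0 \<Longrightarrow> cv_rels N (dec N \<mu> j) (\<lambda>r s. Rr r s * (G X1 j * w) \<in> B (Suc c))"
    "\<mu> j = 0 \<Longrightarrow> G X1 j * w \<in> B (Suc c)"
  proof -
    have D: "G X3 0 * G Y2 i = G Y2 i * G X3 0 + G X1 i" for i using G_comm[of X3 0 Y2 i] by simp
    have cc: "G X1 i * (Rr r s * w) \<in> B (Suc c)" if "j < i" for i r s
    proof -
      have "G X1 i * (Rr r s * w) = Rr r s * (G X1 i * w)"
        using Rr_commute[of "G X1 i" r s, OF c12] by (simp add: mult.assoc[symmetric])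
      then show ?thesis using par_stable_Rr[OF B X1w[of i]] that by simp
    qed
    have aa: "G X3 0 * (Rr r s * w) \<in> B (Suc c)" "G X1 i * (Rr r s * w) \<in> B (Suc c)"
      if "1 \<le> r" "truncated_size N \<mu> r < s + r" for r s i
      using BX cv_relsD[OF rel that] by auto
    show "\<mu> j \<noteq> 0 \<Longrightarrow> cv_rels N (dec N \<mu> j) (\<lambda>r s. Rr r s * (G X1 j * w) \<in> B (Suc c))"
      by (rule extract_fermion(1)[OF sub anti jN D c12]) (use par_stable_Rr[OF B X3w] aa cc in auto)
    show "\<mu> j = 0 \<Longrightarrow> G X1 j * w \<in> B (Suc c)"
      by (rule extract_fermion(2)[OF sub anti jN D c12]) (use par_stable_Rr[OF B X3w] aa cc in auto)
  qed
  show ?case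
  proof (cases "\<mu> j = 0")
    case True
    then have "G X1 i * w \<in> B (Suc c)" if "j \<le> i" for i
      using ex(2) X1w[of i] that by (cases "i = j") auto
    then have "U.rdim (par_closure (xmons e w)) (B (c + e)) (fermion_count_at N (base2 N) j e \<mu>)"
      using Suc.prems by (intro Suc.IH) auto
    then show ?thesis using True by simp
  next
    case False
    let ?w = "G X1 j * w"
    have wL: "?w \<in> layer J (Suc c)" using layer_X[OF J JX3 w] by blast
    have LB: "layer J c \<subseteq> B (Suc c)" using BL[of "Suc c"] by simp
    have r1: "U.rdim (par_closure (xmons e' ?w)) (B (Suc c + e')) (fermion_count_at N (base2 N) j e' (dec N \<mu> j))" for e'
    proof (rule Suc.IH[OF B BL BU BX wL])
      show "G X3 m * ?w \<in> B (Suc (Suc c))" for m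
        by (rule comm_in[OF sub]) (use BX X3w in auto)
      show "G Y1 m * ?w \<in> B (Suc c)" for m
        by (rule comm_in[OF sub]) (use BX[OF Y1w] par_stableD(2)[OF par_stable_layer _ w] LB in auto)
      show "G X2 m * ?w \<in> B (Suc c)" for m
        by (rule comm_in[OF sub]) (use BX[OF X2w] X3w in auto)
      have spans: "U.subspace (U.span (insert ?w (B (Suc c))))" by (rule U.subspace_span)
      have X1span: "G X1 j * u \<in> U.span (insert ?w (B (Suc c)))" if "u \<in> U.span (insert w (B c))" for u
      proof -
        have "(\<lambda>u. G X1 j * u) ` U.span (insert w (B c)) = U.span ((\<lambda>u. G X1 j * u) ` insert w (B c))"
          using module_hom.span_image[of cscale cscale "\<lambda>u. G X1 j * u" "insert w (B c)"] linear_mult_left[of "G X1 j"]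
          by (simp add: module_hom_iff_linear)
        also have "\<dots> \<subseteq> U.span (insert ?w (B (Suc c)))" using BX by (intro U.span_mono) auto
        finally show ?thesis using that by blast
      qed
      have X1m: "G X1 (m + j) * w \<in> U.span (insert ?w (B (Suc c)))" for m
        using X1w[of "m + j"] by (cases "m = 0") (auto intro: U.span_base)
      show "G H1 m * ?w \<in> U.span (insert ?w (B (Suc c)))" for m
        by (rule comm_in[OF spans]) (use X1span[OF H1w] in auto)
      show "G H2 m * ?w \<in> U.span (insert ?w (B (Suc c)))" for m
        by (rule comm_in[OF spans]) (use X1span[OF H2w] X1m in auto)
      show "G X1 i * ?w \<in> B (Suc (Suc c))" if "j \<le> i" for i
      proof (cases "i = j")
        case True then show ?thesis using odd_square_in[OF sub, of X1 j w] by simp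
      next
        case False
        show ?thesis by (rule comm_in[OF sub]) (use BX[OF X1w[of i]] False that in auto)
      qed
    qed (use ex(1)[OF False] antitone_dec[OF anti jN] jN in auto)
    \<comment> \<open>the family \<open>B\<close> enlarged by the submodule that \<open>?w\<close> generates, sorted by the number of currents of \<open>x_1\<close>\<close>

    define S where "S d = (if Suc c \<le> d then xmons (d - Suc c) ?w else {})" for d
    define B' where "B' d = par_closure (B d \<union> S d)" for d
    have BB: "B d \<subseteq> B' d" for d unfolding B'_def by (auto intro: op_closure.base)
    have SL: "S d \<subseteq> layer J d" for d
      using xmon_in_layer[of J ?w "Suc c" "d - Suc c"] layer_X[OF J JX3] wL by (auto simp: S_def)
    have r2: "U.rdim (par_closure (xmons e w)) (B' (c + e)) (fermion_count_at N (base2 N) j e \<mu>)"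
    proof (rule Suc.IH)
      show "par_stable (B' d)" for d unfolding B'_def by (rule par_stable_par_closure)
      show "below J d \<subseteq> B' d" for d using BL BB by blast
      show "B' d \<subseteq> layer J d" for d unfolding B'_def using BU SL by (intro par_closure_minimal par_stable_layer) auto
      show "G X1 m * u \<in> B' (Suc d) \<and> G X3 m * u \<in> B' (Suc d)" if "u \<in> B' d" for d u m
      proof -
        have step: "v \<in> B' (Suc d) \<and> G X1 m * v \<in> B' (Suc d) \<and> G X3 m * v \<in> B' (Suc d)" if "v \<in> B d \<union> S d" for v m
          using that
        proof
          assume "v \<in> B d" then show ?thesis using BX BB up by blast
        next
          assume v: "v \<in> S d"
          then obtain "is" where "is": "Suc c \<le> d" "v = xmon is * ?w" "length is = d - Suc c"
            by (auto simp: S_def xmons_def split: if_splits)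
          have "v \<in> B' (Suc d)" using SL[of d] v BL[of "Suc d"] BB[of "Suc d"] by auto
          moreover have "G X1 m * v \<in> S (Suc d)"
            unfolding S_def xmons_def using "is"
            by (auto simp: xmon_Cons mult.assoc intro!: exI[of _ "m # is"])
          then have "G X1 m * v \<in> B' (Suc d)" unfolding B'_def by (auto intro: op_closure.base)
          moreover have "G X3 m * ?w \<in> B (Suc (Suc c))" for m
            by (rule comm_in[OF sub]) (use BX X3w in auto)
          then have "G X3 m * (xmon is * ?w) \<in> B (Suc (Suc c) + length is)"
            using BX sub by (intro xmon_X3[of B]) auto
          then have "G X3 m * v \<in> B' (Suc d)" using "is" BB[of "Suc d"] by auto
          ultimately show ?thesis by blast
        qed
        have "par_stable (B' (Suc d))" unfolding B'_def by (rule par_stable_par_closure)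
        moreover have "u \<in> par_closure (B d \<union> S d)" using \<open>u \<in> B' d\<close> by (simp add: B'_def)
        ultimately show ?thesis using g1_par_closure step by blast
      qed
      show "G H1 m * w \<in> U.span (insert w (B' c))" for m
        using H1w U.span_mono[of "insert w (B c)" "insert w (B' c)"] BB by blast
      show "G H2 m * w \<in> U.span (insert w (B' c))" for m
        using H2w U.span_mono[of "insert w (B c)" "insert w (B' c)"] BB by blast
      show "cv_rels N \<mu> (\<lambda>r s. Rr r s * w \<in> B' c)" using rel BB by (auto simp: cv_rels_def)
      show "G X1 i * w \<in> B' (Suc c)" if "j \<le> i" for i
      proof (cases "i = j")
        case True
        have "?w \<in> S (Suc c)" by (simp add: S_def xmons_def xmon_Nil)
        then show ?thesis using True unfolding B'_def by (auto intro: op_closure.base)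
      next
        case False then show ?thesis using X1w[of i] that BB by auto
      qed
    qed (use w X3w Y1w X2w subsetD[OF BB] anti jN in auto)
    show ?thesis
    proof (cases e)
      case 0
      have "B' c \<subseteq> B c" unfolding B'_def S_def by (intro par_closure_minimal B) auto
      then show ?thesis using U.rdim_mono[OF r2 order_refl] 0 by simp
    next
      case (Suc e')
      have "S (c + e) = xmons e' ?w" by (simp add: S_def Suc)
      then have "U.rdim (B' (c + e)) (B (c + e)) (fermion_count_at N (base2 N) j e' (dec N \<mu> j))"
        unfolding B'_def using r1[of e'] Suc B[of "c + e"] by (intro rdim_op_closure) (auto simp: par_stable_def)
      from U.rdim_trans[OF r2 this] show ?thesis using False Suc by simp
    qed
  qed
qed

text \<open>The graded pieces of the filtration are bounded by \<open>outer_layer\<close> with \<open>w = 1\<close>. Pieces of degree above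
\<open>N\<close> are zero, so the filtration is exhausted at step \<open>N\<close>.\<close>

theorem upper_bound:
  assumes J: "left_ideal J" and X3: "\<And>m. G X3 m \<in> J" and X2: "\<And>m. G X2 m \<in> J" and Y1: "\<And>m. G Y1 m \<in> J"
    and H: "\<And>m. G H1 m \<in> U.span (insert 1 J)" "\<And>m. G H2 m \<in> U.span (insert 1 J)"
    and X1: "\<And>i. N \<le> i \<Longrightarrow> G X1 i \<in> J"
    and rel: "cv_rels N \<mu> (\<lambda>r s. Rr r s \<in> J)" and anti: "antitone_below N \<mu>"
  shows "U.rdim UNIV J (\<Prod>i<N. if \<mu> i = 0 then 1 else 4 * \<mu> i)"
proof -
  have JL: "J \<subseteq> layer J e" for e unfolding layer_def by (auto intro: op_closure.base)
  have pJ: "par_stable J" using left_ideal_subspace[OF J] left_ideal_mult[OF J] by (simp add: par_stable_def)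
  have par_stable_below: "par_stable (below J d)" for d by (cases d) (use pJ par_stable_layer in auto)
  have mono: "layer J d \<subseteq> layer J (Suc d)" for d unfolding layer_def by (rule op_closure_mono) auto
  have below_X: "G X1 m * u \<in> below J (Suc d) \<and> G X3 m * u \<in> below J (Suc d)" if "u \<in> below J d" for d u m
  proof (cases d)
    case 0 then show ?thesis using that left_ideal_mult[OF J] JL[of 0] by auto
  next
    case (Suc d') then show ?thesis using that layer_X[OF J X3] by auto
  qed
  have one: "1 \<in> layer J 0" unfolding layer_def
    by (intro op_closure.base UnI2 CollectI exI[of _ "[]"]) (simp add: xmon_Nil)
  have layer: "U.rdim (par_closure (xmons e 1)) (below J (0 + e)) (fermion_count_at N (base2 N) N e \<mu>)" for e
  proof (rule outer_layer[OF J X3])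
    show "below J d \<subseteq> layer J d" for d by (cases d) (use JL mono in auto)
    show "G H1 m * 1 \<in> U.span (insert 1 (below J 0))" "G H2 m * 1 \<in> U.span (insert 1 (below J 0))" for m using H by auto
  qed (use par_stable_below below_X one X3 subsetD[OF JL[of 0]] Y1 X2 X1 rel anti in auto)
  have split: "layer J e \<subseteq> par_closure (below J e \<union> xmons e 1)" for e
  proof -
    have "xmon is \<in> par_closure (below J e \<union> xmons e 1)" if len: "length is \<le> e" for "is"
    proof (cases "length is = e")
      case True then show ?thesis by (intro op_closure.base) (auto simp: xmons_def)
    next
      case False
      then obtain e' where "e = Suc e'" "length is \<le> e'" using len by (cases e) auto
      then have "xmon is \<in> below J e" by (auto simp: layer_def intro!: op_closure.base)
      then show ?thesis by (intro op_closure.base) auto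
    qed
    moreover have "J \<subseteq> below J e" by (cases e) (use JL in auto)
    then have "J \<subseteq> par_closure (below J e \<union> xmons e 1)" by (auto intro: op_closure.base)
    ultimately show ?thesis unfolding layer_def by (intro par_closure_minimal par_stable_par_closure) auto
  qed
  have step: "U.rdim (layer J e) (below J e) (fermion_count_at N (base2 N) N e \<mu>)" for e
  proof -
    have "U.rdim (par_closure (below J e \<union> xmons e 1)) (below J e) (fermion_count_at N (base2 N) N e \<mu>)"
      using layer[of e] par_stable_below[of e] by (intro rdim_op_closure) (auto simp: par_stable_def)
    then show ?thesis using split by (rule U.rdim_mono) auto
  qed
  have total: "U.rdim (layer J M) J (\<Sum>e\<le>M. fermion_count_at N (base2 N) N e \<mu>)" for M
  proof (induction M)
    case 0 then show ?case using step[of 0] by simp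
  next
    case (Suc M)
    have "U.rdim (layer J (Suc M)) (layer J M) (fermion_count_at N (base2 N) N (Suc M) \<mu>)" using step[of "Suc M"] by simp
    from U.rdim_trans[OF this Suc] show ?case by (simp add: add.commute)
  qed
  have stable: "layer J (N + k) \<subseteq> layer J N" for k
  proof (induction k)
    case (Suc k)
    have "U.rdim (layer J (N + Suc k)) (layer J (N + k)) 0" using step[of "N + Suc k"] fermion_count_at_0[of N "N + Suc k"] by simp
    then have "layer J (N + Suc k) \<subseteq> U.span (layer J (N + k))" by (auto simp: U.rdim_def)
    also have "\<dots> = layer J (N + k)" using par_stableD(1)[OF par_stable_layer] by (simp add: U.span_eq_iff)
    finally show ?case using Suc by simp
  qed simp
  have "u \<in> layer J N" for u
  proof (rule Uenv_induct)
    show "U.subspace (layer J N)" by (rule par_stableD(1)[OF par_stable_layer])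
    have up: "layer J d \<subseteq> layer J (d + k)" for d k
      by (induction k) (use mono in auto)
    show "1 \<in> layer J N" using one up[of 0 N] by auto
    fix g m u assume u: "u \<in> layer J N"
    have "G g m * u \<in> layer J (N + 1)"
    proof (cases "g \<in> {X1, X3}")
      case True then show ?thesis using layer_X[OF J X3 u] by auto
    next
      case False
      then have "g \<in> {Y1, Y2, Y3, X2, H1, H2}" by (cases g) auto
      then show ?thesis using par_stableD(2)[OF par_stable_layer _ u] up[of N 1] by blast
    qed
    then show "G g m * u \<in> layer J N" using stable by blast
  qed
  then have "U.rdim UNIV J (\<Sum>e\<le>N. fermion_count_at N (base2 N) N e \<mu>)" using total[of N] by (intro U.rdim_mono[OF total[of N]]) auto
  moreover have base2: "base2 N \<mu> = (\<Prod>i<N. 2 * \<mu> i + 1)" if "antitone_below N \<mu>" for \<mu>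
    unfolding base2_def base1_def
    by (subst fermion_count_closed_form[where f = "\<lambda>c. c + 1" and h = "\<lambda>c. 2 * c + 1"]) (use that in auto)
  have fermion_count_base: "fermion_count N f j \<mu> = fermion_count N g j \<mu>"
    if "\<And>\<mu>. antitone_below N \<mu> \<Longrightarrow> f \<mu> = g \<mu>" "antitone_below N \<mu>" "j \<le> N" for f g j \<mu>
    using that(2,3)
  proof (induction j arbitrary: \<mu>)
    case 0 then show ?case using that(1) by simp
  next
    case (Suc j) then show ?case using antitone_dec[of N \<mu> j] by auto
  qed
  have "(\<Sum>e\<le>N. fermion_count_at N (base2 N) N e \<mu>) = fermion_count N (base2 N) N \<mu>" by (rule sum_fermion_count_at) simp
  also have "\<dots> = fermion_count N (\<lambda>\<mu>. \<Prod>i<N. 2 * \<mu> i + 1) N \<mu>" by (rule fermion_count_base[OF base2 anti order_refl])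
  also have "\<dots> = (\<Prod>i<N. if \<mu> i = 0 then 1 else 4 * \<mu> i)"
    by (subst fermion_count_closed_form[where f = "\<lambda>c. 2 * c + 1" and h = "\<lambda>c. if c = 0 then 1 else 4 * c"]) (use anti in auto)
  ultimately show ?thesis by simp
qed

section \<open>Modules given by operators\<close>

text \<open>A representation of the current superalgebra by linear operators extends to the free algebra, and the defining
relations of the enveloping algebra act by zero.\<close>

lemma Uenv_abs_ex: "\<exists>p. u = abs_Uenv p"
  by (rule exI[of _ "rep_Uenv u"]) (simp add: Quotient3_abs_rep[OF Quotient3_Uenv])

locale uenv_module = complex_space sc
  for sc :: "complex \<Rightarrow> 'v::ab_group_add \<Rightarrow> 'v" +
  fixes op :: "complex poly sl12 \<Rightarrow> 'v \<Rightarrow> 'v"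
  assumes op_lin: "op x (v + w) = op x v + op x w" "op x (sc c v) = sc c (op x v)"
    and op_add: "op (x + y) v = op x v + op y v"
    and op_scale: "op (sl_scale [:c:] x) v = sc c (op x v)"
    and op_bracket: "homogeneous p x \<Longrightarrow> homogeneous q y \<Longrightarrow> p \<in> {0,1} \<Longrightarrow> q \<in> {0,1} \<Longrightarrow>
      op x (op y v) = sc ((-1) ^ (p * q)) (op y (op x v)) + op (sbracket x y) v"
begin

fun word_act :: "complex poly sl12 fword \<Rightarrow> 'v \<Rightarrow> 'v" where
  "word_act (FWord xs) v = foldr op xs v"

definition free_act :: "free_alg \<Rightarrow> 'v \<Rightarrow> 'v" where
  "free_act p v = lin_ext sc (\<lambda>w. word_act w v) p"

lemma word_act_plus: "word_act (a + b) v = word_act a (word_act b v)"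
  by (cases a; cases b) simp

lemma word_act_0: "word_act 0 v = v" by (simp add: zero_fword_def)

lemma word_act_lin: "word_act a (v + w) = word_act a v + word_act a w" "word_act a (sc c v) = sc c (word_act a v)"
proof -
  have "foldr op xs (v + w) = foldr op xs v + foldr op xs w" "foldr op xs (sc c v) = sc c (foldr op xs v)" for xs
    by (induction xs) (simp_all add: op_lin)
  then show "word_act a (v + w) = word_act a v + word_act a w" "word_act a (sc c v) = sc c (word_act a v)" by (cases a; simp)+
qed

lemma free_act_add: "free_act (p + q) v = free_act p v + free_act q v" by (simp add: free_act_def lin_ext_add)
lemma free_act_0: "free_act 0 v = 0" by (simp add: free_act_def lin_ext_0)
lemma free_act_diff: "free_act (p - q) v = free_act p v - free_act q v" by (simp add: free_act_def lin_ext_diff)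
lemma free_act_single: "free_act (Poly_Mapping.single w c) v = sc c (word_act w v)" by (simp add: free_act_def lin_ext_single)

lemma free_act_lin: "free_act p (v + w) = free_act p v + free_act p w" "free_act p (sc c v) = sc c (free_act p v)"
  by (induction p rule: poly_mapping_induct_single)
     (simp_all add: free_act_0 free_act_add free_act_single word_act_lin scale_right_distrib scale_left_commute add_ac)

lemma free_act_v0: "free_act p 0 = 0"
  using free_act_lin(2)[of p 0 0] by simp

lemma free_act_mult: "free_act (p * q) v = free_act p (free_act q v)"
proof (induction p rule: poly_mapping_induct_single)
  case (2 a c)
  show ?case
    by (induction q rule: poly_mapping_induct_single)
       (simp_all add: free_act_0 free_act_v0 free_act_add free_act_lin mult_single free_act_single word_act_plus word_act_lin distrib_left)
qed (simp_all add: free_act_0 free_act_add distrib_right)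

lemma free_act_gen: "free_act (free_gen x) v = op x v" by (simp add: free_gen_def free_act_single)
lemma free_act_const: "free_act (free_const c) v = sc c v" by (simp add: free_const_def free_act_single word_act_0)

lemma free_act_U_ideal: "p \<in> U_ideal \<Longrightarrow> free_act p v = 0"
proof -
  let ?K = "{p. \<forall>v. free_act p v = 0}"
  have "two_sided_ideal ?K"
    by (auto simp: two_sided_ideal_def left_ideal_def free_act_0 free_act_add free_act_mult free_act_v0)
  moreover have "U_rels \<subseteq> ?K"
  proof
    fix r assume "r \<in> U_rels"
    then consider x y where "r = free_gen (x + y) - (free_gen x + free_gen y)"
      | c x where "r = free_gen (sl_scale [:c:] x) - free_const c * free_gen x"
      | x y p q where "r = free_gen x * free_gen y - free_const ((-1) ^ (p * q)) * free_gen y * free_gen x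
          - free_gen (sbracket x y)" "p \<in> {0,1}" "q \<in> {0,1}" "homogeneous p x" "homogeneous q y"
      unfolding U_rels_def by blast
    then show "r \<in> ?K"
    proof cases
      case 1 then show ?thesis by (simp only: mem_Collect_eq free_act_diff free_act_add free_act_gen op_add) simp
    next
      case 2 then show ?thesis by (simp only: mem_Collect_eq free_act_diff free_act_mult free_act_gen free_act_const op_scale) simp
    next
      case 3
      have "free_act r v = op x (op y v) - sc ((-1) ^ (p * q)) (op y (op x v)) - op (sbracket x y) v" for v
        by (simp only: 3(1) free_act_diff free_act_mult free_act_gen free_act_const)
      then show ?thesis using op_bracket[OF 3(4,5,2,3)] by simp
    qed
  qed
  ultimately have "U_ideal \<subseteq> ?K"
    unfolding U_ideal_def by (rule hull_minimal[rotated])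
  then show "p \<in> U_ideal \<Longrightarrow> free_act p v = 0" by auto
qed

definition uact :: "Uenv \<Rightarrow> 'v \<Rightarrow> 'v" where
  "uact u = free_act (rep_Uenv u)"

lemma uact_abs: "uact (abs_Uenv p) v = free_act p v"
proof -
  have "abs_Uenv (rep_Uenv (abs_Uenv p)) = abs_Uenv p"
    by (simp add: Quotient3_abs_rep[OF Quotient3_Uenv])
  then have "rep_Uenv (abs_Uenv p) - p \<in> U_ideal" by (simp add: Uenv.abs_eq_iff)
  then show ?thesis using free_act_U_ideal[of "rep_Uenv (abs_Uenv p) - p" v] by (simp add: uact_def free_act_diff)
qed

lemma uact_add: "uact (u + w) v = uact u v + uact w v"
  using Uenv_abs_ex[of u] Uenv_abs_ex[of w] by (auto simp: plus_Uenv.abs_eq uact_abs free_act_add)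
lemma uact_diff: "uact (u - w) v = uact u v - uact w v"
  using Uenv_abs_ex[of u] Uenv_abs_ex[of w] by (auto simp: minus_Uenv.abs_eq uact_abs free_act_diff)
lemma uact_mult: "uact (u * w) v = uact u (uact w v)"
  using Uenv_abs_ex[of u] Uenv_abs_ex[of w] by (auto simp: times_Uenv.abs_eq uact_abs free_act_mult)
lemma uact_gen: "uact (U_gen x) v = op x v" by (simp add: U_gen.abs_eq uact_abs free_act_gen)
lemma uact_const: "uact (U_const c) v = sc c v" by (simp add: U_const.abs_eq uact_abs free_act_const)
lemma uact_1: "uact 1 v = v" using uact_const[of 1 v] by (simp add: U_const_1)
lemma uact_0: "uact 0 v = 0" using uact_const[of 0 v] by (simp add: U_const_0)
lemma uact_cscale: "uact (cscale c u) v = sc c (uact u v)" by (simp add: cscale_def uact_mult uact_const)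
lemma uact_lin: "uact u (v + w) = uact u v + uact u w" "uact u (sc c v) = sc c (uact u v)"
  by (simp_all add: uact_def free_act_lin)

end

section \<open>Kac modules\<close>

text \<open>The state \<open>(a, b, k)\<close> stands for the basis vector \<open>y_1^a y_3^b y_2^k u\<close> of the Kac module, where \<open>u\<close>
is a highest weight vector of the \<open>n\<close>-dimensional module of the even part on which \<open>h_1\<close> acts by \<open>l\<close>
and \<open>h_2\<close> by \<open>n - 1\<close>. The highest weight vector for the positive part is \<open>y_1 u\<close>, the state
\<open>(True, False, 0)\<close>.\<close>

type_synonym state = "bool \<times> bool \<times> nat"

text \<open>Vectors are coefficient functions on states, so the matrices of the generators are given by rows: the
coefficient of \<open>g f\<close> at \<open>t\<close> is the sum of \<open>c * f t'\<close> over the entries \<open>(c, t')\<close> of row \<open>t\<close>. Rows with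
\<open>k \<ge> n\<close> are empty; the values there belong to no basis vector.\<close>

fun kac :: "'a::comm_ring_1 \<Rightarrow> nat \<Rightarrow> gen \<Rightarrow> state \<Rightarrow> ('a \<times> state) list" where
  "kac l n Y1 (a, b, k) = (if a \<and> k < n then [(1, (False, b, k))] else [])"
| "kac l n Y3 (a, b, k) = (if b \<and> k < n then [(if a then -1 else 1, (a, False, k))] else [])"
| "kac l n X2 (a, b, k) = (if k < n then
      (if a \<and> \<not> b then [(1, (False, True, k))] else []) @
      [(of_nat (Suc k) * (of_nat n - 1 - of_nat k), (a, b, Suc k))] else [])"
| "kac l n Y2 (a, b, k) = (if k < n then
      (if \<not> a \<and> b then [(1, (True, False, k))] else []) @
      (if 0 < k then [(1, (a, b, k - 1))] else []) else [])"
| "kac l n H1 (a, b, k) = (if k < n then [(l - of_nat k - (if b then 1 else 0), (a, b, k))] else [])"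
| "kac l n H2 (a, b, k) = (if k < n then
      [((if a then 1 else 0) - (if b then 1 else 0) + of_nat n - 1 - 2 * of_nat k, (a, b, k))] else [])"
| "kac l n X1 (a, b, k) = (if k < n then
      (if a then [] else [(l - of_nat k - (if b then 1 else 0), (True, b, k))]) @
      (if \<not> b \<and> 0 < k then [(if a then -1 else 1, (a, True, k - 1))] else []) else [])"
| "kac l n X3 (a, b, k) = (if k < n then
      (if b then [] else if a then [(- (l - of_nat n + of_nat k), (True, True, k))]
        else [(l - of_nat n + 1 + of_nat k, (False, True, k))]) @
      (if a then [] else [(of_nat (Suc k) * (of_nat n - 1 - of_nat k), (True, b, Suc k))]) else [])"

definition krow :: "'a::comm_ring_1 \<Rightarrow> nat \<Rightarrow> gen \<Rightarrow> (state \<Rightarrow> 'a) \<Rightarrow> state \<Rightarrow> 'a" where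
  "krow l n g f t = (\<Sum>(c, t')\<leftarrow>kac l n g t. c * f t')"

lemma krow_bracket:
  "krow l n g (krow l n h f) t = (if odd_gen g \<and> odd_gen h then -1 else 1) * krow l n h (krow l n g f) t
     + (\<Sum>(c, x)\<leftarrow>brk g h. of_int c * krow l n x f t)"
proof -
  obtain a b k where t: "t = (a, b, k)" by (cases t)
  consider "n \<le> k" | "k < n" "n = Suc k" | "Suc k < n" by linarith
  then show ?thesis
  proof cases
    case 1 then show ?thesis unfolding t by (cases g; cases h; simp add: krow_def)
  next
    case 2
    show ?thesis unfolding t using 2
      by (cases a; cases b; cases k; cases g; cases h; simp add: krow_def; simp add: algebra_simps)
  next
    case 3
    then show ?thesis unfolding t
      by (cases a; cases b; cases k; cases g; cases h; simp add: krow_def; simp add: algebra_simps)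
  qed
qed

lemma krow_add: "krow l n g (\<lambda>t. f t + f' t) t = krow l n g f t + krow l n g f' t"
  by (simp add: krow_def case_prod_unfold distrib_left sum_list_addf)

lemma krow_scale: "krow l n g (\<lambda>t. c * f t) t = c * krow l n g f t"
  by (simp add: krow_def case_prod_unfold sum_list_const_mult[symmetric] mult.left_commute)

lemma sum_list_swap:
  "(\<Sum>x\<leftarrow>xs. \<Sum>y\<leftarrow>ys. f x y) = (\<Sum>y\<leftarrow>ys. \<Sum>x\<leftarrow>xs. f x y)" for f :: "_ \<Rightarrow> _ \<Rightarrow> 'a::comm_monoid_add"
  by (induction xs) (simp_all add: sum_list_addf)

lemma krow_commute:
  "krow l n g (\<lambda>t. krow l' n' h (\<lambda>t'. F t t') s') s = krow l' n' h (\<lambda>t'. krow l n g (\<lambda>t. F t t') s) s'"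
  unfolding krow_def case_prod_unfold sum_list_const_mult[symmetric]
  by (subst sum_list_swap) (simp add: mult.left_commute)

definition sgp :: "state \<Rightarrow> 'a::comm_ring_1" where
  "sgp t = (if fst t \<noteq> fst (snd t) then -1 else 1)"

lemma sgp_sq: "sgp t * sgp t = 1" by (simp add: sgp_def)

lemma kac_parity: "(c, t') \<in> set (kac l n g t) \<Longrightarrow> sgp t' = (if odd_gen g then - sgp t else sgp t)"
  by (cases t; cases g) (auto simp: sgp_def split: if_splits)

lemma krow_parity: "krow l n g (\<lambda>t. sgp t * f t) t = (if odd_gen g then -1 else 1) * sgp t * krow l n g f t"
proof -
  have "(\<Sum>(c, t')\<leftarrow>xs. c * (sgp t' * f t')) = (if odd_gen g then -1 else 1) * sgp t * (\<Sum>(c, t')\<leftarrow>xs. c * f t')"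
    if "set xs \<subseteq> set (kac l n g t)" for xs
    using that
  proof (induction xs)
    case (Cons x xs)
    obtain c t' where x: "x = (c, t')" by (cases x)
    have "(c, t') \<in> set (kac l n g t)" using Cons.prems x by auto
    then have "sgp t' = (if odd_gen g then - sgp t else sgp t :: 'a)" by (rule kac_parity)
    then show ?case using Cons x by (auto simp: algebra_simps)
  qed simp
  then show ?thesis by (simp add: krow_def)
qed

section \<open>Tensor products of evaluation modules over a polynomial ring\<close>

text \<open>A configuration assigns a state to each tensor factor. Coefficients are polynomials in the deformation
parameter.\<close>

type_synonym conf = "nat \<Rightarrow> state"
type_synonym vec = "conf \<Rightarrow> complex poly"

definition psc :: "complex poly \<Rightarrow> vec \<Rightarrow> vec" where "psc p f = (\<lambda>\<sigma>. p * f \<sigma>)"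
definition fsc :: "complex \<Rightarrow> vec \<Rightarrow> vec" where "fsc c = psc [:c:]"

interpretation P: Modules.module psc
  by unfold_locales (auto simp: psc_def fun_eq_iff algebra_simps)

interpretation F: complex_space fsc
  by unfold_locales (auto simp: fsc_def psc_def fun_eq_iff smult_add_right smult_add_left mult.commute)

lemma brk_parity: "(c, x) \<in> set (brk g h) \<Longrightarrow> odd_gen x \<longleftrightarrow> odd_gen g \<noteq> odd_gen h"
  by (cases g; cases h; auto)

lemma homogeneous_coef:
  assumes "homogeneous p A" "p \<in> {0,1}" "odd_gen g \<noteq> (p = 1)"
  shows "coef g A = 0"
proof -
  have e: "entry A i j = 0" if "odd (block i + block j + p)" for i j
  proof -
    have "hpart p (Rep_sl12 A) $ i $ j = 0" using that by (simp add: hpart_def)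
    then show ?thesis using assms(1) by (simp add: homogeneous.rep_eq entry.rep_eq)
  qed
  have blk: "block 1 = 0" "block 2 = 1" "block 3 = 1" by (simp_all add: block_def)
  show ?thesis
    using assms(2,3) e[of 1 2] e[of 2 3] e[of 1 3] e[of 2 1] e[of 3 2] e[of 3 1] e[of 1 1] e[of 3 3]
    by (cases g) (auto simp: blk)
qed

text \<open>The current parameter \<open>t\<close> is evaluated in the factor \<open>i\<close> at the point \<open>c i\<close>, where \<open>c\<close> is the
polynomial variable; so the points are distinct for \<open>c \<noteq> 0\<close> and all collapse to zero for \<open>c = 0\<close>.\<close>

definition epol :: "nat \<Rightarrow> complex poly \<Rightarrow> complex poly" where
  "epol i p = pcompose p [:0, of_nat i:]"

lemma epol_simps: "epol i (p + q) = epol i p + epol i q" "epol i (p * q) = epol i p * epol i q"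
  "epol i 0 = 0" "epol i [:c:] = [:c:]"
  by (simp_all add: epol_def pcompose_add pcompose_mult pcompose_const)

lemma epol_of_int: "epol i (of_int c) = of_int c"
  using epol_simps(4)[of i "of_int c"] by (simp add: of_int_poly)

lemma epol_sum: "epol i (sum f I) = (\<Sum>k\<in>I. epol i (f k))"
  by (induction I rule: infinite_finite_induct) (auto simp: epol_simps)

locale tensor_module =
  fixes N :: nat and \<nu> :: "nat \<Rightarrow> nat" and l :: "nat \<Rightarrow> complex poly"
begin

text \<open>The sign that an odd operator picks up when it passes the factors before position \<open>i\<close>.\<close>

definition sgb :: "nat \<Rightarrow> conf \<Rightarrow> complex poly" where "sgb i \<sigma> = (\<Prod>j<i. sgp (\<sigma> j))"

definition site :: "nat \<Rightarrow> gen \<Rightarrow> vec \<Rightarrow> vec" where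
  "site i g f = (\<lambda>\<sigma>. (if odd_gen g then sgb i \<sigma> else 1) * krow (l i) (\<nu> i) g (\<lambda>t. f (\<sigma>(i := t))) (\<sigma> i))"

lemma sgb_sq: "sgb i \<sigma> * sgb i \<sigma> = 1"
  by (simp add: sgb_def prod.distrib[symmetric] sgp_sq)

lemma sgb_upd_ge: "i \<le> j \<Longrightarrow> sgb i (\<sigma>(j := t)) = sgb i \<sigma>"
  unfolding sgb_def by (rule prod.cong) auto

lemma sgb_upd_less:
  assumes "i < j" shows "sgb j (\<sigma>(i := t)) = sgb j \<sigma> * sgp (\<sigma> i) * sgp t"
proof -
  have "(\<Prod>k\<in>{..<j} - {i}. sgp ((\<sigma>(i := t)) k)) = (\<Prod>k\<in>{..<j} - {i}. sgp (\<sigma> k) :: complex poly)"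
    by (rule prod.cong) auto
  then have e: "sgb j (\<sigma>(i := t)) = sgp t * (\<Prod>k\<in>{..<j} - {i}. sgp (\<sigma> k))"
    "sgb j \<sigma> = sgp (\<sigma> i) * (\<Prod>k\<in>{..<j} - {i}. sgp (\<sigma> k))"
    using assms prod.remove[of "{..<j}" i "\<lambda>k. sgp ((\<sigma>(i := t)) k) :: complex poly"]
      prod.remove[of "{..<j}" i "\<lambda>k. sgp (\<sigma> k) :: complex poly"]
    by (simp_all add: sgb_def)
  have "sgp (\<sigma> i) * p * sgp (\<sigma> i) * sgp t = (sgp (\<sigma> i) * sgp (\<sigma> i)) * (sgp t * p)" for p :: "complex poly"
    by (simp only: ac_simps)
  then show ?thesis unfolding e by (simp only: sgp_sq mult_1_left)
qed

lemma site_add: "site i g (f + f') = site i g f + site i g f'"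
  by (rule ext) (simp add: site_def krow_add distrib_left)
lemma site_psc: "site i g (psc c f) = psc c (site i g f)"
  by (rule ext) (simp add: site_def psc_def krow_scale)
lemma site_0: "site i g 0 = 0"
  using site_psc[of i g 0 0] by simp
lemma site_sum: "site i g (sum F I) = (\<Sum>k\<in>I. site i g (F k))"
  by (induction I rule: infinite_finite_induct)
     (simp_all only: site_0 site_add sum.infinite sum.empty sum.insert not_False_eq_True)

lemma site_bracket_same:
  "site i g (site i h f) = psc (if odd_gen g \<and> odd_gen h then -1 else 1) (site i h (site i g f))
     + (\<Sum>(c, x)\<leftarrow>brk g h. psc (of_int c) (site i x f))"
proof (rule ext)
  fix \<sigma>
  let ?k = "\<lambda>g f. krow (l i) (\<nu> i) g f" and ?\<phi> = "\<lambda>t. f (\<sigma>(i := t))"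
  let ?s = "\<lambda>g. if odd_gen g then sgb i \<sigma> else 1"
  have ss: "site i g (site i h f) \<sigma> = ?s g * ?s h * ?k g (?k h ?\<phi>) (\<sigma> i)" for g h
    by (simp add: site_def sgb_upd_ge krow_scale mult.assoc)
  have "(\<Sum>(c, x)\<leftarrow>xs. psc (of_int c) (site i x f)) \<sigma> = ?s g * ?s h * (\<Sum>(c, x)\<leftarrow>xs. of_int c * ?k x ?\<phi> (\<sigma> i))"
    if "set xs \<subseteq> set (brk g h)" for xs
    using that
  proof (induction xs)
    case (Cons y xs)
    obtain c x where y: "y = (c, x)" by (cases y)
    have "?s x = ?s g * ?s h" using brk_parity[of c x g h] Cons.prems y sgb_sq by auto
    then have "psc (of_int c) (site i x f) \<sigma> = ?s g * ?s h * (of_int c * ?k x ?\<phi> (\<sigma> i))"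
      unfolding psc_def site_def by (simp only: mult_ac)
    moreover have "(\<Sum>(c, x)\<leftarrow>xs. psc (of_int c) (site i x f)) \<sigma> = ?s g * ?s h * (\<Sum>(c, x)\<leftarrow>xs. of_int c * ?k x ?\<phi> (\<sigma> i))"
      by (rule Cons.IH) (use Cons.prems in simp)
    ultimately show ?case unfolding y
      by (simp only: list.map sum_list.Cons plus_fun_apply prod.case distrib_left)
  qed simp
  then show "site i g (site i h f) \<sigma> = (psc (if odd_gen g \<and> odd_gen h then -1 else 1) (site i h (site i g f))
     + (\<Sum>(c, x)\<leftarrow>brk g h. psc (of_int c) (site i x f))) \<sigma>"
    unfolding plus_fun_apply psc_def[of "if _ then _ else _"] ss
    by (subst krow_bracket) (simp add: algebra_simps)
qed

lemma site_commute_less: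
  assumes "i < j"
  shows "site i g (site j h f) = psc (if odd_gen g \<and> odd_gen h then -1 else 1) (site j h (site i g f))"
proof (rule ext)
  fix \<sigma>
  let ?F = "\<lambda>t t'. f (\<sigma>(i := t, j := t'))"
  have tw: "\<sigma>(j := t', i := t) = \<sigma>(i := t, j := t')" for t t'
    using assms by (simp add: fun_upd_twist)
  have R: "site j h (site i g f) \<sigma> = (if odd_gen h then sgb j \<sigma> else 1) * ((if odd_gen g then sgb i \<sigma> else 1) *
     krow (l j) (\<nu> j) h (\<lambda>t'. krow (l i) (\<nu> i) g (\<lambda>t. ?F t t') (\<sigma> i)) (\<sigma> j))"
    using assms by (simp add: site_def sgb_upd_ge krow_scale tw)
  have L: "site i g (site j h f) \<sigma> = (if odd_gen g then sgb i \<sigma> else 1) *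
     krow (l i) (\<nu> i) g (\<lambda>t. (if odd_gen h then sgb j \<sigma> * sgp (\<sigma> i) * sgp t else 1) * krow (l j) (\<nu> j) h (?F t) (\<sigma> j)) (\<sigma> i)"
    using assms by (cases "odd_gen h") (simp_all add: site_def sgb_upd_less)
  show "site i g (site j h f) \<sigma> = psc (if odd_gen g \<and> odd_gen h then -1 else 1) (site j h (site i g f)) \<sigma>"
  proof (cases "odd_gen h")
    case True
    have "krow (l i) (\<nu> i) g (\<lambda>t. (sgb j \<sigma> * sgp (\<sigma> i) * sgp t) * krow (l j) (\<nu> j) h (?F t) (\<sigma> j)) (\<sigma> i)
      = sgb j \<sigma> * sgp (\<sigma> i) * krow (l i) (\<nu> i) g (\<lambda>t. sgp t * krow (l j) (\<nu> j) h (?F t) (\<sigma> j)) (\<sigma> i)"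
      unfolding mult.assoc[of "sgb j \<sigma> * sgp (\<sigma> i)"] krow_scale ..
    also have "\<dots> = (if odd_gen g then -1 else 1) * sgb j \<sigma> * (sgp (\<sigma> i) * sgp (\<sigma> i)) *
       krow (l i) (\<nu> i) g (\<lambda>t. krow (l j) (\<nu> j) h (?F t) (\<sigma> j)) (\<sigma> i)"
      unfolding krow_parity by (simp add: mult_ac)
    finally show ?thesis
      unfolding psc_def R L using True krow_commute[of "l i" "\<nu> i" g "l j" "\<nu> j" h ?F "\<sigma> j" "\<sigma> i"]
      by (simp add: sgp_sq mult_ac)
  next
    case False
    then show ?thesis
      unfolding psc_def R L using krow_commute[of "l i" "\<nu> i" g "l j" "\<nu> j" h ?F "\<sigma> j" "\<sigma> i"] by simp
  qed
qed

lemma site_commute: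
  assumes "i \<noteq> j"
  shows "site i g (site j h f) = psc (if odd_gen g \<and> odd_gen h then -1 else 1) (site j h (site i g f))"
proof (cases "i < j")
  case False
  then have "site j h (site i g f) = psc (if odd_gen h \<and> odd_gen g then -1 else 1) (site i g (site j h f))"
    using assms by (intro site_commute_less) auto
  then show ?thesis by (auto simp: P.scale_scale)
qed (rule site_commute_less)

definition tact :: "complex poly sl12 \<Rightarrow> vec \<Rightarrow> vec" where
  "tact A f = (\<Sum>g\<in>UNIV. \<Sum>i<N. psc (epol i (coef g A)) (site i g f))"

lemma tact_compose:
  "tact A (tact B f) = (\<Sum>g\<in>UNIV. \<Sum>i<N. \<Sum>h\<in>UNIV. \<Sum>j<N.
     psc (epol i (coef g A) * epol j (coef h B)) (site i g (site j h f)))"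
  unfolding tact_def site_sum site_psc P.scale_sum_right P.scale_scale ..

lemma brk_sum: "(\<Sum>(c, x)\<leftarrow>xs. psc (of_int c) (F x)) = (\<Sum>x\<in>UNIV. psc (\<Sum>(c, y)\<leftarrow>xs. if y = x then of_int c else 0) (F x))"
  for F :: "gen \<Rightarrow> vec"
proof (induction xs)
  case (Cons z xs)
  obtain c x where z: "z = (c, x)" by (cases z)
  have "(\<Sum>y\<in>UNIV. psc (if x = y then of_int c else 0) (F y)) = (\<Sum>y\<in>UNIV. if x = y then psc (of_int c) (F y) else 0)"
    by (rule sum.cong) auto
  then have "(\<Sum>y\<in>UNIV. psc (if x = y then of_int c else 0) (F y)) = psc (of_int c) (F x)" by simp
  then show ?case
    unfolding z list.map sum_list.Cons prod.case P.scale_left_distrib sum.distrib Cons by simp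
qed simp

lemma epol_brk: "epol i (\<Sum>(c, y)\<leftarrow>xs. if y = x then of_int c else 0) = (\<Sum>(c, y)\<leftarrow>xs. if y = x then of_int c else 0)"
  by (induction xs) (auto simp: epol_simps epol_of_int)

lemma tact_bracket:
  assumes hom: "homogeneous p A" "homogeneous q B" "p \<in> {0,1}" "q \<in> {0,1}"
  shows "tact A (tact B f) = fsc ((-1) ^ (p * q)) (tact B (tact A f)) + tact (sbracket A B) f"
proof -
  let ?X = "\<lambda>g i. epol i (coef g A)" and ?Y = "\<lambda>h j. epol j (coef h B)"
  let ?br = "\<lambda>g h i. psc (?X g i * ?Y h i) (\<Sum>(c, x)\<leftarrow>brk g h. psc (of_int c) (site i x f))"
  have s: "psc (?X g i * ?Y h j) (psc (if odd_gen g \<and> odd_gen h then -1 else 1) v) =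
      fsc ((-1) ^ (p * q)) (psc (?X g i * ?Y h j) v)" for g h :: gen and i j v
  proof (cases "coef g A = 0 \<or> coef h B = 0")
    case True then show ?thesis by (auto simp: epol_simps)
  next
    case False
    then have "odd_gen g \<longleftrightarrow> p = 1" "odd_gen h \<longleftrightarrow> q = 1" using homogeneous_coef hom by blast+
    then show ?thesis using hom(3,4) by (auto simp: fsc_def psc_def fun_eq_iff one_pCons[symmetric])
  qed
  have summand: "psc (?X g i * ?Y h j) (site i g (site j h f)) =
     fsc ((-1) ^ (p * q)) (psc (?X g i * ?Y h j) (site j h (site i g f))) + (if i = j then ?br g h i else 0)" for g h :: gen and i j
  proof (cases "i = j")
    case True
    have "psc c (site j g (site j h f)) = psc c (psc (if odd_gen g \<and> odd_gen h then -1 else 1) (site j h (site j g f)))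
        + psc c (\<Sum>(c, x)\<leftarrow>brk g h. psc (of_int c) (site j x f))" for c
      by (subst site_bracket_same) (rule P.scale_right_distrib)
    then show ?thesis unfolding True by (simp only: s if_True simp_thms)
  next
    case False
    have "psc c (site i g (site j h f)) = psc c (psc (if odd_gen g \<and> odd_gen h then -1 else 1) (site j h (site i g f)))" for c
      by (subst site_commute[OF False]) (rule refl)
    then show ?thesis using False by (simp only: s if_False add_0_right)
  qed
  have "tact A (tact B f) = (\<Sum>g\<in>UNIV. \<Sum>i<N. \<Sum>h\<in>UNIV. \<Sum>j<N.
      fsc ((-1) ^ (p * q)) (psc (?X g i * ?Y h j) (site j h (site i g f)))) +
      (\<Sum>g\<in>UNIV. \<Sum>i<N. \<Sum>h\<in>UNIV. \<Sum>j<N. if i = j then ?br g h i else 0)"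
    unfolding tact_compose summand by (simp only: sum.distrib)
  also have "(\<Sum>g\<in>UNIV. \<Sum>i<N. \<Sum>h\<in>UNIV. \<Sum>j<N. fsc ((-1) ^ (p * q)) (psc (?X g i * ?Y h j) (site j h (site i g f)))) =
     fsc ((-1) ^ (p * q)) (\<Sum>g\<in>UNIV. \<Sum>i<N. \<Sum>h\<in>UNIV. \<Sum>j<N. psc (?X g i * ?Y h j) (site j h (site i g f)))"
    by (simp only: F.scale_sum_right)
  also have "(\<Sum>g\<in>UNIV. \<Sum>i<N. \<Sum>h\<in>UNIV. \<Sum>j<N. psc (?X g i * ?Y h j) (site j h (site i g f))) = tact B (tact A f)"
  proof -
    have "(\<Sum>g\<in>UNIV. \<Sum>i<N. \<Sum>h\<in>UNIV. \<Sum>j<N. psc (?X g i * ?Y h j) (site j h (site i g f))) =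
      (\<Sum>(g, i)\<in>UNIV \<times> {..<N}. \<Sum>(h, j)\<in>UNIV \<times> {..<N}. psc (?X g i * ?Y h j) (site j h (site i g f)))"
      by (simp only: sum.cartesian_product[symmetric])
    also have "\<dots> = (\<Sum>(h, j)\<in>UNIV \<times> {..<N}. \<Sum>(g, i)\<in>UNIV \<times> {..<N}. psc (?X g i * ?Y h j) (site j h (site i g f)))"
      unfolding case_prod_unfold by (rule sum.swap)
    also have "\<dots> = tact B (tact A f)" unfolding tact_compose
      by (simp only: sum.cartesian_product[symmetric] mult.commute)
    finally show ?thesis .
  qed
  also have "(\<Sum>g\<in>UNIV. \<Sum>i<N. \<Sum>h\<in>UNIV. \<Sum>j<N. if i = j then ?br g h i else 0) = tact (sbracket A B) f"
  proof -
    have "(\<Sum>g\<in>UNIV. \<Sum>i<N. \<Sum>h\<in>UNIV. \<Sum>j<N. if i = j then ?br g h i else 0) =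
      (\<Sum>g\<in>UNIV. \<Sum>i<N. \<Sum>h\<in>UNIV. ?br g h i)"
      by (intro sum.cong refl) (simp add: sum.delta)
    also have "\<dots> = (\<Sum>g\<in>UNIV. \<Sum>i<N. \<Sum>h\<in>UNIV. \<Sum>x\<in>UNIV.
        psc ((\<Sum>(c, y)\<leftarrow>brk g h. if y = x then of_int c else 0) * (?X g i * ?Y h i)) (site i x f))"
      unfolding brk_sum P.scale_sum_right P.scale_scale by (simp only: mult.commute)
    also have "\<dots> = (\<Sum>i<N. \<Sum>x\<in>UNIV. \<Sum>g\<in>UNIV. \<Sum>h\<in>UNIV.
        psc ((\<Sum>(c, y)\<leftarrow>brk g h. if y = x then of_int c else 0) * (?X g i * ?Y h i)) (site i x f))"
    proof -
      have "(\<Sum>g\<in>UNIV. \<Sum>i<N. \<Sum>h\<in>UNIV. \<Sum>x\<in>UNIV. F g i h x) = (\<Sum>i<N. \<Sum>x\<in>UNIV. \<Sum>g\<in>UNIV. \<Sum>h\<in>UNIV. F g i h x)"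
        for F :: "gen \<Rightarrow> nat \<Rightarrow> gen \<Rightarrow> gen \<Rightarrow> vec"
      proof -
        have "(\<Sum>g\<in>UNIV. \<Sum>i<N. \<Sum>h\<in>UNIV. \<Sum>x\<in>UNIV. F g i h x) = (\<Sum>i<N. \<Sum>g\<in>UNIV. \<Sum>h\<in>UNIV. \<Sum>x\<in>UNIV. F g i h x)"
          by (rule sum.swap)
        also have "\<dots> = (\<Sum>i<N. \<Sum>g\<in>UNIV. \<Sum>x\<in>UNIV. \<Sum>h\<in>UNIV. F g i h x)"
          by (rule sum.cong[OF refl], rule sum.cong[OF refl], rule sum.swap)
        also have "\<dots> = (\<Sum>i<N. \<Sum>x\<in>UNIV. \<Sum>g\<in>UNIV. \<Sum>h\<in>UNIV. F g i h x)"
          by (rule sum.cong[OF refl], rule sum.swap)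
        finally show ?thesis .
      qed
      then show ?thesis .
    qed
    also have "\<dots> = (\<Sum>x\<in>UNIV. \<Sum>i<N. psc (epol i (coef x (sbracket A B))) (site i x f))"
      unfolding coef_sbracket epol_sum epol_simps epol_brk P.scale_sum_left by (rule sum.swap)
    finally show ?thesis by (simp add: tact_def)
  qed
  finally show ?thesis .
qed

sublocale W: uenv_module fsc tact
proof
  show "tact x (v + w) = tact x v + tact x w" for x v w
    by (simp add: tact_def site_add P.scale_right_distrib sum.distrib)
  show "tact x (fsc c v) = fsc c (tact x v)" for x c v
    by (simp add: tact_def fsc_def site_psc P.scale_sum_right P.scale_left_commute)
  show "tact (x + y) v = tact x v + tact y v" for x y v
    by (simp add: tact_def epol_simps P.scale_left_distrib sum.distrib)
  show "tact (sl_scale [:c:] x) v = fsc c (tact x v)" for c x v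
    unfolding tact_def coef_scale epol_simps fsc_def P.scale_sum_right P.scale_scale ..
qed (rule tact_bracket)

end

declare zero_fun_apply [simp del] plus_fun_apply [simp del]

lemma krow_eq_0:
  assumes "\<And>c t'. (c, t') \<in> set (kac l n g t) \<Longrightarrow> f t' = 0"
  shows "krow l n g f t = 0"
proof -
  have "(\<Sum>(c, t')\<leftarrow>xs. c * f t') = 0" if "\<And>c t'. (c, t') \<in> set xs \<Longrightarrow> f t' = 0" for xs :: "('a \<times> state) list"
    using that
  proof (induction xs)
    case (Cons x xs)
    obtain c t' where x: "x = (c, t')" by (cases x)
    have "f t' = 0" using Cons.prems[of c t'] x by simp
    moreover have "(\<Sum>(c, t')\<leftarrow>xs. c * f t') = 0" by (rule Cons.IH) (use Cons.prems in auto)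
    ultimately show ?case using x by simp
  qed simp
  then show ?thesis using assms by (simp add: krow_def)
qed

context tensor_module
begin

lemma tact_psc: "tact x (psc p f) = psc p (tact x f)"
  by (simp only: tact_def site_psc P.scale_sum_right P.scale_left_commute)

lemma uact_psc: "W.uact u (psc p f) = psc p (W.uact u f)"
proof -
  have "u \<in> {u. \<forall>f. W.uact u (psc p f) = psc p (W.uact u f)}"
  proof (rule Uenv_induct)
    show "U.subspace {u. \<forall>f. W.uact u (psc p f) = psc p (W.uact u f)}"
      by (simp add: U.subspace_def W.uact_0 W.uact_add W.uact_cscale P.scale_right_distrib fsc_def P.scale_left_commute)
  qed (simp_all add: W.uact_1 W.uact_mult G_def W.uact_gen tact_psc)
  then show ?thesis by simp
qed

lemma uact_0_right: "W.uact u 0 = 0"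
  using W.uact_lin(2)[of u 0 0] by simp

lemma epol_monom: "epol i (monom 1 m) = [:0, 1:] ^ m * [:of_nat i ^ m:]"
proof -
  have "epol i (monom 1 m) = [:0, of_nat i:] ^ m"
  proof (induction m)
    case 0 then show ?case using epol_of_int[of i 1] by (simp add: monom_eq_1)
  next
    case (Suc m)
    have "monom 1 (Suc m) = [:0, 1:] * monom (1::complex) m" by (simp add: monom_Suc)
    then show ?case using Suc by (simp add: epol_simps) (simp add: epol_def pcompose_pCons)
  qed
  also have "[:0, of_nat i:] = [:0, 1:] * [:of_nat i :: complex:]" by simp
  also have "\<dots> ^ m = [:0, 1:] ^ m * [:of_nat i ^ m:]" by (simp only: power_mult_distrib poly_const_pow)
  finally show ?thesis .
qed

lemma uact_G: "W.uact (G g m) f = (\<Sum>i<N. psc ([:0, 1:] ^ m * [:of_nat i ^ m:]) (site i g f))"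
proof -
  have "W.uact (G g m) f = (\<Sum>h\<in>UNIV. if h = g then \<Sum>i<N. psc ([:0, 1:] ^ m * [:of_nat i ^ m:]) (site i g f) else 0)"
    unfolding G_def W.uact_gen tact_def coef_cur
    by (intro sum.cong refl) (auto simp: epol_monom epol_simps)
  then show ?thesis by simp
qed

lemma sum_coeff_poly:
  fixes d :: "complex poly"
  assumes "degree d \<le> M"
  shows "(\<Sum>k\<le>M. [:coeff d k:] * [:x ^ k:]) = [:poly d x:]"
proof -
  have "poly d x = (\<Sum>k\<le>M. coeff d k * x ^ k)"
    unfolding poly_altdef using assms by (intro sum.mono_neutral_left) (auto simp: coeff_eq_0)
  moreover have "[:sum f I:] = (\<Sum>k\<in>I. [:f k:])" for f :: "nat \<Rightarrow> complex" and I
  proof (induction I rule: infinite_finite_induct)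
    case (insert i I) then show ?case by (simp add: insert.IH[symmetric])
  qed simp_all
  ultimately show ?thesis by (simp add: mult.commute)
qed

text \<open>Interpolation: a combination of \<open>g(0), \<dots>, g(N-1)\<close> with polynomial coefficients acts by a nonzero
polynomial times \<open>g\<close> on the factor \<open>j\<close> alone. The coefficients are those of \<open>\<Prod>i\<noteq>j. (t - c i)\<close>.\<close>

lemma localize:
  assumes j: "j < N"
  shows "\<exists>c. c \<noteq> 0 \<and> psc c (site j g f) =
    (\<Sum>k\<le>N-1. psc ([:coeff (\<Prod>i\<in>{..<N}-{j}. [:- of_nat i, 1:]) k:] * [:0,1:] ^ (N - 1 - k)) (W.uact (G g k) f))"
proof -
  define d :: "complex poly" where "d = (\<Prod>i\<in>{..<N}-{j}. [:- of_nat i, 1:])"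
  let ?X = "[:0, 1:] :: complex poly"
  have "degree d = (\<Sum>i\<in>{..<N}-{j}. degree [:- of_nat i, 1 :: complex:])" unfolding d_def
    by (rule degree_prod_eq_sum_degree) simp
  then have deg: "degree d \<le> N - 1" using j by simp
  have "(\<Sum>k\<le>N-1. psc ([:coeff d k:] * ?X ^ (N - 1 - k)) (W.uact (G g k) f)) =
     (\<Sum>k\<le>N-1. \<Sum>i<N. psc (?X ^ (N - 1) * ([:coeff d k:] * [:of_nat i ^ k:])) (site i g f))"
    unfolding uact_G P.scale_sum_right P.scale_scale
  proof (intro sum.cong refl arg_cong2[of _ _ _ _ psc])
    fix k i assume "k \<in> {..N-1}"
    then have "N - 1 - k + k = N - 1" by simp
    then have "?X ^ (N - 1) = ?X ^ (N - 1 - k) * ?X ^ k" by (metis power_add)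
    then show "[:coeff d k:] * ?X ^ (N - 1 - k) * (?X ^ k * [:of_nat i ^ k:]) = ?X ^ (N - 1) * ([:coeff d k:] * [:of_nat i ^ k:])"
      by (simp only: mult_ac)
  qed
  also have "\<dots> = (\<Sum>i<N. \<Sum>k\<le>N-1. psc (?X ^ (N - 1) * ([:coeff d k:] * [:of_nat i ^ k:])) (site i g f))"
    by (rule sum.swap)
  also have "\<dots> = (\<Sum>i<N. psc (?X ^ (N - 1) * [:poly d (of_nat i):]) (site i g f))"
    by (simp only: P.scale_sum_left[symmetric] sum_distrib_left[symmetric] sum_coeff_poly[OF deg])
  also have "\<dots> = (\<Sum>i<N. if i = j then psc (?X ^ (N - 1) * [:poly d (of_nat j):]) (site j g f) else 0)"
  proof (intro sum.cong refl)
    fix i assume "i \<in> {..<N}"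
    then have "i \<noteq> j \<Longrightarrow> poly d (of_nat i) = 0" by (simp add: d_def poly_prod)
    then show "psc (?X ^ (N - 1) * [:poly d (of_nat i):]) (site i g f) =
      (if i = j then psc (?X ^ (N - 1) * [:poly d (of_nat j):]) (site j g f) else 0)" by auto
  qed
  also have "\<dots> = psc (?X ^ (N - 1) * [:poly d (of_nat j):]) (site j g f)" using j by simp
  finally have eq: "(\<Sum>k\<le>N-1. psc ([:coeff d k:] * ?X ^ (N - 1 - k)) (W.uact (G g k) f)) =
     psc (?X ^ (N - 1) * [:poly d (of_nat j):]) (site j g f)" .
  have "poly d (of_nat j) \<noteq> 0" by (simp add: d_def poly_prod)
  then have "?X ^ (N - 1) * [:poly d (of_nat j):] \<noteq> 0" by simp
  then show ?thesis using eq unfolding d_def by metis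
qed

text \<open>All evaluation points are roots of \<open>\<Prod>i. (t - c i)\<close>, so \<open>t^N\<close> acts as a combination of lower powers with
coefficients divisible by \<open>c\<close>.\<close>

lemma truncate:
  assumes N: "0 < N"
  shows "tact (sl_scale (monom 1 N) x) f =
    (\<Sum>k<N. psc ([:- coeff (\<Prod>i<N. [:- of_nat i, 1:]) k:] * [:0, 1:] ^ (N - k)) (tact (sl_scale (monom 1 k) x) f))"
proof -
  define d :: "complex poly" where "d = (\<Prod>i<N. [:- of_nat i, 1:])"
  let ?X = "[:0, 1:] :: complex poly"
  have "degree d = (\<Sum>i<N. degree [:- of_nat i, 1 :: complex:])" unfolding d_def
    by (rule degree_prod_eq_sum_degree) simp
  then have deg: "degree d = N" by simp
  have "lead_coeff d = 1" unfolding d_def by (simp add: lead_coeff_prod)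
  then have lc: "coeff d N = 1" using deg by simp
  have pow: "?X ^ N * [:of_nat i ^ N:] = (\<Sum>k<N. [:- coeff d k:] * ?X ^ (N - k) * (?X ^ k * [:of_nat i ^ k:]))"
    if "i < N" for i
  proof -
    have "(\<Sum>k\<le>N. [:coeff d k:] * [:of_nat i ^ k :: complex:]) = [:poly d (of_nat i):]"
      by (rule sum_coeff_poly) (simp add: deg)
    also have "poly d (of_nat i) = 0" using that by (simp add: d_def poly_prod)
    finally have "[:of_nat i ^ N:] = - (\<Sum>k<N. [:coeff d k:] * [:of_nat i ^ k :: complex:])"
      using lc by (simp add: lessThan_Suc_atMost[symmetric] add_eq_0_iff2 del: mult_pCons_left mult_pCons_right)
    then have "?X ^ N * [:of_nat i ^ N:] = (\<Sum>k<N. ?X ^ N * ([:- coeff d k:] * [:of_nat i ^ k:]))"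
      by (simp add: sum_distrib_left sum_negf)
    also have "\<dots> = (\<Sum>k<N. [:- coeff d k:] * ?X ^ (N - k) * (?X ^ k * [:of_nat i ^ k:]))"
    proof (intro sum.cong refl)
      fix k assume "k \<in> {..<N}"
      then have "N - k + k = N" by simp
      then have "?X ^ N = ?X ^ (N - k) * ?X ^ k" by (metis power_add)
      then show "?X ^ N * ([:- coeff d k:] * [:of_nat i ^ k:]) = [:- coeff d k:] * ?X ^ (N - k) * (?X ^ k * [:of_nat i ^ k:])"
        by (simp only: mult_ac)
    qed
    finally show ?thesis .
  qed
  have "tact (sl_scale (monom 1 N) x) f = (\<Sum>g\<in>UNIV. \<Sum>i<N. \<Sum>k<N.
      psc ([:- coeff d k:] * ?X ^ (N - k) * (?X ^ k * [:of_nat i ^ k:]) * epol i (coef g x)) (site i g f))"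
    unfolding tact_def coef_scale epol_simps epol_monom
    by (intro sum.cong refl) (simp only: pow lessThan_iff sum_distrib_right P.scale_sum_left)
  also have "\<dots> = (\<Sum>g\<in>UNIV. \<Sum>k<N. \<Sum>i<N.
      psc ([:- coeff d k:] * ?X ^ (N - k) * (?X ^ k * [:of_nat i ^ k:]) * epol i (coef g x)) (site i g f))"
    by (rule sum.cong[OF refl], rule sum.swap)
  also have "\<dots> = (\<Sum>k<N. \<Sum>g\<in>UNIV. \<Sum>i<N.
      psc ([:- coeff d k:] * ?X ^ (N - k) * (?X ^ k * [:of_nat i ^ k:]) * epol i (coef g x)) (site i g f))"
    by (rule sum.swap)
  also have "\<dots> = (\<Sum>k<N. psc ([:- coeff d k:] * ?X ^ (N - k)) (tact (sl_scale (monom 1 k) x) f))"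
    unfolding tact_def coef_scale epol_simps epol_monom P.scale_sum_right P.scale_scale by (simp only: mult.assoc)
  finally show ?thesis unfolding d_def .
qed

definition delta :: "conf \<Rightarrow> vec" where "delta \<sigma> = (\<lambda>\<sigma>'. if \<sigma>' = \<sigma> then 1 else 0)"

lemma site_delta:
  assumes k: "\<And>t. krow (l i) (\<nu> i) g (\<lambda>t'. if t' = \<sigma> i then 1 else 0) t = (if t = s' then c else 0)"
  shows "site i g (delta \<sigma>) = psc ((if odd_gen g then sgb i \<sigma> else 1) * c) (delta (\<sigma>(i := s')))"
proof (rule ext)
  fix \<sigma>'
  show "site i g (delta \<sigma>) \<sigma>' = psc ((if odd_gen g then sgb i \<sigma> else 1) * c) (delta (\<sigma>(i := s'))) \<sigma>'"
  proof (cases "\<sigma>'(i := \<sigma> i) = \<sigma>")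
    case True
    then have \<sigma>': "\<sigma>' = \<sigma>(i := \<sigma>' i)" by (metis fun_upd_triv fun_upd_upd)
    have "\<sigma>'(i := t) = \<sigma> \<longleftrightarrow> t = \<sigma> i" for t
      using True by (metis fun_upd_same)
    then have "(\<lambda>t. delta \<sigma> (\<sigma>'(i := t))) = (\<lambda>t'. if t' = \<sigma> i then 1 else 0)"
      by (simp add: delta_def)
    then have "site i g (delta \<sigma>) \<sigma>' = (if odd_gen g then sgb i \<sigma>' else 1) * (if \<sigma>' i = s' then c else 0)"
      by (simp add: site_def k)
    moreover have "sgb i \<sigma>' = sgb i \<sigma>" by (subst \<sigma>') (simp add: sgb_upd_ge)
    moreover have "\<sigma>' = \<sigma>(i := s') \<longleftrightarrow> \<sigma>' i = s'" using \<sigma>' by (metis fun_upd_same)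
    ultimately show ?thesis by (simp add: psc_def delta_def)
  next
    case False
    then have "\<sigma>'(i := t) \<noteq> \<sigma>" for t by (metis fun_upd_same fun_upd_upd fun_upd_triv)
    then have "(\<lambda>t. delta \<sigma> (\<sigma>'(i := t))) = (\<lambda>t. 0 * (0 :: complex poly))" by (auto simp: delta_def)
    then have "site i g (delta \<sigma>) \<sigma>' = 0" unfolding site_def by (simp only: krow_scale) simp
    moreover have "\<sigma>' \<noteq> \<sigma>(i := s')" using False by auto
    ultimately show ?thesis by (simp add: psc_def delta_def)
  qed
qed

end

section \<open>The lattice generated by the product of the highest weight vectors\<close>

fun wt_gen :: "gen \<Rightarrow> weight" where
  "wt_gen X1 = (0, -1)" | "wt_gen X2 = (1, 2)" | "wt_gen X3 = (1, 1)" |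
  "wt_gen Y1 = (0, 1)" | "wt_gen Y2 = (-1, -2)" | "wt_gen Y3 = (-1, -1)" |
  "wt_gen H1 = (0, 0)" | "wt_gen H2 = (0, 0)"

locale fusion =
  fixes N :: nat and \<nu> :: "nat \<Rightarrow> nat" and l1 :: complex
  assumes N: "0 < N" and \<nu>: "\<And>i. i < N \<Longrightarrow> 0 < \<nu> i"
begin

text \<open>On the even highest weight vector of factor \<open>i\<close>, \<open>h_1\<close> acts by \<open>c\<close>, shifted by \<open>l1\<close> for \<open>i = 0\<close>. These are nonzero polynomials, so
\<open>x_1\<close> leads from the highest weight vector to the even highest weight vector for generic \<open>c\<close>,
and at \<open>c = 0\<close> they add up to \<open>l1\<close>.\<close>

definition lw :: "nat \<Rightarrow> complex poly" where "lw i = [:if i = 0 then l1 else 0, 1:]"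

sublocale T: tensor_module N \<nu> lw .

definition hw_conf :: conf where "hw_conf = (\<lambda>i. if i < N then (True, False, 0) else undefined)"
definition v0 :: vec where "v0 = T.delta hw_conf"
definition Lat :: "vec set" where "Lat = P.span {T.W.uact u v0 |u. True}"
definition XLat :: "vec set" where "XLat = psc [:0, 1:] ` Lat"

lemma v0_Lat: "v0 \<in> Lat"
  unfolding Lat_def using T.W.uact_1[of v0] by (auto intro!: P.span_base intro: exI[of _ 1])

lemma uact_Lat: "f \<in> Lat \<Longrightarrow> T.W.uact u f \<in> Lat"
  unfolding Lat_def
proof (induction rule: P.span_induct_alt)
  case base then show ?case by (simp add: T.uact_0_right P.span_zero)
next
  case (step p x y)
  then obtain u' where "x = T.W.uact u' v0" by auto
  then have "T.W.uact u x = T.W.uact (u * u') v0" by (simp add: T.W.uact_mult)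
  then have "T.W.uact u x \<in> P.span {T.W.uact u v0 |u. True}" by (auto intro: P.span_base)
  then show ?case using step by (simp add: T.W.uact_lin T.uact_psc P.span_add P.span_scale)
qed

lemma Lat_psc: "f \<in> Lat \<Longrightarrow> psc p f \<in> Lat"
  and Lat_sum: "(\<And>i. i \<in> I \<Longrightarrow> F i \<in> Lat) \<Longrightarrow> sum F I \<in> Lat"
  and Lat_add: "f \<in> Lat \<Longrightarrow> g \<in> Lat \<Longrightarrow> f + g \<in> Lat"
  unfolding Lat_def by (auto intro: P.span_scale P.span_sum P.span_add)

lemma XLat_mult: "f \<in> Lat \<Longrightarrow> psc ([:0, 1:] * p) f \<in> XLat"
  unfolding XLat_def P.scale_scale[symmetric] by (intro imageI Lat_psc)

lemma XLat_0: "0 \<in> XLat"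
  using XLat_mult[OF v0_Lat, of 0] by simp

lemma XLat_add: "f \<in> XLat \<Longrightarrow> g \<in> XLat \<Longrightarrow> f + g \<in> XLat"
  unfolding XLat_def using Lat_add by (auto simp: P.scale_right_distrib[symmetric])

lemma XLat_sum: "(\<And>i. i \<in> I \<Longrightarrow> F i \<in> XLat) \<Longrightarrow> sum F I \<in> XLat"
  by (induction I rule: infinite_finite_induct) (auto simp: XLat_0 XLat_add)

text \<open>This left ideal is the annihilator of the highest weight vector in the reduction of the lattice at \<open>c = 0\<close>.\<close>

lemma left_ideal_XLat: "left_ideal {u. T.W.uact u v0 \<in> XLat}"
proof -
  have "T.W.uact r f \<in> XLat" if "f \<in> XLat" for r f
    using that uact_Lat unfolding XLat_def by (auto simp: T.uact_psc)
  then show ?thesis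
    by (auto simp: left_ideal_def T.W.uact_0 XLat_0 T.W.uact_add XLat_add T.W.uact_mult)
qed

lemma site_hw:
  assumes "i < N"
  shows "T.site i Y1 v0 = 0" "T.site i X2 v0 = 0" "T.site i X3 v0 = 0"
    "T.site i H1 v0 = psc (lw i) v0" "T.site i H2 v0 = psc (of_nat (\<nu> i)) v0"
proof -
  have hw: "hw_conf i = (True, False, 0)" and upd: "hw_conf(i := (True, False, 0)) = hw_conf"
    using assms by (auto simp: hw_conf_def)
  note nu = \<nu>[OF assms]
  have "krow (lw i) (\<nu> i) Y1 (\<lambda>t'. if t' = hw_conf i then 1 else 0) t = (if t = (True, False, 0) then 0 else 0)" for t
    by (cases t) (auto simp: hw krow_def)
  from T.site_delta[where \<sigma> = hw_conf and i = i, OF this] show "T.site i Y1 v0 = 0" by (simp add: v0_def)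
  have "krow (lw i) (\<nu> i) X2 (\<lambda>t'. if t' = hw_conf i then 1 else 0) t = (if t = (True, False, 0) then 0 else 0)" for t
    by (cases t) (auto simp: hw krow_def)
  from T.site_delta[where \<sigma> = hw_conf and i = i, OF this] show "T.site i X2 v0 = 0" by (simp add: v0_def)
  have "krow (lw i) (\<nu> i) X3 (\<lambda>t'. if t' = hw_conf i then 1 else 0) t = (if t = (True, False, 0) then 0 else 0)" for t
    by (cases t) (auto simp: hw krow_def)
  from T.site_delta[where \<sigma> = hw_conf and i = i, OF this] show "T.site i X3 v0 = 0" by (simp add: v0_def)
  have "krow (lw i) (\<nu> i) H1 (\<lambda>t'. if t' = hw_conf i then 1 else 0) t = (if t = (True, False, 0) then lw i else 0)" for t
    by (cases t) (use nu in \<open>auto simp: hw krow_def split: if_splits\<close>)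
  from T.site_delta[where \<sigma> = hw_conf and i = i, OF this] show "T.site i H1 v0 = psc (lw i) v0" by (simp add: v0_def upd)
  have "krow (lw i) (\<nu> i) H2 (\<lambda>t'. if t' = hw_conf i then 1 else 0) t = (if t = (True, False, 0) then of_nat (\<nu> i) else 0)" for t
    by (cases t) (use nu in \<open>auto simp: hw krow_def split: if_splits\<close>)
  from T.site_delta[where \<sigma> = hw_conf and i = i, OF this] show "T.site i H2 v0 = psc (of_nat (\<nu> i)) v0" by (simp add: v0_def upd)
qed

definition wt_state :: "nat \<Rightarrow> state \<Rightarrow> weight" where
  "wt_state i t = (case t of (a, b, k) \<Rightarrow>
     ((if i = 0 then l1 else 0) - of_nat k - (if b then 1 else 0),
      (if a then 1 else 0) - (if b then 1 else 0) + of_nat (\<nu> i) - 1 - 2 * of_nat k))"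

definition wt_conf :: "conf \<Rightarrow> weight" where "wt_conf \<sigma> = (\<Sum>i<N. wt_state i (\<sigma> i))"

text \<open>Homogeneity includes that no coefficient sits at a state without basis vector; only then do weights
bound the powers of \<open>y_2\<close> that act by nonzero operators.\<close>

definition valid :: "conf \<Rightarrow> bool" where "valid \<sigma> \<longleftrightarrow> (\<forall>i<N. snd (snd (\<sigma> i)) < \<nu> i)"

definition homog :: "weight \<Rightarrow> vec \<Rightarrow> bool" where
  "homog \<mu> f \<longleftrightarrow> (\<forall>\<sigma>. f \<sigma> \<noteq> 0 \<longrightarrow> wt_conf \<sigma> = \<mu> \<and> valid \<sigma>)"

lemma wt_conf_upd: "i < N \<Longrightarrow> wt_conf (\<sigma>(i := t)) + wt_state i (\<sigma> i) = wt_conf \<sigma> + wt_state i t"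
proof -
  assume i: "i < N"
  have "(\<Sum>j\<in>{..<N} - {i}. wt_state j ((\<sigma>(i := t)) j)) = (\<Sum>j\<in>{..<N} - {i}. wt_state j (\<sigma> j))"
    by (rule sum.cong) auto
  then show ?thesis
    using i sum.remove[of "{..<N}" i "\<lambda>j. wt_state j ((\<sigma>(i := t)) j)"] sum.remove[of "{..<N}" i "\<lambda>j. wt_state j (\<sigma> j)"]
    by (simp add: wt_conf_def algebra_simps)
qed

lemma kac_weight:
  assumes "(c, t') \<in> set (kac (lw i) (\<nu> i) g t)"
  shows "wt_state i t = wt_state i t' + wt_gen g" "snd (snd t) < \<nu> i"
proof -
  show "snd (snd t) < \<nu> i" using assms by (cases t; cases g) (auto split: if_splits)
  show "wt_state i t = wt_state i t' + wt_gen g"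
    using assms by (cases t; cases g) (auto simp: wt_state_def of_nat_diff split: if_splits)
qed

lemma homog_site:
  assumes i: "i < N" and f: "homog \<mu> f"
  shows "homog (\<mu> + wt_gen g) (T.site i g f)"
  unfolding homog_def
proof (intro allI impI)
  fix \<sigma> assume "T.site i g f \<sigma> \<noteq> 0"
  then have "krow (lw i) (\<nu> i) g (\<lambda>t. f (\<sigma>(i := t))) (\<sigma> i) \<noteq> 0" by (auto simp: T.site_def)
  then obtain c t' where t': "(c, t') \<in> set (kac (lw i) (\<nu> i) g (\<sigma> i))" "f (\<sigma>(i := t')) \<noteq> 0"
    using krow_eq_0[of "lw i" "\<nu> i" g "\<sigma> i" "\<lambda>t. f (\<sigma>(i := t))"] by blast
  note kw = kac_weight[OF t'(1)]
  have w: "wt_conf (\<sigma>(i := t')) = \<mu>" and v: "valid (\<sigma>(i := t'))" using f t'(2) by (auto simp: homog_def)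
  have "wt_conf \<sigma> + wt_state i t' = \<mu> + wt_gen g + wt_state i t'"
    using wt_conf_upd[OF i, of \<sigma> t'] w kw(1) by (simp add: add_ac)
  moreover have "valid \<sigma>" using v kw(2) by (auto simp: valid_def split: if_splits)
  ultimately show "wt_conf \<sigma> = \<mu> + wt_gen g \<and> valid \<sigma>" by simp
qed

lemma homog_sum: "(\<And>i. i \<in> I \<Longrightarrow> homog \<mu> (F i)) \<Longrightarrow> homog \<mu> (sum F I)"
proof (induction I rule: infinite_finite_induct)
  case (insert i I)
  then have "homog \<mu> (F i)" "homog \<mu> (sum F I)" by auto
  then show ?case using insert.hyps unfolding homog_def sum.insert[OF insert.hyps] plus_fun_apply
    by (metis add.left_neutral add.right_neutral)
qed (simp_all add: homog_def zero_fun_apply)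

lemma homog_psc: "homog \<mu> f \<Longrightarrow> homog \<mu> (psc p f)"
  by (auto simp: homog_def psc_def)

lemma homog_G: "homog \<mu> f \<Longrightarrow> homog (\<mu> + wt_gen g) (T.W.uact (G g m) f)"
  unfolding T.uact_G by (intro homog_sum homog_psc homog_site) auto

definition hw :: weight where "hw = (l1, of_nat (\<Sum>i<N. \<nu> i))"

lemma homog_v0: "homog hw v0"
proof -
  have "wt_conf hw_conf = (\<Sum>i<N. (if i = 0 then l1 else 0, of_nat (\<nu> i)))"
    unfolding wt_conf_def by (intro sum.cong refl) (auto simp: hw_conf_def wt_state_def)
  also have "\<dots> = hw"
  proof -
    have "(\<Sum>i<M. (if i = 0 then l1 else 0, of_nat (\<nu> i) :: complex)) = (if 0 < M then l1 else 0, of_nat (\<Sum>i<M. \<nu> i))" for M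
      by (induction M) (auto simp: zero_prod_def)
    then show ?thesis using N by (simp add: hw_def)
  qed
  finally show ?thesis using \<nu> by (auto simp: homog_def v0_def T.delta_def valid_def hw_conf_def)
qed

text \<open>No basis state has \<open>h_2\<close>-weight below \<open>- \<Sum>i. \<nu> i\<close>.\<close>

lemma Y2_nilpotent: "T.W.uact (G Y2 0 ^ Suc (\<Sum>i<N. \<nu> i)) v0 = 0"
proof -
  define n where "n = (\<Sum>i<N. \<nu> i)"
  have h: "homog (hw - (of_nat k, 2 * of_nat k)) (T.W.uact (G Y2 0 ^ k) v0)" for k
  proof (induction k)
    case 0 then show ?case using homog_v0 by (simp add: T.W.uact_1 hw_def)
  next
    case (Suc k)
    have "hw - (of_nat (Suc k), 2 * of_nat (Suc k)) = hw - (of_nat k, 2 * of_nat k) + wt_gen Y2"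
      by (simp add: hw_def)
    then show ?case using homog_G[OF Suc, of Y2 0] by (simp only: power_Suc T.W.uact_mult)
  qed
  have "T.W.uact (G Y2 0 ^ Suc n) v0 \<sigma> = 0" for \<sigma>
  proof (rule ccontr)
    assume "T.W.uact (G Y2 0 ^ Suc n) v0 \<sigma> \<noteq> 0"
    then have w: "wt_conf \<sigma> = hw - (of_nat (Suc n), 2 * of_nat (Suc n))" and v: "valid \<sigma>"
      using h[of "Suc n"] by (auto simp: homog_def)
    define z where "z i = (case \<sigma> i of (a, b, k) \<Rightarrow> (if a then 1 else 0) - (if b then 1 else 0) + int (\<nu> i) - 1 - 2 * int k)" for i
    have "snd (wt_conf \<sigma>) = of_int (\<Sum>i<N. z i)"
    proof -
      have "snd (\<Sum>i<M. wt_state i (\<sigma> i)) = of_int (\<Sum>i<M. z i)" for M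
        by (induction M) (auto simp: wt_state_def z_def split: prod.splits)
      then show ?thesis by (simp add: wt_conf_def)
    qed
    moreover have "snd (wt_conf \<sigma>) = of_int (- int n - 2)" using w by (simp add: hw_def n_def[symmetric])
    ultimately have "(\<Sum>i<N. z i) = - int n - 2" by (metis of_int_eq_iff)
    moreover have "(\<Sum>i<N. z i) \<ge> (\<Sum>i<N. - int (\<nu> i))"
    proof (rule sum_mono)
      fix i assume "i \<in> {..<N}"
      then show "- int (\<nu> i) \<le> z i" using v by (cases "\<sigma> i") (auto simp: z_def valid_def)
    qed
    moreover have "(\<Sum>i<N. - int (\<nu> i)) = - int n" by (simp add: n_def sum_negf)
    ultimately show False by simp
  qed
  then show ?thesis unfolding n_def[symmetric] by (intro ext) (simp add: zero_fun_apply)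
qed

end

section \<open>Weights and the lower bound\<close>

definition cartanU :: "complex \<Rightarrow> complex \<Rightarrow> nat \<Rightarrow> Uenv" where
  "cartanU a b r = U_gen (cur (cartan a b) r)"

lemma cartanU_eq: "cartanU a b r = cscale a (G H1 r) + cscale b (G H2 r)"
proof -
  have "cur (cartan a b) r = sl_scale [:a:] (cur sl_h1 r) + sl_scale [:b:] (cur sl_h2 r)"
    by (rule sl12_eqI) (simp add: cur_def cartan_def smult_add_left mult.commute)
  then show ?thesis by (simp add: cartanU_def U_gen_add U_gen_scale G_def cscale_def)
qed

lemma cscale_2: "cscale 2 u = 2 * u"
  using of_nat_cscale[of 2 u] by simp

lemma H_weight:
  "G H1 0 * (G g m * u) = G g m * (G H1 0 * u) + cscale (fst (wt_gen g)) (G g m * u)"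
  "G H2 0 * (G g m * u) = G g m * (G H2 0 * u) + cscale (snd (wt_gen g)) (G g m * u)"
  by (subst G_comm_assoc, cases g, simp_all add: cscale_2)+

lemma cartanU_G: "cartanU a b 0 * (G g m * u) = G g m * (cartanU a b 0 * u) + cscale (wt_eval (wt_gen g) a b) (G g m * u)"
proof -
  have "cartanU a b 0 * (G g m * u) = cscale a (G H1 0 * (G g m * u)) + cscale b (G H2 0 * (G g m * u))"
    by (simp add: cartanU_eq distrib_right U.scale_mult)
  also have "\<dots> = G g m * (cartanU a b 0 * u) + cscale (wt_eval (wt_gen g) a b) (G g m * u)"
    unfolding H_weight
    by (simp add: cartanU_eq distrib_right distrib_left U.scale_mult mult_cscale U.scale_right_distrib
        wt_eval_def U.scale_left_distrib add_ac)
  finally show ?thesis .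
qed

definition wprod :: "(gen \<times> nat) list \<Rightarrow> Uenv" where
  "wprod ws = prod_list (map (\<lambda>(g, m). G g m) ws)"

definition wt_word :: "(gen \<times> nat) list \<Rightarrow> weight" where
  "wt_word ws = (\<Sum>(g, m)\<leftarrow>ws. wt_gen g)"

lemma wprod_simps: "wprod [] = 1" "wprod ((g, m) # ws) = G g m * wprod ws"
  and wt_word_simps: "wt_word [] = 0" "wt_word ((g, m) # ws) = wt_gen g + wt_word ws"
  by (simp_all add: wprod_def wt_word_def)

lemma wprod_span: "u \<in> U.span (range wprod)"
proof (rule Uenv_induct)
  show "1 \<in> U.span (range wprod)" using wprod_simps(1) by (metis U.span_base rangeI)
  fix g m u assume "u \<in> U.span (range wprod)"
  then show "G g m * u \<in> U.span (range wprod)"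
  proof (induction rule: U.span_induct_alt)
    case base show ?case by (simp add: U.span_zero)
  next
    case (step c x y)
    then obtain ws where "x = wprod ws" by auto
    then have "G g m * x \<in> U.span (range wprod)" by (metis U.span_base rangeI wprod_simps(2))
    then show ?case using step by (simp add: distrib_left mult_cscale U.span_add U.span_scale)
  qed
qed simp

lemma wprod_weight:
  assumes J: "left_ideal J" and h: "\<And>a b. cartanU a b 0 - U_const (wt_eval hwt a b) \<in> J"
  shows "cartanU a b 0 * wprod ws - U_const (wt_eval (hwt + wt_word ws) a b) * wprod ws \<in> J"
proof (induction ws)
  case Nil then show ?case using h by (simp add: wprod_simps wt_word_simps)
next
  case (Cons x ws)
  obtain g m where x: "x = (g, m)" by (cases x)
  have "wt_eval (hwt + wt_word (x # ws)) a b = wt_eval (wt_gen g) a b + wt_eval (hwt + wt_word ws) a b"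
    by (simp add: x wt_word_simps wt_eval_def algebra_simps)
  then have "cartanU a b 0 * wprod (x # ws) - U_const (wt_eval (hwt + wt_word (x # ws)) a b) * wprod (x # ws)
     = G g m * (cartanU a b 0 * wprod ws - U_const (wt_eval (hwt + wt_word ws) a b) * wprod ws)"
    unfolding x wprod_simps cartanU_G
    by (simp add: U_const_add distrib_right right_diff_distrib cscale_def[symmetric] mult_cscale)
  then show ?case using left_ideal_mult[OF J Cons] by simp
qed

interpretation FF: complex_space_pair fsc fsc ..

context fusion
begin

lemma XLat_if_root:
  assumes "poly p 0 = 0" shows "psc p v0 \<in> XLat"
proof -
  have "[:0, 1:] dvd p" using assms poly_eq_0_iff_dvd[of p 0] by simp
  then obtain q where "p = [:0, 1:] * q" by (auto elim: dvdE)
  then show ?thesis using XLat_mult[OF v0_Lat] by metis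
qed

lemma uact_U_gen_Lat: "T.tact x v0 \<in> Lat"
  using uact_Lat[OF v0_Lat, of "U_gen x"] by (simp add: T.W.uact_gen)

text \<open>The product of the highest weight vectors satisfies the defining relations of the truncated Weyl module
after reduction at \<open>c = 0\<close>: the Cartan currents act by polynomials with the right constant term, and the
truncation holds by \<open>truncate\<close>.\<close>

lemma ideal_kills:
  assumes "u \<in> left_ideal hull weyl_trunc_rels l1 (\<Sum>i<N. \<nu> i) N"
  shows "T.W.uact u v0 \<in> XLat"
proof -
  have "weyl_trunc_rels l1 (\<Sum>i<N. \<nu> i) N \<subseteq> {u. T.W.uact u v0 \<in> XLat}"
  proof
    fix u assume "u \<in> weyl_trunc_rels l1 (\<Sum>i<N. \<nu> i) N"
    then consider f g k where "u = U_gen (tens sl_y1 f + tens sl_x2 g + tens sl_x3 k)"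
      | a b r where "u = cartanU a b r - U_const (if r = 0 then wt_eval hw a b else 0)"
      | "u = G Y2 0 ^ Suc (\<Sum>i<N. \<nu> i)"
      | x where "u = U_gen (sl_scale (monom 1 N) x)"
      unfolding weyl_trunc_rels_def weyl_rels_def cartanU_def hw_def G_def by auto
    then have "T.W.uact u v0 \<in> XLat"
    proof cases
      case 1
      let ?A = "tens sl_y1 f + tens sl_x2 g + tens sl_x3 k"
      have z: "psc (epol i (coef h ?A)) (T.site i h v0) = 0" if "i < N" for h i
        using site_hw[OF that] coef_basis_elt[of h Y1] coef_basis_elt[of h X2] coef_basis_elt[of h X3]
        by (cases h) (simp_all add: epol_simps)
      have "T.tact ?A v0 = 0" unfolding T.tact_def by (intro sum.neutral ballI) (simp only: z lessThan_iff)
      then show ?thesis using 1 by (simp add: T.W.uact_gen XLat_0)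
    next
      case 2
      let ?c = "if r = 0 then wt_eval hw a b else 0"
      define p where "p = (\<Sum>i<N. [:a:] * ([:0, 1:] ^ r * [:of_nat i ^ r:] * lw i))
          + (\<Sum>i<N. [:b:] * ([:0, 1:] ^ r * [:of_nat i ^ r:] * of_nat (\<nu> i))) - [:?c:]"
      have s1: "(\<Sum>i<N. psc ([:0, 1:] ^ r * [:of_nat i ^ r:]) (T.site i H1 v0)) = (\<Sum>i<N. psc ([:0, 1:] ^ r * [:of_nat i ^ r:] * lw i) v0)"
        by (intro sum.cong refl) (simp only: site_hw(4) lessThan_iff P.scale_scale)
      have s2: "(\<Sum>i<N. psc ([:0, 1:] ^ r * [:of_nat i ^ r:]) (T.site i H2 v0)) = (\<Sum>i<N. psc ([:0, 1:] ^ r * [:of_nat i ^ r:] * of_nat (\<nu> i)) v0)"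
        by (intro sum.cong refl) (simp only: site_hw(5) lessThan_iff P.scale_scale)
      have "T.W.uact u v0 = psc p v0"
        unfolding 2 p_def cartanU_eq T.W.uact_diff T.W.uact_add T.W.uact_cscale T.W.uact_const T.uact_G s1 s2 fsc_def
        by (simp only: P.scale_sum_right P.scale_scale sum_distrib_left P.scale_sum_left[symmetric] P.scale_left_diff_distrib[symmetric] P.scale_left_distrib[symmetric])
      moreover have "poly p 0 = 0"
      proof (cases "r = 0")
        case True
        have "poly (lw i) 0 = (if i = 0 then l1 else 0)" for i by (simp add: lw_def)
        then show ?thesis using True N
          by (simp add: p_def poly_sum hw_def wt_eval_def sum_distrib_left[symmetric] sum.delta)
      next
        case False then show ?thesis by (simp add: p_def poly_sum power_0_left)
      qed
      ultimately show ?thesis by (simp add: XLat_if_root)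
    next
      case 3 then show ?thesis using Y2_nilpotent XLat_0 by simp
    next
      case 4
      have "psc ([:c:] * [:0, 1:] ^ (N - k)) f \<in> XLat" if "k < N" "f \<in> Lat" for c k f
      proof -
        have "k < N" by (rule that(1))
        then obtain k' where "N - k = Suc k'" by (cases "N - k") auto
        then have "[:c:] * [:0, 1:] ^ (N - k) = [:0, 1:] * ([:c:] * [:0, 1:] ^ k')"
          by (simp only: power_Suc mult_ac)
        then show ?thesis using XLat_mult[OF that(2)] by metis
      qed
      then have "- psc ([:c:] * [:0, 1:] ^ (N - k)) f \<in> XLat" if "k < N" "f \<in> Lat" for c k f
        using that by (metis (no_types) minus_pCons minus_zero mult_minus_left P.scale_minus_left)
      then show ?thesis unfolding 4 T.W.uact_gen T.truncate[OF N]
        by (intro XLat_sum) (simp add: uact_U_gen_Lat)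
    qed
    then show "u \<in> {u. T.W.uact u v0 \<in> XLat}" by simp
  qed
  then have "left_ideal hull weyl_trunc_rels l1 (\<Sum>i<N. \<nu> i) N \<subseteq> {u. T.W.uact u v0 \<in> XLat}"
    using left_ideal_XLat by (rule hull_minimal)
  then show ?thesis using assms by auto
qed

text \<open>The intersection of the space with the span of the lattice over the field of fractions.\<close>

definition sat :: "vec set" where "sat = {f. \<exists>p. p \<noteq> 0 \<and> psc p f \<in> Lat}"

lemma sat_site:
  assumes f: "f \<in> sat" and j: "j < N" shows "T.site j g f \<in> sat"
proof -
  obtain p where p: "p \<noteq> 0" "psc p f \<in> Lat" using f by (auto simp: sat_def)
  obtain c where c: "c \<noteq> 0" "psc c (T.site j g (psc p f)) =
    (\<Sum>k\<le>N-1. psc ([:coeff (\<Prod>i\<in>{..<N}-{j}. [:- of_nat i, 1:]) k:] * [:0,1:] ^ (N - 1 - k)) (T.W.uact (G g k) (psc p f)))"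
    using T.localize[OF j, of g "psc p f"] by blast
  have "psc c (T.site j g (psc p f)) \<in> Lat" unfolding c(2) by (intro Lat_sum Lat_psc uact_Lat p)
  then have "psc (c * p) (T.site j g f) \<in> Lat" by (simp only: T.site_psc P.scale_scale)
  then show ?thesis using c(1) p(1) unfolding sat_def by (intro CollectI exI[of _ "c * p"]) simp
qed

lemma sat_step:
  assumes \<sigma>: "T.delta \<sigma> \<in> sat" and i: "i < N" and c: "c \<noteq> 0"
    and k: "\<And>t. krow (lw i) (\<nu> i) g (\<lambda>t'. if t' = \<sigma> i then 1 else 0) t = (if t = s' then c else 0)"
  shows "T.delta (\<sigma>(i := s')) \<in> sat"
proof -
  let ?s = "if odd_gen g then T.sgb i \<sigma> else 1"
  have "T.sgb i \<sigma> \<noteq> 0" using T.sgb_sq[of i \<sigma>] by auto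
  then have s: "?s * c \<noteq> 0" using c by simp
  have "psc (?s * c) (T.delta (\<sigma>(i := s'))) \<in> sat"
    using sat_site[OF \<sigma> i, of g] unfolding T.site_delta[where i = i and \<sigma> = \<sigma> and g = g, OF k] .
  then obtain p where "p \<noteq> 0" "psc p (psc (?s * c) (T.delta (\<sigma>(i := s')))) \<in> Lat" by (auto simp: sat_def)
  then have "p * (?s * c) \<noteq> 0" "psc (p * (?s * c)) (T.delta (\<sigma>(i := s'))) \<in> Lat"
    using s by (simp, simp only: P.scale_scale)
  then show ?thesis unfolding sat_def by blast
qed

text \<open>From the highest weight state of a factor, \<open>x_1\<close> leads to the even highest weight state, powers of
\<open>y_2\<close> to \<open>(False, False, k)\<close>, and then \<open>y_3\<close> and \<open>y_1\<close> to all states.\<close>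

lemma sat_reach:
  assumes \<sigma>: "T.delta \<sigma> \<in> sat" and i: "i < N" and hw: "\<sigma> i = (True, False, 0)" and k: "k < \<nu> i"
  shows "T.delta (\<sigma>(i := (a, b, k))) \<in> sat"
proof -
  have "krow (lw i) (\<nu> i) X1 (\<lambda>t'. if t' = \<sigma> i then 1 else 0) t = (if t = (False, False, 0) then lw i else 0)" for t
    using k by (cases t) (auto simp: hw krow_def)
  from sat_step[where \<sigma> = \<sigma> and i = i, OF \<sigma> i _ this] have 1: "T.delta (\<sigma>(i := (False, False, 0))) \<in> sat" by (simp add: lw_def)
  have 2: "T.delta (\<sigma>(i := (False, False, m))) \<in> sat" if "m < \<nu> i" for m
    using that
  proof (induction m)
    case 0 show ?case by (rule 1)
  next
    case (Suc m)
    let ?\<sigma> = "\<sigma>(i := (False, False, m))"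
    have "krow (lw i) (\<nu> i) Y2 (\<lambda>t'. if t' = ?\<sigma> i then 1 else 0) t = (if t = (False, False, Suc m) then 1 else 0)" for t
      using Suc.prems by (cases t) (auto simp: krow_def)
    from sat_step[where \<sigma> = ?\<sigma> and i = i, OF Suc.IH[OF Suc_lessD[OF Suc.prems]] i one_neq_zero this]
    show ?case by (simp only: fun_upd_upd)
  qed
  have 3: "T.delta (\<sigma>(i := (False, b, k))) \<in> sat"
  proof (cases b)
    case True
    let ?\<sigma> = "\<sigma>(i := (False, False, k))"
    have "krow (lw i) (\<nu> i) Y3 (\<lambda>t'. if t' = ?\<sigma> i then 1 else 0) t = (if t = (False, True, k) then 1 else 0)" for t
      using k by (cases t) (auto simp: krow_def)
    from sat_step[where \<sigma> = ?\<sigma> and i = i, OF _ i _ this] 2[OF k] True show ?thesis by simp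
  qed (use 2[OF k] in simp)
  show ?thesis
  proof (cases a)
    case True
    let ?\<sigma> = "\<sigma>(i := (False, b, k))"
    have "krow (lw i) (\<nu> i) Y1 (\<lambda>t'. if t' = ?\<sigma> i then 1 else 0) t = (if t = (True, b, k) then 1 else 0)" for t
      using k by (cases t) (auto simp: krow_def)
    from sat_step[where \<sigma> = ?\<sigma> and i = i, OF _ i _ this] 3 True show ?thesis by simp
  qed (use 3 in simp)
qed

definition confs :: "conf set" where "confs = Pi\<^sub>E {..<N} (\<lambda>i. {t. snd (snd t) < \<nu> i})"

lemma finite_states: "finite {t :: state. snd (snd t) < n}"
proof -
  have "{t :: state. snd (snd t) < n} = UNIV \<times> UNIV \<times> {..<n}" by auto
  then show ?thesis by simp
qed

lemma finite_confs: "finite confs"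
  unfolding confs_def by (intro finite_PiE finite_states) simp

text \<open>The factors are changed one after the other, which \<open>localize\<close> permits; the induction is on the number of
factors that may have left the highest weight state.\<close>

lemma delta_sat:
  assumes "\<sigma> \<in> confs" shows "T.delta \<sigma> \<in> sat"
proof -
  have "m \<le> N \<Longrightarrow> \<sigma> \<in> confs \<Longrightarrow> (\<And>i. m \<le> i \<Longrightarrow> i < N \<Longrightarrow> \<sigma> i = (True, False, 0)) \<Longrightarrow> T.delta \<sigma> \<in> sat" for m \<sigma>
  proof (induction m arbitrary: \<sigma>)
    case 0
    then have "\<sigma> = hw_conf" by (auto simp: hw_conf_def fun_eq_iff confs_def PiE_def extensional_def)
    moreover have "psc 1 v0 \<in> Lat" using v0_Lat by (simp add: P.scale_one)
    ultimately show ?case unfolding sat_def v0_def by (intro CollectI exI[of _ 1]) simp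
  next
    case (Suc m)
    let ?\<sigma> = "\<sigma>(m := (True, False, 0))"
    obtain a b k where s: "\<sigma> m = (a, b, k)" by (cases "\<sigma> m")
    have m: "m < N" using Suc.prems by simp
    have "\<sigma> m \<in> {t. snd (snd t) < \<nu> m}" using Suc.prems(2) m by (auto simp: confs_def PiE_def Pi_def)
    then have k: "k < \<nu> m" using s by simp
    have a1: "?\<sigma> \<in> confs" using Suc.prems(2) m \<nu> by (auto simp: confs_def PiE_def extensional_def)
    have a2: "?\<sigma> i = (True, False, 0)" if "m \<le> i" "i < N" for i
      using that Suc.prems(3)[of i] by (cases "i = m") auto
    have "T.delta ?\<sigma> \<in> sat" by (rule Suc.IH[OF less_imp_le[OF m] a1 a2])
    from sat_reach[OF this m _ k, of a b] show ?case by (simp add: s[symmetric])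
  qed
  from this[of N \<sigma>] show ?thesis using assms by simp
qed

lemma homog_wprod: "homog (hw + wt_word ws) (T.W.uact (wprod ws) v0)"
proof (induction ws)
  case Nil then show ?case using homog_v0 by (simp add: wprod_simps wt_word_simps T.W.uact_1)
next
  case (Cons x ws)
  obtain g m where x: "x = (g, m)" by (cases x)
  have "hw + wt_word (x # ws) = hw + wt_word ws + wt_gen g" by (simp add: x wt_word_simps add_ac)
  then show ?case using homog_G[OF Cons, of g m] by (simp only: x wprod_simps T.W.uact_mult)
qed

definition proj :: "weight \<Rightarrow> vec \<Rightarrow> vec" where
  "proj \<mu> f = (\<lambda>\<sigma>. if wt_conf \<sigma> = \<mu> then f \<sigma> else 0)"

lemma proj_add: "proj \<mu> (f + g) = proj \<mu> f + proj \<mu> g"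
  by (rule ext) (simp add: proj_def plus_fun_apply)
lemma proj_psc: "proj \<mu> (psc p f) = psc p (proj \<mu> f)"
  by (rule ext) (simp add: proj_def psc_def)
lemma proj_0: "proj \<mu> 0 = 0"
  by (rule ext) (simp add: proj_def zero_fun_apply)
lemma proj_fsc: "proj \<mu> (fsc c f) = fsc c (proj \<mu> f)"
  by (simp only: fsc_def proj_psc)
lemma proj_homog: "homog \<mu>' f \<Longrightarrow> proj \<mu> f = (if \<mu>' = \<mu> then f else 0)"
  by (rule ext) (auto simp: proj_def homog_def zero_fun_apply)

definition LatW :: "weight \<Rightarrow> vec set" where
  "LatW \<mu> = P.span {T.W.uact (wprod ws) v0 |ws. hw + wt_word ws = \<mu>}"

lemma LatW_0: "0 \<in> LatW \<mu>"
  and LatW_add: "f \<in> LatW \<mu> \<Longrightarrow> g \<in> LatW \<mu> \<Longrightarrow> f + g \<in> LatW \<mu>"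
  and LatW_psc: "f \<in> LatW \<mu> \<Longrightarrow> psc p f \<in> LatW \<mu>"
  and LatW_fsc: "f \<in> LatW \<mu> \<Longrightarrow> fsc c f \<in> LatW \<mu>"
  unfolding LatW_def fsc_def by (rule P.span_zero P.span_add P.span_scale; assumption?)+

lemma proj_uact: "proj \<mu> (T.W.uact u v0) \<in> LatW \<mu>"
  using wprod_span[of u]
proof (induction rule: U.span_induct_alt)
  case base show ?case by (simp only: T.W.uact_0 proj_0 LatW_0)
next
  case (step c x y)
  then obtain ws where x: "x = wprod ws" by auto
  have "proj \<mu> (T.W.uact x v0) \<in> LatW \<mu>"
    unfolding x proj_homog[OF homog_wprod] LatW_def by (auto intro: P.span_base P.span_zero)
  then show ?case using step(2) unfolding T.W.uact_add T.W.uact_cscale proj_add proj_fsc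
    by (intro LatW_add LatW_fsc)
qed

lemma proj_Lat: "f \<in> Lat \<Longrightarrow> proj \<mu> f \<in> LatW \<mu>"
  unfolding Lat_def
proof (induction rule: P.span_induct_alt)
  case base show ?case by (simp only: proj_0 LatW_def P.span_zero)
next
  case (step p x y)
  then obtain u where "x = T.W.uact u v0" by auto
  then have "proj \<mu> x \<in> LatW \<mu>" using proj_uact by simp
  then show ?case using step(2) unfolding proj_add proj_psc by (intro LatW_add LatW_psc)
qed

lemma linear_psc: "Vector_Spaces.linear fsc fsc (psc p)"
  by unfold_locales (simp_all only: P.scale_right_distrib fsc_def P.scale_left_commute)

text \<open>Elements that generate a weight space modulo the left ideal also generate the weight space of the
reduced lattice.\<close>

lemma LatW_rdim:
  assumes S: "finite S" "\<And>ws. hw + wt_word ws = \<mu> \<Longrightarrow> wprod ws \<in> U.span (S \<union> (left_ideal hull weyl_trunc_rels l1 (\<Sum>i<N. \<nu> i) N))"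
  shows "F.rdim (LatW \<mu>) (psc [:0, 1:] ` LatW \<mu>) (card S)"
proof -
  let ?J = "left_ideal hull weyl_trunc_rels l1 (\<Sum>i<N. \<nu> i) N"
  let ?\<phi> = "\<lambda>u. proj \<mu> (T.W.uact u v0)"
  let ?X = "psc [:0, 1:] ` LatW \<mu>"
  have lin: "Vector_Spaces.linear cscale fsc ?\<phi>"
    by unfold_locales (simp_all only: T.W.uact_add proj_add T.W.uact_cscale fsc_def proj_psc)
  interpret phi: Vector_Spaces.linear cscale fsc ?\<phi> by (rule lin)
  have JX: "?\<phi> ` ?J \<subseteq> ?X"
  proof clarify
    fix j assume "j \<in> ?J"
    then obtain f where f: "f \<in> Lat" "T.W.uact j v0 = psc [:0, 1:] f" using ideal_kills unfolding XLat_def by blast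
    show "?\<phi> j \<in> ?X" unfolding f(2) proj_psc by (rule imageI[OF proj_Lat[OF f(1)]])
  qed
  have gen: "T.W.uact (wprod ws) v0 \<in> F.span (?\<phi> ` S \<union> ?X)" if "hw + wt_word ws = \<mu>" for ws
  proof -
    have "?\<phi> (wprod ws) \<in> ?\<phi> ` U.span (S \<union> ?J)" using S(2)[OF that] by (rule imageI)
    also have "\<dots> = F.span (?\<phi> ` (S \<union> ?J))" by (rule phi.span_image[symmetric])
    also have "\<dots> \<subseteq> F.span (?\<phi> ` S \<union> ?X)" using JX by (intro F.span_mono) auto
    finally show ?thesis using proj_homog[OF homog_wprod, of \<mu> ws] that by simp
  qed
  have "f \<in> F.span (?\<phi> ` S \<union> ?X)" if "f \<in> LatW \<mu>" for f
    using that unfolding LatW_def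
  proof (induction rule: P.span_induct_alt)
    case base show ?case by (rule F.span_zero)
  next
    case (step p x y)
    then obtain ws where x: "x = T.W.uact (wprod ws) v0" "hw + wt_word ws = \<mu>" by auto
    obtain c q where p: "p = pCons c q" by (cases p)
    have "p = [:c:] + [:0, 1:] * q" by (simp add: p)
    then have "psc p x = fsc c x + psc [:0, 1:] (psc q x)" by (simp only: fsc_def P.scale_left_distrib P.scale_scale)
    moreover have "psc q x \<in> LatW \<mu>" unfolding LatW_def using x by (intro P.span_scale P.span_base) auto
    then have "psc [:0, 1:] (psc q x) \<in> F.span (?\<phi> ` S \<union> ?X)" by (intro F.span_base UnI2 imageI)
    moreover have "fsc c x \<in> F.span (?\<phi> ` S \<union> ?X)" using gen[OF x(2)] unfolding x(1) by (rule F.span_scale)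
    ultimately have "psc p x \<in> F.span (?\<phi> ` S \<union> ?X)" by (simp only: F.span_add)
    then show ?case using step(2) unfolding LatW_def[symmetric] by (rule F.span_add)
  qed
  then show ?thesis unfolding F.rdim_def using S(1) card_image_le[OF S(1), of ?\<phi>]
    by (intro exI[of _ "?\<phi> ` S"]) auto
qed

lemma LatW_rdim_power:
  assumes "F.rdim (LatW \<mu>) (psc [:0, 1:] ` LatW \<mu>) d"
  shows "F.rdim (LatW \<mu>) (psc ([:0, 1:] ^ M) ` LatW \<mu>) (M * d)"
proof (induction M)
  case 0
  have "psc ([:0, 1:] ^ 0) ` LatW \<mu> = LatW \<mu>" by (simp add: P.scale_one image_def)
  then show ?case using F.rdim_0[of "LatW \<mu>" "LatW \<mu>"] F.span_superset by auto
next
  case (Suc M)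
  have "F.rdim (psc ([:0, 1:] ^ M) ` LatW \<mu>) (psc ([:0, 1:] ^ M) ` psc [:0, 1:] ` LatW \<mu>) d"
    by (rule FF.rdim_image[OF linear_psc assms])
  moreover have "psc ([:0, 1:] ^ M) ` psc [:0, 1:] ` LatW \<mu> = psc ([:0, 1:] ^ Suc M) ` LatW \<mu>"
    by (simp only: image_image P.scale_scale power_Suc2)
  ultimately show ?case using F.rdim_trans[OF Suc] by (simp add: add.commute)
qed

text \<open>Counting modulo a large power \<open>c^(M+e)\<close>: the weight part of the lattice has dimension at most
\<open>(M + e) d\<close> there, with \<open>d = card S\<close>, while it contains nonzero multiples \<open>p_\<sigma> \<sigma>\<close> of all configurations and thus
\<open>M\<close> independent vectors \<open>c^k p_\<sigma> \<sigma>\<close>, \<open>k < M\<close>, for each, if \<open>e\<close> bounds the orders of vanishing of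
the \<open>p_\<sigma>\<close>. As \<open>M\<close> grows, this forces at most \<open>d\<close> configurations.\<close>

lemma weight_lower_bound:
  assumes S: "finite S" "\<And>ws. hw + wt_word ws = \<mu> \<Longrightarrow> wprod ws \<in> U.span (S \<union> (left_ideal hull weyl_trunc_rels l1 (\<Sum>i<N. \<nu> i) N))"
  shows "card {\<sigma> \<in> confs. wt_conf \<sigma> = \<mu>} \<le> card S"
proof -
  let ?X = "[:0, 1:] :: complex poly"
  define \<Omega> where "\<Omega> = {\<sigma> \<in> confs. wt_conf \<sigma> = \<mu>}"
  define d where "d = card S"
  have fin: "finite \<Omega>" unfolding \<Omega>_def using finite_confs by simp
  have "\<forall>\<sigma>\<in>\<Omega>. \<exists>p. p \<noteq> 0 \<and> psc p (T.delta \<sigma>) \<in> Lat" using delta_sat unfolding \<Omega>_def sat_def by blast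
  then obtain p where p: "\<And>\<sigma>. \<sigma> \<in> \<Omega> \<Longrightarrow> p \<sigma> \<noteq> 0" "\<And>\<sigma>. \<sigma> \<in> \<Omega> \<Longrightarrow> psc (p \<sigma>) (T.delta \<sigma>) \<in> Lat" by metis
  define e where "e = (\<Sum>\<sigma>\<in>\<Omega>. Polynomial.order 0 (p \<sigma>))"
  have ord: "Polynomial.order 0 (p \<sigma>) \<le> e" if "\<sigma> \<in> \<Omega>" for \<sigma> unfolding e_def using that fin by (intro member_le_sum) auto
  define x where "x = (\<lambda>(\<sigma>, k). psc (?X ^ k * p \<sigma>) (T.delta \<sigma>))"
  have x_val: "x (\<sigma>, k) \<sigma>' = (if \<sigma>' = \<sigma> then ?X ^ k * p \<sigma> else 0)" for \<sigma> k \<sigma>'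
    by (simp add: x_def psc_def T.delta_def)
  have count: "M * card \<Omega> \<le> (M + e) * d" for M
  proof -
    define I where "I = \<Omega> \<times> {..<M}"
    define J' where "J' = {f :: vec. \<forall>\<sigma>. ?X ^ (M + e) dvd f \<sigma>}"
    have Xm: "?X ^ k = monom 1 k" for k by (simp add: monom_altdef)
    have Xp: "Polynomial.smult c (?X ^ k * r) = monom c k * r" for c :: complex and k r
      by (simp add: Xm mult_smult_left[symmetric] smult_monom del: mult_smult_left)
    have J'sub: "F.subspace J'" unfolding J'_def F.subspace_def fsc_def psc_def
      by (auto simp: zero_fun_apply plus_fun_apply dvd_smult)
    have key: "\<forall>k<M. \<alpha> (\<sigma>, k) = 0" if s: "(\<Sum>i\<in>I. fsc (\<alpha> i) (x i)) \<in> J'" and \<sigma>: "\<sigma> \<in> \<Omega>" for \<alpha> \<sigma>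
    proof -
      define A where "A = (\<Sum>k<M. monom (\<alpha> (\<sigma>, k)) k)"
      have sum_app: "(\<Sum>i\<in>K. F i) \<sigma> = (\<Sum>i\<in>K. F i \<sigma>)" for F :: "_ \<Rightarrow> vec" and K
        by (induction K rule: infinite_finite_induct) (auto simp: zero_fun_apply plus_fun_apply)
      have "(\<Sum>i\<in>I. fsc (\<alpha> i) (x i)) \<sigma> = (\<Sum>(\<sigma>', k)\<in>I. if \<sigma>' = \<sigma> then monom (\<alpha> (\<sigma>, k)) k * p \<sigma> else 0)"
        unfolding sum_app by (rule sum.cong) (auto simp: fsc_def psc_def x_val Xp)
      also have "\<dots> = (\<Sum>\<sigma>'\<in>\<Omega>. if \<sigma>' = \<sigma> then (\<Sum>k<M. monom (\<alpha> (\<sigma>, k)) k * p \<sigma>) else 0)"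
        unfolding I_def by (subst sum.cartesian_product[symmetric]) (intro sum.cong refl, simp)
      also have "\<dots> = A * p \<sigma>" using fin \<sigma> by (simp add: A_def sum_distrib_right)
      finally have eq: "(\<Sum>i\<in>I. fsc (\<alpha> i) (x i)) \<sigma> = A * p \<sigma>" .
      have dv: "?X ^ (M + e) dvd A * p \<sigma>" using s unfolding J'_def eq[symmetric] by blast
      have "A = 0"
      proof (rule ccontr)
        assume A: "A \<noteq> 0"
        have cA: "coeff A k = 0" if "M \<le> k" for k
          unfolding A_def coeff_sum using that by (intro sum.neutral) auto
        have "degree A < M"
        proof (rule ccontr)
          assume "\<not> degree A < M"
          then have "lead_coeff A = 0" using cA by simp
          then show False using A by simp
        qed
        then have "Polynomial.order 0 A < M" using order_degree[OF A, of 0] by simp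
        moreover have "A * p \<sigma> \<noteq> 0" using A p(1)[OF \<sigma>] by simp
        moreover have "M + e \<le> Polynomial.order 0 (A * p \<sigma>)"
          using dv \<open>A * p \<sigma> \<noteq> 0\<close> order_divides[of 0 "M + e" "A * p \<sigma>"] by simp
        ultimately show False using ord[OF \<sigma>] by (simp add: order_mult)
      qed
      have "coeff A k = \<alpha> (\<sigma>, k)" if "k < M" for k
        unfolding A_def coeff_sum using that by (simp add: sum.delta)
      then show ?thesis using \<open>A = 0\<close> by auto
    qed
    have finI: "finite I" unfolding I_def using fin by simp
    have inj: "inj_on x I"
    proof (rule inj_onI, rule ccontr)
      fix i j assume ij: "i \<in> I" "j \<in> I" "x i = x j" "i \<noteq> j"
      define \<alpha> where "\<alpha> k = (if k = i then 1 else if k = j then -1 else 0 :: complex)" for k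
      have "(\<Sum>k\<in>I. fsc (\<alpha> k) (x k)) = (\<Sum>k\<in>{i, j}. fsc (\<alpha> k) (x k))"
        using ij finI by (intro sum.mono_neutral_right) (auto simp: \<alpha>_def)
      also have "\<dots> = fsc (\<alpha> i) (x i) + fsc (\<alpha> j) (x j)" using ij by simp
      also have "\<dots> = fsc (\<alpha> i + \<alpha> j) (x j)" unfolding ij(3) by (simp only: F.scale_left_distrib)
      also have "\<dots> = 0" using ij by (simp add: \<alpha>_def)
      finally have "(\<Sum>k\<in>I. fsc (\<alpha> k) (x k)) \<in> J'" using F.subspace_0[OF J'sub] by simp
      moreover obtain \<sigma> k where i: "i = (\<sigma>, k)" "\<sigma> \<in> \<Omega>" "k < M" using ij(1) by (auto simp: I_def)
      ultimately have "\<alpha> i = 0" using key[of \<alpha> \<sigma>] by auto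
      then show False by (simp add: \<alpha>_def)
    qed
    have ind: "F.indep_mod (x ` I) J'"
      unfolding F.indep_mod_def
    proof (intro allI impI ballI)
      fix c y assume c: "(\<Sum>s\<in>x ` I. fsc (c s) s) \<in> J'" and y: "y \<in> x ` I"
      have "(\<Sum>i\<in>I. fsc (c (x i)) (x i)) \<in> J'" using c by (simp add: sum.reindex[OF inj])
      then have k0: "\<forall>k<M. c (x (\<sigma>, k)) = 0" if "\<sigma> \<in> \<Omega>" for \<sigma>
        using key[of "\<lambda>i. c (x i)" \<sigma>] that by simp
      obtain \<sigma> k where "y = x (\<sigma>, k)" "\<sigma> \<in> \<Omega>" "k < M" using y by (auto simp: I_def)
      then show "c y = 0" using k0 by simp
    qed
    have sub: "x ` I \<subseteq> LatW \<mu>"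
    proof clarify
      fix \<sigma> k assume "(\<sigma>, k) \<in> I"
      then have \<sigma>: "\<sigma> \<in> \<Omega>" by (simp add: I_def)
      have "x (\<sigma>, k) = psc (?X ^ k) (psc (p \<sigma>) (T.delta \<sigma>))" by (simp only: x_def prod.case P.scale_scale)
      then have "x (\<sigma>, k) \<in> Lat" using p(2)[OF \<sigma>] by (simp only: Lat_psc)
      moreover have "proj \<mu> (x (\<sigma>, k)) = x (\<sigma>, k)"
        using \<sigma> by (intro ext) (auto simp: proj_def x_val \<Omega>_def)
      ultimately show "x (\<sigma>, k) \<in> LatW \<mu>" using proj_Lat by metis
    qed
    have "F.rdim (LatW \<mu>) (psc (?X ^ (M + e)) ` LatW \<mu>) ((M + e) * d)"
      unfolding d_def by (rule LatW_rdim_power[OF LatW_rdim[OF S]])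
    then have "F.rdim (LatW \<mu>) J' ((M + e) * d)"
      by (rule F.rdim_mono) (auto simp: J'_def psc_def)
    from F.indep_mod_card_le[OF J'sub _ ind sub this] finI have "card (x ` I) \<le> (M + e) * d" by simp
    then show ?thesis using card_image[OF inj] by (simp add: I_def card_cartesian_product mult.commute)
  qed
  have "card \<Omega> \<le> d"
  proof (rule ccontr)
    assume "\<not> card \<Omega> \<le> d"
    then have "Suc d \<le> card \<Omega>" by simp
    \<comment> \<open>already \<open>M = e d + 1\<close> is large enough for a contradiction\<close>

    then have "(e * d + 1) * Suc d \<le> (e * d + 1) * card \<Omega>" by (rule mult_left_mono) simp
    also have "\<dots> \<le> (e * d + 1 + e) * d" by (rule count)
    finally show False by (simp add: algebra_simps)
  qed
  then show ?thesis by (simp add: \<Omega>_def d_def)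
qed

end

section \<open>Dimensions of quotients by left ideals\<close>

text \<open>Spanning and independence modulo a left ideal \<open>J\<close> are translated into the dimension of the space of
cosets, for an arbitrary subspace \<open>A\<close>: both the whole module and its weight spaces are of this
form.\<close>

lemma coset_eq_iff:
  fixes J :: "Uenv set"
  assumes J: "left_ideal J" shows "u +o J = v +o J \<longleftrightarrow> u - v \<in> J"
proof
  note sub = left_ideal_subspace[OF J]
  assume e: "u +o J = v +o J"
  have "u \<in> u +o J" using U.subspace_0[OF sub] by (auto simp: elt_set_plus_def)
  then show "u - v \<in> J" unfolding e by (auto simp: elt_set_plus_def)
next
  note sub = left_ideal_subspace[OF J]
  have imp: "u +o J \<subseteq> v +o J" if "u - v \<in> J" for u v
  proof
    fix x assume "x \<in> u +o J"
    then obtain j where j: "j \<in> J" "x = v + ((u - v) + j)" by (auto simp: elt_set_plus_def)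
    show "x \<in> v +o J" unfolding j(2) elt_set_plus_def using U.subspace_add[OF sub that j(1)] by blast
  qed
  assume "u - v \<in> J"
  moreover have "v - u \<in> J" using U.subspace_neg[OF sub \<open>u - v \<in> J\<close>] by simp
  ultimately show "u +o J = v +o J" using imp by blast
qed

lemma coset_zero_iff: "left_ideal (J :: Uenv set) \<Longrightarrow> u +o J = J \<longleftrightarrow> u \<in> J"
  using coset_eq_iff[of J u 0] by (simp add: elt_set_plus_def)

lemma vectorspace_cosets:
  assumes J: "left_ideal J" and A: "U.subspace A"
  shows "vectorspace C_field (U_quot J\<lparr>carrier := (\<lambda>u. u +o J) ` A\<rparr>)"
proof -
  let ?V = "U_quot J\<lparr>carrier := (\<lambda>u. u +o J) ` A\<rparr>"
  note [simp] = coset_add[OF J] coset_mult[OF J]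
  have zero: "J = 0 +o J" by (simp add: elt_set_plus_def)
  have "abelian_group ?V"
  proof (rule abelian_groupI)
    fix x assume "x \<in> carrier ?V"
    then obtain u where u: "u \<in> A" "x = u +o J" by auto
    then have "- u \<in> A" using U.subspace_neg[OF A] by blast
    then show "\<exists>y\<in>carrier ?V. y \<oplus>\<^bsub>?V\<^esub> x = \<zero>\<^bsub>?V\<^esub>"
      by (intro bexI[of _ "(- u) +o J"]) (use zero in \<open>auto simp: U_quot_def u\<close>)
    show "\<zero>\<^bsub>?V\<^esub> \<oplus>\<^bsub>?V\<^esub> x = x"
      using coset_add[OF J, of 0 u] zero by (simp add: U_quot_def u)
  next
    show "\<zero>\<^bsub>?V\<^esub> \<in> carrier ?V"
      using imageI[OF U.subspace_0[OF A], of "\<lambda>u. u +o J"] by (simp add: U_quot_def)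
  next
    fix x y assume "x \<in> carrier ?V" "y \<in> carrier ?V"
    then show "x \<oplus>\<^bsub>?V\<^esub> y \<in> carrier ?V"
      using U.subspace_add[OF A] by (auto simp: U_quot_def)
  qed (auto simp: U_quot_def algebra_simps)
  moreover have "cring C_field"
    using field_C_field by (simp add: field_def domain_def)
  moreover have "U_const c * u \<in> A" if "u \<in> A" for c u
    using U.subspace_scale[OF A that] by (simp add: cscale_def)
  then have "module_axioms C_field ?V"
    by unfold_locales
       (auto simp: U_quot_def C_field_def U_const_add U_const_mult U_const_1
          distrib_left distrib_right mult.assoc)
  ultimately have "module C_field ?V"
    by (simp add: module_def)
  then show ?thesis
    by (simp add: vectorspace_def field_C_field)
qed

lemma indep_mod_notin: "U.subspace J \<Longrightarrow> finite S \<Longrightarrow> U.indep_mod S J \<Longrightarrow> s \<in> S \<Longrightarrow> s \<notin> J"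
proof
  assume J: "U.subspace J" and S: "finite S" "U.indep_mod S J" "s \<in> S" "s \<in> J"
  have "(\<Sum>t\<in>S. cscale (if t = s then 1 else 0) t) = (\<Sum>t\<in>S. if t = s then t else 0)"
    by (intro sum.cong) auto
  then have "(\<Sum>t\<in>S. cscale (if t = s then 1 else 0) t) \<in> J" using S by simp
  then have "\<forall>t\<in>S. (if t = s then 1 else 0) = (0 :: complex)"
    using S(2)[unfolded U.indep_mod_def, rule_format, of "\<lambda>t. if t = s then 1 else 0"] by blast
  then show False using S(3) by auto
qed

lemma indep_mod_subset:
  assumes S: "finite S" "U.indep_mod S J" "T \<subseteq> S"
  shows "U.indep_mod T J"
  unfolding U.indep_mod_def
proof (intro allI impI ballI)
  fix c s assume c: "(\<Sum>t\<in>T. cscale (c t) t) \<in> J" and s: "s \<in> T"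
  have "(\<Sum>t\<in>S. cscale (if t \<in> T then c t else 0) t) = (\<Sum>t\<in>T. cscale (c t) t)"
    using S by (intro sum.mono_neutral_cong_right) auto
  then have "\<forall>t\<in>S. (if t \<in> T then c t else 0) = 0"
    using c S(2)[unfolded U.indep_mod_def, rule_format, of "\<lambda>t. if t \<in> T then c t else 0"] by auto
  then show "c s = 0" using s S(3) by (auto split: if_splits)
qed

text \<open>The cosets of \<open>S\<close> form a basis.\<close>

lemma dim_cosets:
  assumes J: "left_ideal J" and A: "U.subspace A"
    and S: "S \<subseteq> A" "finite S" "U.indep_mod S J" and gen: "A \<subseteq> U.span (S \<union> J)"
  shows "vectorspace.fin_dim C_field (U_quot J\<lparr>carrier := (\<lambda>u. u +o J) ` A\<rparr>)"
    "vectorspace.dim C_field (U_quot J\<lparr>carrier := (\<lambda>u. u +o J) ` A\<rparr>) = card S"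
proof -
  let ?V = "U_quot J\<lparr>carrier := (\<lambda>u. u +o J) ` A\<rparr>"
  let ?c = "\<lambda>u. u +o J"
  note sub = left_ideal_subspace[OF J]
  interpret V: vectorspace C_field ?V by (rule vectorspace_cosets[OF J A])
  have inj: "inj_on ?c S"
  proof (rule inj_onI, rule ccontr)
    fix s t assume st: "s \<in> S" "t \<in> S" "?c s = ?c t" "s \<noteq> t"
    define c :: "Uenv \<Rightarrow> complex" where "c x = (if x = s then 1 else if x = t then -1 else 0)" for x
    have "(\<Sum>x\<in>S. cscale (c x) x) = (\<Sum>x\<in>{s,t}. cscale (c x) x)"
      using st S(2) by (intro sum.mono_neutral_right) (auto simp: c_def)
    also have "\<dots> = s - t" using st by (simp add: c_def)
    finally have "(\<Sum>x\<in>S. cscale (c x) x) \<in> J" using st(3) coset_eq_iff[OF J] by simp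
    then have "c s = 0" using S(3) st unfolding U.indep_mod_def by blast
    then show False by (simp add: c_def)
  qed
  have lc: "V.lincomb a (?c ` T) = ?c (\<Sum>t\<in>T. cscale (a (?c t)) t)" if "T \<subseteq> S" for a T
  proof -
    have "finite T" using that S(2) finite_subset by blast
    then show ?thesis using that
    proof (induction T)
      case empty
      then show ?case by (simp add: V.lincomb_def) (simp add: U_quot_def elt_set_plus_def)
    next
      case (insert t T)
      have nt: "?c t \<notin> ?c ` T" using inj insert.prems insert.hyps by (auto dest: inj_onD)
      have tA: "t \<in> A" "T \<subseteq> A" using insert.prems S(1) by auto
      have sm: "a (?c u) \<odot>\<^bsub>?V\<^esub> ?c u = ?c (cscale (a (?c u)) u)" for u
        by (simp add: U_quot_def coset_mult[OF J] cscale_def)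
      have cl: "?c (cscale k u) \<in> carrier ?V" if "u \<in> A" for k u
        using U.subspace_scale[OF A that] by simp
      have "V.lincomb a (?c ` insert t T) = (a (?c t) \<odot>\<^bsub>?V\<^esub> ?c t) \<oplus>\<^bsub>?V\<^esub> V.lincomb a (?c ` T)"
        unfolding V.lincomb_def image_insert
        using insert.hyps nt sm cl tA by (subst V.finsum_insert) auto
      also have "\<dots> = ?c (cscale (a (?c t)) t) + ?c (\<Sum>t\<in>T. cscale (a (?c t)) t)"
        using insert by (simp only: sm) (simp add: U_quot_def)
      finally show ?case using insert.hyps by (simp add: coset_add[OF J])
    qed
  qed
  have zero: "\<zero>\<^bsub>?V\<^esub> = J" by (simp add: U_quot_def)
  have indpt: "V.lin_indpt (?c ` S)"
  proof
    assume "V.lin_dep (?c ` S)"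
    then obtain B a v where B: "B \<subseteq> ?c ` S" "V.lincomb a B = \<zero>\<^bsub>?V\<^esub>" "v \<in> B" "a v \<noteq> \<zero>\<^bsub>C_field\<^esub>"
      unfolding V.lin_dep_def by blast
    obtain T where T: "T \<subseteq> S" "B = ?c ` T" using B(1) by (auto simp: subset_image_iff)
    then have "(\<Sum>t\<in>T. cscale (a (?c t)) t) \<in> J"
      using B(2) lc[OF T(1)] zero coset_zero_iff[OF J] by simp
    then have "\<forall>t\<in>T. a (?c t) = 0"
      using indep_mod_subset[OF S(2,3) T(1), unfolded U.indep_mod_def, rule_format, of "\<lambda>t. a (?c t)"] by blast
    then show False using B(3,4) T(2) by (auto simp: C_field_def)
  qed
  have carr: "?c ` S \<subseteq> carrier ?V" using S(1) by auto
  have "carrier ?V \<subseteq> V.span (?c ` S)"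
  proof
    fix x assume "x \<in> carrier ?V"
    then obtain u where u: "u \<in> A" "x = ?c u" by auto
    then have "u \<in> U.span (S \<union> J)" using gen by blast
    then obtain y z where yz: "u = y + z" "y \<in> U.span S" "z \<in> U.span J" unfolding U.span_Un by auto
    obtain k where k: "y = (\<Sum>s\<in>S. cscale (k s) s)" using yz(2) U.span_finite[OF S(2)] by auto
    have "z \<in> J" using yz(3) sub by (metis U.span_eq_iff)
    then have x: "x = ?c y" using coset_eq_iff[OF J, of u y] u yz(1) by simp
    define a where "a X = k (the_inv_into S ?c X)" for X
    have "V.lincomb a (?c ` S) = x"
      unfolding lc[OF subset_refl] x k by (rule arg_cong[where f = ?c], rule sum.cong)
        (simp_all add: a_def the_inv_into_f_f[OF inj])
    then show "x \<in> V.span (?c ` S)" unfolding V.span_def using S(2) by (force simp: C_field_def)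
  qed
  then have gen': "V.gen_set (?c ` S)" using V.span_is_subset2[OF carr] by blast
  then show "V.fin_dim" unfolding V.fin_dim_def using carr S(2) by blast
  have "V.basis (?c ` S)" unfolding V.basis_def using indpt gen' carr by blast
  then have "V.dim = card (?c ` S)" using S(2) by (intro V.dim_basis) auto
  then show "V.dim = card S" by (simp add: card_image[OF inj])
qed

section \<open>Consequences of the defining relations\<close>

lemma weyl_relations:
  assumes J: "left_ideal J" and rel: "weyl_rels l1 l2 \<subseteq> J"
  shows "G X2 m \<in> J" "G X3 m \<in> J" "G Y1 m \<in> J"
    "cartanU a b 0 - U_const (wt_eval (l1, of_nat l2) a b) \<in> J"
    "G H1 m - U_const (if m = 0 then l1 else 0) \<in> J"
    "G H2 m - (if m = 0 then of_nat l2 else 0) \<in> J"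
    "G Y2 0 ^ (l2 + 1) \<in> J"
proof -
  have n: "U_gen (tens sl_y1 f + tens sl_x2 g + tens sl_x3 k) \<in> J" for f g k
    using rel unfolding weyl_rels_def by blast
  show "G X2 m \<in> J" using n[of 0 "monom 1 m" 0] by (simp add: tens_0 G_def cur_def)
  show "G X3 m \<in> J" using n[of 0 0 "monom 1 m"] by (simp add: tens_0 G_def cur_def)
  show "G Y1 m \<in> J" using n[of "monom 1 m" 0 0] by (simp add: tens_0 G_def cur_def)
  have c: "cartanU a b r - U_const (if r = 0 then wt_eval (l1, of_nat l2) a b else 0) \<in> J" for a b r
    using rel unfolding weyl_rels_def cartanU_def by blast
  show "cartanU a b 0 - U_const (wt_eval (l1, of_nat l2) a b) \<in> J" using c[of a b 0] by simp
  show "G H1 m - U_const (if m = 0 then l1 else 0) \<in> J"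
    using c[of 1 0 m] by (cases "m = 0") (simp_all add: cartanU_eq wt_eval_def)
  show "G H2 m - (if m = 0 then of_nat l2 else 0) \<in> J"
    using c[of 0 1 m] by (auto simp: cartanU_eq wt_eval_def U_const_of_nat U_const_0 split: if_splits)
  show "G Y2 0 ^ (l2 + 1) \<in> J" using rel unfolding weyl_rels_def G_def by auto
qed

lemma truncation_relations:
  assumes "weyl_trunc_rels l1 l2 N \<subseteq> J" "N \<le> j"
  shows "G g j \<in> J"
proof -
  have "U_gen (sl_scale (monom 1 N) (cur (basis_elt g) (j - N))) \<in> J"
    using assms(1) unfolding weyl_trunc_rels_def by blast
  moreover have "sl_scale (monom 1 N) (cur (basis_elt g) (j - N)) = cur (basis_elt g) j"
    by (rule sl12_eqI) (simp add: coef_cur mult_monom assms(2))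
  ultimately show ?thesis by (simp add: G_def)
qed

text \<open>Garland's relation for \<open>r = 1\<close> gives \<open>y_2(j)\<close>; then \<open>x_1(j)\<close> and \<open>y_3(j)\<close> are brackets of \<open>y_2(j)\<close> with the
generators \<open>x_3(0)\<close> and \<open>y_1(0)\<close>. For \<open>j = 0\<close> the Cartan elements cause no exception: then \<open>l2 = 0\<close>,
and dominance forces \<open>l1 = 0\<close>.\<close>

lemma weyl_ideal_high_currents:
  assumes lam: "(l1, of_nat l2) \<in> Pplus" and N: "l2 \<le> N" "N \<le> j"
    and J: "left_ideal J" and rel: "weyl_rels l1 l2 \<subseteq> J"
  shows "G g j \<in> J"
proof -
  note R = weyl_relations[OF J rel] and sub = left_ideal_subspace[OF J]
  have zero: "j = 0 \<Longrightarrow> l2 = 0 \<and> l1 = 0" using lam N by (auto simp: Pplus_def zero_prod_def)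
  have Y2: "G Y2 j \<in> J"
    using garland_relations[OF J R(1) R(6) R(7), of "Suc 0" j] N by (simp add: rcoef_1)
  have "G X3 0 * G Y2 j = G Y2 j * G X3 0 + G X1 j" using G_comm[of X3 0 Y2 j] by simp
  then have "G X1 j = G X3 0 * G Y2 j - G Y2 j * G X3 0" by simp
  then have X1: "G X1 j \<in> J" using U.subspace_diff[OF sub] left_ideal_mult[OF J] Y2 R(2) by metis
  have "G Y1 0 * G Y2 j = G Y2 j * G Y1 0 - G Y3 j" using G_comm[of Y1 0 Y2 j] by simp
  then have "G Y3 j = G Y2 j * G Y1 0 - G Y1 0 * G Y2 j" by (simp add: algebra_simps)
  then have Y3: "G Y3 j \<in> J" using U.subspace_diff[OF sub] left_ideal_mult[OF J] Y2 R(3) by metis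
  have H: "G H1 j \<in> J" "G H2 j \<in> J"
    using R(5)[of j] R(6)[of j] zero by (auto simp: U_const_0 split: if_splits)
  show ?thesis using Y2 X1 Y3 H R by (cases g) auto
qed

lemma U_gen_shift_in:
  assumes J: "left_ideal J" and G: "\<And>g j. N \<le> j \<Longrightarrow> G g j \<in> J"
  shows "U_gen (sl_scale (monom 1 N) x) \<in> J"
proof -
  note sub = left_ideal_subspace[OF J]
  have "cscale (coeff (coef g (sl_scale (monom 1 N) x)) i) (G g i) \<in> J" for g i
  proof (cases "N \<le> i")
    case True then show ?thesis using G U.subspace_scale[OF sub] by blast
  next
    case False then show ?thesis using U.subspace_0[OF sub] by (simp add: coeff_monom_mult)
  qed
  then show ?thesis
    by (subst U_gen_decomp, unfold U_gen_tens) (intro U.subspace_sum[OF sub])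
qed

lemma weyl_trunc_hull:
  assumes "(l1, of_nat l2) \<in> Pplus" "l2 \<le> N"
  shows "left_ideal hull weyl_trunc_rels l1 l2 N = left_ideal hull weyl_rels l1 l2"
proof (rule antisym)
  let ?J = "left_ideal hull weyl_rels l1 l2"
  have "weyl_trunc_rels l1 l2 N \<subseteq> ?J"
    using U_gen_shift_in[OF left_ideal_hull weyl_ideal_high_currents[OF assms _ left_ideal_hull hull_subset]]
    by (auto simp: weyl_trunc_rels_def intro: hull_inc)
  then show "left_ideal hull weyl_trunc_rels l1 l2 N \<subseteq> ?J" by (rule hull_minimal) (rule left_ideal_hull)
  show "?J \<subseteq> left_ideal hull weyl_trunc_rels l1 l2 N"
    by (rule hull_mono) (simp add: weyl_trunc_rels_def)
qed

lemma cmodule_iso_refl: "cmodule_iso V V"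
  unfolding cmodule_iso_def by (rule bexI[of _ "\<lambda>x. x"]) (auto simp: module_hom_def bij_betw_def)

lemma prod_split_at:
  fixes a b :: "'a::comm_monoid_mult"
  assumes "m \<le> N" shows "(\<Prod>i<N. if i < m then a else b) = a ^ m * b ^ (N - m)"
proof -
  have "{..<N} \<inter> {i. i < m} = {..<m}" "{..<N} \<inter> - {i. i < m} = {m..<N}" using assms by auto
  then show ?thesis by (simp add: prod.If_cases)
qed

lemma trunc_upper_bound:
  assumes n: "l2 = q * N + m" "m < N" "0 < q"
  shows "U.rdim UNIV (left_ideal hull weyl_trunc_rels l1 l2 N) (\<Prod>i<N. 4 * (if i < m then q + 1 else q))"
proof -
  let ?J = "left_ideal hull weyl_trunc_rels l1 l2 N" and ?\<nu> = "\<lambda>i. if i < m then q + 1 else q"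
  have sub: "weyl_trunc_rels l1 l2 N \<subseteq> ?J" by (rule hull_subset)
  then have sub': "weyl_rels l1 l2 \<subseteq> ?J" by (auto simp: weyl_trunc_rels_def)
  note J = left_ideal_hull[of "weyl_trunc_rels l1 l2 N"]
  note R = weyl_relations[OF J sub'] and T = truncation_relations[OF sub]
  have span: "x \<in> U.span (insert 1 ?J)" if "x - U_const c \<in> ?J" for x c
  proof -
    have "(x - U_const c) + cscale c 1 \<in> U.span (insert 1 ?J)"
      by (intro U.span_add U.span_scale U.span_base) (use that in auto)
    then show ?thesis by (simp add: cscale_def)
  qed
  have H2: "G H2 m - U_const (if m = 0 then of_nat l2 else 0) \<in> ?J" for m
    using R(6)[of m] by (auto simp: U_const_of_nat U_const_0 split: if_splits)
  have "U.rdim UNIV ?J (\<Prod>i<N. if ?\<nu> i = 0 then 1 else 4 * ?\<nu> i)"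
    by (rule upper_bound[OF J R(2) R(1) R(3) span[OF R(5)] span[OF H2] T
          near_rectangle_relations[OF J R(1) R(6) R(7) T n(1,2)]])
       (auto simp: antitone_below_def)
  also have "(\<Prod>i<N. if ?\<nu> i = 0 then 1 else 4 * ?\<nu> i) = (\<Prod>i<N. 4 * ?\<nu> i)"
    using n(3) by (intro prod.cong) auto
  finally show ?thesis .
qed

section \<open>Weight multiplicities and the character\<close>

definition weight_sub :: "Uenv set \<Rightarrow> weight \<Rightarrow> Uenv set" where
  "weight_sub J \<mu> = {u. \<forall>a b. cartanU a b 0 * u - U_const (wt_eval \<mu> a b) * u \<in> J}"

lemma subspace_weight_sub:
  assumes J: "left_ideal J" shows "U.subspace (weight_sub J \<mu>)"
  unfolding U.subspace_def
proof (intro conjI ballI allI)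
  note sub = left_ideal_subspace[OF J]
  show "0 \<in> weight_sub J \<mu>" using U.subspace_0[OF sub] by (simp add: weight_sub_def)
  fix u v c assume u: "u \<in> weight_sub J \<mu>"
  have "cartanU a b 0 * cscale c u - U_const (wt_eval \<mu> a b) * cscale c u
      = cscale c (cartanU a b 0 * u - U_const (wt_eval \<mu> a b) * u)" for a b
    by (simp add: mult_cscale U.scale_right_diff_distrib)
  then show "cscale c u \<in> weight_sub J \<mu>" using u U.subspace_scale[OF sub] by (simp add: weight_sub_def)
next
  note sub = left_ideal_subspace[OF J]
  fix u v assume u: "u \<in> weight_sub J \<mu>" and v: "v \<in> weight_sub J \<mu>"
  have "cartanU a b 0 * (u + v) - U_const (wt_eval \<mu> a b) * (u + v)
      = (cartanU a b 0 * u - U_const (wt_eval \<mu> a b) * u) + (cartanU a b 0 * v - U_const (wt_eval \<mu> a b) * v)" for a b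
    by (simp add: algebra_simps)
  then show "u + v \<in> weight_sub J \<mu>" using u v U.subspace_add[OF sub] by (simp add: weight_sub_def)
qed

lemma weight_space_U_quot:
  assumes J: "left_ideal J"
  shows "weight_space (U_quot J) \<mu> = (\<lambda>u. u +o J) ` weight_sub J \<mu>"
proof -
  have "(u +o J \<in> weight_space (U_quot J) \<mu>) = (u \<in> weight_sub J \<mu>)" for u
    by (simp add: rangeI[of "\<lambda>u. u +o J" u] weight_space_def U_quot_def coset_mult[OF J] coset_eq_iff[OF J] weight_sub_def cartanU_def)
  moreover have "weight_space (U_quot J) \<mu> \<subseteq> range (\<lambda>u. u +o J)"
    by (auto simp: weight_space_def U_quot_def)
  ultimately show ?thesis by blast
qed

text \<open>Applying \<open>h - \<mu>0(h)\<close> to a sum of weight vectors removes the component of weight \<open>\<mu>0\<close> and multiplies the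
others by \<open>\<mu>(h) - \<mu>0(h)\<close>, which is nonzero for a suitable \<open>h\<close> among \<open>h_1\<close> and \<open>h_2\<close>.\<close>

lemma weights_independent:
  assumes J: "left_ideal J"
  shows "finite M \<Longrightarrow> (\<And>\<mu>. \<mu> \<in> M \<Longrightarrow> u \<mu> \<in> weight_sub J \<mu>) \<Longrightarrow> (\<Sum>\<mu>\<in>M. u \<mu>) \<in> J \<Longrightarrow> \<mu> \<in> M \<Longrightarrow> u \<mu> \<in> J"
proof (induction M arbitrary: u \<mu> rule: finite_induct)
  case (insert \<mu>0 M)
  note sub = left_ideal_subspace[OF J]
  have M: "u \<mu> \<in> J" if \<mu>: "\<mu> \<in> M" for \<mu>
  proof -
    have step: "cscale (wt_eval \<mu> a b - wt_eval \<mu>0 a b) (u \<mu>) \<in> J" for a b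
    proof (rule insert.IH[where u = "\<lambda>\<mu>. cscale (wt_eval \<mu> a b - wt_eval \<mu>0 a b) (u \<mu>)", OF _ _ \<mu>])
      show "cscale (wt_eval \<mu>' a b - wt_eval \<mu>0 a b) (u \<mu>') \<in> weight_sub J \<mu>'" if "\<mu>' \<in> M" for \<mu>'
        using insert.prems(1) that U.subspace_scale[OF subspace_weight_sub[OF J]] by blast
      let ?d = "\<lambda>\<mu>. cartanU a b 0 * u \<mu> - cscale (wt_eval \<mu> a b) (u \<mu>)"
      have d: "?d \<mu>' \<in> J" if "\<mu>' \<in> insert \<mu>0 M" for \<mu>'
        using insert.prems(1)[OF that] by (simp add: weight_sub_def cscale_def)
      let ?s = "\<Sum>\<mu>\<in>insert \<mu>0 M. u \<mu>"
      have "cartanU a b 0 * ?s - cscale (wt_eval \<mu>0 a b) ?s - (\<Sum>\<mu>\<in>insert \<mu>0 M. ?d \<mu>) \<in> J"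
        using left_ideal_mult[OF J insert.prems(2)] U.subspace_scale[OF sub insert.prems(2)]
        by (intro U.subspace_diff[OF sub] U.subspace_sum[OF sub] d)
      also have "cartanU a b 0 * ?s - cscale (wt_eval \<mu>0 a b) ?s - (\<Sum>\<mu>\<in>insert \<mu>0 M. ?d \<mu>)
          = (\<Sum>\<mu>\<in>insert \<mu>0 M. cscale (wt_eval \<mu> a b - wt_eval \<mu>0 a b) (u \<mu>))"
        unfolding sum_distrib_left U.scale_sum_right sum_subtractf[symmetric]
        by (intro sum.cong refl) (simp add: U.scale_left_diff_distrib)
      also have "\<dots> = (\<Sum>\<mu>\<in>M. cscale (wt_eval \<mu> a b - wt_eval \<mu>0 a b) (u \<mu>))"
        using insert.hyps by simp
      finally show "(\<Sum>\<mu>\<in>M. cscale (wt_eval \<mu> a b - wt_eval \<mu>0 a b) (u \<mu>)) \<in> J" .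
    qed
    have "\<mu> \<noteq> \<mu>0" using \<mu> insert.hyps by auto
    then have "wt_eval \<mu> 1 0 - wt_eval \<mu>0 1 0 \<noteq> 0 \<or> wt_eval \<mu> 0 1 - wt_eval \<mu>0 0 1 \<noteq> 0"
      by (auto simp: wt_eval_def prod_eq_iff)
    then obtain a b where ab: "wt_eval \<mu> a b - wt_eval \<mu>0 a b \<noteq> 0" by blast
    show ?thesis using U.subspace_scale[OF sub step[of a b], of "inverse (wt_eval \<mu> a b - wt_eval \<mu>0 a b)"] ab by simp
  qed
  have "u \<mu>0 = (\<Sum>\<mu>\<in>insert \<mu>0 M. u \<mu>) - (\<Sum>\<mu>\<in>M. u \<mu>)" using insert.hyps by simp
  then have "u \<mu>0 \<in> J" using U.subspace_diff[OF sub insert.prems(2) U.subspace_sum[OF sub M]] by simp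
  then show ?case using M insert.prems(3) by blast
qed simp

lemma weight_bases_union:
  assumes J: "left_ideal J" and M: "finite M"
    and S: "\<And>\<mu>. \<mu> \<in> M \<Longrightarrow> S \<mu> \<subseteq> weight_sub J \<mu> \<and> finite (S \<mu>) \<and> U.indep_mod (S \<mu>) J"
  shows "U.indep_mod (\<Union>\<mu>\<in>M. S \<mu>) J" "card (\<Union>\<mu>\<in>M. S \<mu>) = (\<Sum>\<mu>\<in>M. card (S \<mu>))"
proof -
  note sub = left_ideal_subspace[OF J]
  have disj: "S \<mu> \<inter> S \<mu>' = {}" if "\<mu> \<in> M" "\<mu>' \<in> M" "\<mu> \<noteq> \<mu>'" for \<mu> \<mu>'
  proof (rule ccontr)
    assume "S \<mu> \<inter> S \<mu>' \<noteq> {}"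
    then obtain s where s: "s \<in> S \<mu>" "s \<in> S \<mu>'" by auto
    let ?u = "\<lambda>k. if k = \<mu> then s else - s"
    have "- s \<in> weight_sub J \<mu>'" using s(2) S[OF that(2)] U.subspace_neg[OF subspace_weight_sub[OF J]] by blast
    then have "?u k \<in> weight_sub J k" if "k \<in> {\<mu>, \<mu>'}" for k
      using that s(1) S[OF \<open>\<mu> \<in> M\<close>] \<open>\<mu> \<noteq> \<mu>'\<close> by auto
    moreover have "(\<Sum>k\<in>{\<mu>, \<mu>'}. ?u k) \<in> J" using that(3) U.subspace_0[OF sub] by simp
    ultimately have "?u \<mu> \<in> J" by (intro weights_independent[OF J, of "{\<mu>, \<mu>'}" ?u]) auto
    then show False using indep_mod_notin[OF sub] S[OF that(1)] s(1) by auto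
  qed
  then show "card (\<Union>\<mu>\<in>M. S \<mu>) = (\<Sum>\<mu>\<in>M. card (S \<mu>))"
    using M S by (intro card_UN_disjoint) auto
  show "U.indep_mod (\<Union>\<mu>\<in>M. S \<mu>) J"
    unfolding U.indep_mod_def
  proof (intro allI impI ballI)
    fix c s assume c: "(\<Sum>s\<in>(\<Union>\<mu>\<in>M. S \<mu>). cscale (c s) s) \<in> J" and s: "s \<in> (\<Union>\<mu>\<in>M. S \<mu>)"
    then obtain \<mu> where \<mu>: "\<mu> \<in> M" "s \<in> S \<mu>" by auto
    have "(\<Sum>s\<in>(\<Union>\<mu>\<in>M. S \<mu>). cscale (c s) s) = (\<Sum>\<mu>\<in>M. \<Sum>s\<in>S \<mu>. cscale (c s) s)"
      using M S disj by (intro sum.UNION_disjoint) auto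
    then have "(\<Sum>\<mu>\<in>M. \<Sum>s\<in>S \<mu>. cscale (c s) s) \<in> J" using c by simp
    then have "(\<Sum>s\<in>S \<mu>. cscale (c s) s) \<in> J"
    proof (rule weights_independent[OF J M, where u = "\<lambda>\<mu>. \<Sum>s\<in>S \<mu>. cscale (c s) s", rotated])
      show "(\<Sum>s\<in>S \<mu>'. cscale (c s) s) \<in> weight_sub J \<mu>'" if "\<mu>' \<in> M" for \<mu>'
        by (intro U.subspace_sum[OF subspace_weight_sub[OF J]] U.subspace_scale[OF subspace_weight_sub[OF J]])
           (use S[OF that] in auto)
    qed (rule \<mu>(1))
    then show "c s = 0" using S[OF \<mu>(1)] \<mu>(2) unfolding U.indep_mod_def by blast
  qed
qed

context fusion
begin

lemma card_confs: "card confs = (\<Prod>i<N. 4 * \<nu> i)"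
proof -
  have "{t :: state. snd (snd t) < n} = UNIV \<times> UNIV \<times> {..<n}" for n by auto
  then have "card {t :: state. snd (snd t) < n} = 4 * n" for n by (simp add: card_cartesian_product)
  then show ?thesis unfolding confs_def by (subst card_PiE) simp_all
qed

text \<open>The lower bounds for the single weight spaces add up to the upper bound for the module, and sums over
distinct weights are direct; hence equality holds everywhere.\<close>

lemma weight_multiplicities:
  defines "J \<equiv> left_ideal hull weyl_trunc_rels l1 (\<Sum>i<N. \<nu> i) N"
  assumes bound: "U.rdim UNIV J (\<Prod>i<N. 4 * \<nu> i)"
  shows "vectorspace.fin_dim C_field (U_quot J)" "vectorspace.dim C_field (U_quot J) = (\<Prod>i<N. 4 * \<nu> i)"
    "vectorspace.dim C_field (U_quot J\<lparr>carrier := weight_space (U_quot J) \<mu>\<rparr>) = card {\<sigma> \<in> confs. wt_conf \<sigma> = \<mu>}"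
proof -
  let ?P = "\<lambda>\<mu> S. S \<subseteq> weight_sub J \<mu> \<and> finite S \<and> U.indep_mod S J \<and> weight_sub J \<mu> \<subseteq> U.span (S \<union> J)"
  let ?D = "\<lambda>\<mu>. card {\<sigma> \<in> confs. wt_conf \<sigma> = \<mu>}"
  have J: "left_ideal J" unfolding J_def by (rule left_ideal_hull)
  note sub = left_ideal_subspace[OF J]
  have rel: "weyl_rels l1 (\<Sum>i<N. \<nu> i) \<subseteq> J"
    unfolding J_def using hull_subset[of "weyl_trunc_rels l1 (\<Sum>i<N. \<nu> i) N" left_ideal] by (auto simp: weyl_trunc_rels_def)
  have "\<exists>S. ?P \<mu> S" for \<mu>
    by (rule U.mod_basis_exists[OF sub U.rdim_mono[OF bound subset_UNIV subset_refl order_refl], of "weight_sub J \<mu>"]) blast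
  then obtain S where S: "\<And>\<mu>. ?P \<mu> (S \<mu>)" by metis
  have lower: "?D \<mu> \<le> card (S \<mu>)" for \<mu>
  proof (rule weight_lower_bound)
    show "finite (S \<mu>)" using S by blast
    fix ws assume ws: "hw + wt_word ws = \<mu>"
    have "wprod ws \<in> weight_sub J \<mu>"
      unfolding weight_sub_def using wprod_weight[OF J, of hw _ _ ws] weyl_relations(4)[OF J rel] ws
      by (simp add: hw_def)
    then show "wprod ws \<in> U.span (S \<mu> \<union> (left_ideal hull weyl_trunc_rels l1 (\<Sum>i<N. \<nu> i) N))"
      using S[of \<mu>] unfolding J_def by blast
  qed
  have upper: "(\<Sum>\<mu>\<in>M. card (S \<mu>)) \<le> (\<Prod>i<N. 4 * \<nu> i)" if M: "finite M" for M
  proof -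
    note B = weight_bases_union[OF J M, of S]
    have "card (\<Union>\<mu>\<in>M. S \<mu>) \<le> (\<Prod>i<N. 4 * \<nu> i)"
      by (rule U.indep_mod_card_le[OF sub _ _ subset_UNIV bound]) (use B(1) S M in auto)
    then show ?thesis using B(2) S by auto
  qed
  have total: "(\<Sum>\<mu>\<in>M. ?D \<mu>) = (\<Prod>i<N. 4 * \<nu> i)" if M: "finite M" "wt_conf ` confs \<subseteq> M" for M
  proof -
    have "card confs = (\<Sum>\<sigma>\<in>confs. 1)" by simp
    also have "\<dots> = (\<Sum>\<mu>\<in>M. \<Sum>\<sigma> | \<sigma> \<in> confs \<and> wt_conf \<sigma> = \<mu>. 1)"
      by (rule sum.group[symmetric, OF finite_confs M])
    finally show ?thesis using card_confs by simp
  qed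
  have eq: "card (S \<mu>) = ?D \<mu>" for \<mu>
  proof -
    let ?M = "insert \<mu> (wt_conf ` confs)"
    have fin: "finite ?M" using finite_confs by simp
    have "(\<Sum>\<mu>\<in>?M. card (S \<mu>)) \<le> (\<Sum>\<mu>\<in>?M. ?D \<mu>)" using upper[OF fin] total[OF fin subset_insertI] by simp
    moreover have "(\<Sum>\<mu>\<in>?M - {\<mu>}. ?D \<mu>) \<le> (\<Sum>\<mu>\<in>?M - {\<mu>}. card (S \<mu>))" by (intro sum_mono lower)
    ultimately have "card (S \<mu>) \<le> ?D \<mu>"
      using sum.remove[OF fin, of \<mu> ?D] sum.remove[OF fin, of \<mu> "\<lambda>\<mu>. card (S \<mu>)"] by simp
    then show ?thesis using lower[of \<mu>] by simp
  qed
  show "vectorspace.dim C_field (U_quot J\<lparr>carrier := weight_space (U_quot J) \<mu>\<rparr>) = ?D \<mu>"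
    unfolding weight_space_U_quot[OF J] eq[symmetric]
    by (rule dim_cosets(2)[OF J subspace_weight_sub[OF J]]) (use S in auto)
  obtain T where T: "T \<subseteq> UNIV" "finite T" "U.indep_mod T J" "UNIV \<subseteq> U.span (T \<union> J)" "card T \<le> (\<Prod>i<N. 4 * \<nu> i)"
    using U.mod_basis_exists[OF sub bound] by blast
  have "(\<Prod>i<N. 4 * \<nu> i) \<le> card T"
  proof -
    let ?M = "wt_conf ` confs"
    have fin: "finite ?M" using finite_confs by simp
    note B = weight_bases_union[OF J fin, of S]
    have rT: "U.rdim UNIV J (card T)" unfolding U.rdim_def using T by auto
    have "U.indep_mod (\<Union>\<mu>\<in>?M. S \<mu>) J" by (rule B(1)) (use S in blast)
    moreover have "finite (\<Union>\<mu>\<in>?M. S \<mu>)" by (rule finite_UN_I[OF fin]) (use S in blast)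
    ultimately have "card (\<Union>\<mu>\<in>?M. S \<mu>) \<le> card T"
      by (rule U.indep_mod_card_le[OF sub _ _ subset_UNIV rT, rotated])
    then show ?thesis using B(2) S eq total[OF fin subset_refl] by simp
  qed
  then have cT: "card T = (\<Prod>i<N. 4 * \<nu> i)" using T(5) by simp
  have V: "U_quot J\<lparr>carrier := (\<lambda>u. u +o J) ` UNIV\<rparr> = U_quot J" by (simp add: U_quot_def)
  note D = dim_cosets[OF J U.subspace_UNIV T(1,2,3,4), unfolded V]
  show "vectorspace.fin_dim C_field (U_quot J)" by (rule D(1))
  show "vectorspace.dim C_field (U_quot J) = (\<Prod>i<N. 4 * \<nu> i)" using D(2) cT by simp
qed

lemma ch_eq_sum_confs:
  assumes "U.rdim UNIV (left_ideal hull weyl_trunc_rels l1 (\<Sum>i<N. \<nu> i) N) (\<Prod>i<N. 4 * \<nu> i)"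
  shows "ch (Weyl_trunc l1 (\<Sum>i<N. \<nu> i) N) = (\<Sum>\<sigma>\<in>confs. fexp (wt_conf \<sigma>))"
proof -
  have "Poly_Mapping.lookup (\<Sum>\<sigma>\<in>confs. fexp (wt_conf \<sigma>)) \<mu> = int (card {\<sigma> \<in> confs. wt_conf \<sigma> = \<mu>})" for \<mu>
  proof -
    have "Poly_Mapping.lookup (\<Sum>\<sigma>\<in>confs. fexp (wt_conf \<sigma>)) \<mu> = (\<Sum>\<sigma>\<in>confs. if wt_conf \<sigma> = \<mu> then 1 else 0)"
      by (simp add: lookup_sum fexp_def lookup_single when_def eq_commute[of \<mu>])
    also have "\<dots> = int (card (confs \<inter> {\<sigma>. wt_conf \<sigma> = \<mu>}))"
      by (simp add: sum.If_cases finite_confs)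
    finally show ?thesis by (simp add: Int_def)
  qed
  then have "(\<lambda>\<mu>. int (vectorspace.dim C_field (Weyl_trunc l1 (\<Sum>i<N. \<nu> i) N\<lparr>carrier := weight_space (Weyl_trunc l1 (\<Sum>i<N. \<nu> i) N) \<mu>\<rparr>)))
      = Poly_Mapping.lookup (\<Sum>\<sigma>\<in>confs. fexp (wt_conf \<sigma>))"
    using weight_multiplicities(3)[OF assms] unfolding Weyl_trunc_def by (intro ext) simp
  then show ?thesis unfolding ch_def by (simp add: lookup_inverse)
qed

end

lemma fexp_add: "fexp (\<mu> + \<nu>) = fexp \<mu> * fexp \<nu>"
  by (simp add: fexp_def mult_single)

lemma fexp_0: "fexp 0 = 1"
  by (simp add: fexp_def)

lemma fexp_sum: "finite A \<Longrightarrow> fexp (\<Sum>i\<in>A. w i) = (\<Prod>i\<in>A. fexp (w i))"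
  by (induction A rule: finite_induct) (simp_all add: fexp_0 fexp_add)

text \<open>A telescoping sum: neighbouring weights of the string differ by \<open>(-1, -2)\<close>, as do the two exponents in the
factor.\<close>

lemma sl2_string:
  "(\<Sum>k<n. fexp (c - of_nat k, of_nat n - 1 - 2 * of_nat k)) * (fexp (1/2, 1) - fexp (-1/2, -1))
    = fexp (c + (1 - of_nat n) / 2, 0) * (fexp (of_nat n / 2, of_nat n) - fexp (- of_nat n / 2, - of_nat n))"
proof -
  define g where "g k = fexp (c + 1/2 - of_nat k, of_nat n - 2 * of_nat k)" for k :: nat
  have "fexp (c - of_nat k, of_nat n - 1 - 2 * of_nat k) * (fexp (1/2, 1) - fexp (-1/2, -1)) = g k - g (Suc k)" for k
    by (simp add: g_def right_diff_distrib fexp_add[symmetric] algebra_simps)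
  then have "(\<Sum>k<n. fexp (c - of_nat k, of_nat n - 1 - 2 * of_nat k)) * (fexp (1/2, 1) - fexp (-1/2, -1)) = (\<Sum>k<n. g k - g (Suc k))"
    by (simp add: sum_distrib_right)
  also have "\<dots> = g 0 - g n" by (rule sum_lessThan_telescope')
  also have "\<dots> = fexp (c + (1 - of_nat n) / 2, 0) * (fexp (of_nat n / 2, of_nat n) - fexp (- of_nat n / 2, - of_nat n))"
  proof -
    have "(c + 1/2 - of_nat 0, of_nat n - 2 * of_nat 0) = (c + (1 - of_nat n) / 2, 0) + (of_nat n / 2, of_nat n :: complex)"
      "(c + 1/2 - of_nat n, of_nat n - 2 * of_nat n) = (c + (1 - of_nat n) / 2, 0) + (- of_nat n / 2, - of_nat n :: complex)"
      by (simp_all add: field_simps)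
    then show ?thesis by (simp only: g_def right_diff_distrib fexp_add)
  qed
  finally show ?thesis .
qed

context fusion
begin

text \<open>The factor \<open>ch_Lambda\<close> comes from the two Grassmann generators, the rest is the character of the even top.\<close>

lemma site_character:
  "(\<Sum>t | snd (snd t) < \<nu> i. fexp (wt_state i t)) * (fexp (1/2, 1) - fexp (-1/2, -1))
    = fexp ((if i = 0 then l1 else 0) + (1 - of_nat (\<nu> i)) / 2, 0) * ch_Lambda
      * (fexp (of_nat (\<nu> i) / 2, of_nat (\<nu> i)) - fexp (- of_nat (\<nu> i) / 2, - of_nat (\<nu> i)))"
proof -
  define c where "c = (if i = 0 then l1 else 0)"
  let ?f = "\<lambda>k. fexp (c - of_nat k, of_nat (\<nu> i) - 1 - 2 * of_nat k)"
  have "{t :: state. snd (snd t) < \<nu> i} = UNIV \<times> UNIV \<times> {..<\<nu> i}" by auto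
  then have "(\<Sum>t | snd (snd t) < \<nu> i. fexp (wt_state i t))
      = (\<Sum>(a, b, k)\<in>UNIV \<times> UNIV \<times> {..<\<nu> i}. fexp (wt_state i (a, b, k)))"
    by (intro sum.cong) auto
  also have "\<dots> = (\<Sum>a\<in>UNIV. \<Sum>b\<in>UNIV. \<Sum>k<\<nu> i. fexp (wt_state i (a, b, k)))"
    by (simp only: sum.cartesian_product)
  also have "\<dots> = (\<Sum>a\<in>UNIV. \<Sum>b\<in>UNIV. \<Sum>k<\<nu> i. fexp (if b then -1 else 0, (if a then 1 else 0) - (if b then 1 else 0)) * ?f k)"
  proof (intro sum.cong refl)
    fix a b :: bool and k :: nat
    have "wt_state i (a, b, k) = (if b then -1 else 0, (if a then 1 else 0) - (if b then 1 else 0))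
        + (c - of_nat k, of_nat (\<nu> i) - 1 - 2 * of_nat k)"
      by (simp add: wt_state_def c_def)
    then show "fexp (wt_state i (a, b, k)) = fexp (if b then -1 else 0, (if a then 1 else 0) - (if b then 1 else 0)) * ?f k"
      by (simp only: fexp_add)
  qed
  also have "\<dots> = ch_Lambda * (\<Sum>k<\<nu> i. ?f k)"
    by (simp add: sum_distrib_left[symmetric] UNIV_bool ch_Lambda_def algebra_simps)
  finally show ?thesis unfolding c_def[symmetric] by (simp only: mult.assoc sl2_string) (simp only: mult_ac)
qed

lemma confs_character:
  "(\<Sum>\<sigma>\<in>confs. fexp (wt_conf \<sigma>)) * (fexp (1/2, 1) - fexp (-1/2, -1)) ^ N
    = fexp (l1 + (of_nat N - of_nat (\<Sum>i<N. \<nu> i)) / 2, 0) * ch_Lambda ^ N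
      * (\<Prod>i<N. fexp (of_nat (\<nu> i) / 2, of_nat (\<nu> i)) - fexp (- of_nat (\<nu> i) / 2, - of_nat (\<nu> i)))"
proof -
  let ?s = "\<lambda>i. (if i = 0 then l1 else 0) + (1 - of_nat (\<nu> i)) / 2 :: complex"
  have "(\<Sum>\<sigma>\<in>confs. fexp (wt_conf \<sigma>)) = (\<Prod>i<N. \<Sum>t | snd (snd t) < \<nu> i. fexp (wt_state i t))"
    unfolding confs_def wt_conf_def by (subst prod_sum_PiE) (simp_all add: finite_states fexp_sum)
  then have "(\<Sum>\<sigma>\<in>confs. fexp (wt_conf \<sigma>)) * (fexp (1/2, 1) - fexp (-1/2, -1)) ^ N
      = (\<Prod>i<N. (\<Sum>t | snd (snd t) < \<nu> i. fexp (wt_state i t)) * (fexp (1/2, 1) - fexp (-1/2, -1)))"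
    by (simp add: prod.distrib)
  also have "\<dots> = (\<Prod>i<N. fexp (?s i, 0)) * ch_Lambda ^ N
      * (\<Prod>i<N. fexp (of_nat (\<nu> i) / 2, of_nat (\<nu> i)) - fexp (- of_nat (\<nu> i) / 2, - of_nat (\<nu> i)))"
    unfolding site_character by (simp add: prod.distrib)
  also have "(\<Prod>i<N. fexp (?s i, 0)) = fexp (\<Sum>i<N. (?s i, 0))" by (simp add: fexp_sum)
  also have "(\<Sum>i<N. (?s i, 0)) = (\<Sum>i<N. ?s i, 0 :: complex)" by (simp add: prod_eq_iff fst_sum snd_sum)
  also have "(\<Sum>i<N. ?s i) = l1 + (of_nat N - of_nat (\<Sum>i<N. \<nu> i)) / 2"
    using N by (simp add: sum.distrib sum_divide_distrib[symmetric] sum_subtractf sum.delta)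
  finally show ?thesis .
qed

end

text \<open>The three parts are read off from \<open>weyl_trunc_hull\<close>, \<open>weight_multiplicities\<close> and \<open>confs_character\<close> for the
partition \<open>\<nu>\<close> of \<open>l2\<close> into \<open>m\<close> parts \<open>q + 1\<close> and \<open>N - m\<close> parts \<open>q\<close>.\<close>

theorem corollary5p7:
  fixes l1 :: complex and l2 N :: nat
  assumes "(l1, of_nat l2) \<in> Pplus"
  shows "(N \<ge> l2 \<longrightarrow> cmodule_iso (Weyl_trunc l1 l2 N) (Weyl l1 l2)) \<and>
    (\<forall>q m :: nat. N < l2 \<and> l2 = q * N + m \<and> m < N \<longrightarrow>
      vectorspace.fin_dim C_field (Weyl_trunc l1 l2 N) \<and>
      vectorspace.dim C_field (Weyl_trunc l1 l2 N) = 4 ^ N * q ^ (N - m) * (q + 1) ^ m) \<and>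
    (\<forall>q m :: nat. N < l2 \<and> l2 = q * N + m \<and> m < N \<longrightarrow>
      ch (Weyl_trunc l1 l2 N) * (fexp (1/2, 1) - fexp (-1/2, -1)) ^ N =
        fexp (l1 - of_nat (l2 - N) / 2, 0) * ch_Lambda ^ N
        * (fexp (of_nat q / 2, of_nat q) - fexp (- of_nat q / 2, - of_nat q)) ^ (N - m)
        * (fexp (of_nat (q + 1) / 2, of_nat (q + 1))
            - fexp (- of_nat (q + 1) / 2, - of_nat (q + 1))) ^ m)"
proof (intro conjI impI allI)
  show "cmodule_iso (Weyl_trunc l1 l2 N) (Weyl l1 l2)" if "l2 \<le> N"
    unfolding Weyl_trunc_def Weyl_def weyl_trunc_hull[OF assms that] by (rule cmodule_iso_refl)
  fix q m assume n: "N < l2 \<and> l2 = q * N + m \<and> m < N"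
  define \<nu> where "\<nu> i = (if i < m then q + 1 else q)" for i
  have q: "0 < q" using n by (cases q) auto
  interpret fusion N \<nu> l1 by unfold_locales (use n q in \<open>auto simp: \<nu>_def\<close>)
  have "\<nu> i = q + (if i < m then 1 else 0)" for i by (simp add: \<nu>_def)
  moreover have "{..<N} \<inter> {i. i < m} = {..<m}" using n by auto
  ultimately have l2: "(\<Sum>i<N. \<nu> i) = l2" using n by (simp add: sum.distrib sum.If_cases)
  have bound: "U.rdim UNIV (left_ideal hull weyl_trunc_rels l1 (\<Sum>i<N. \<nu> i) N) (\<Prod>i<N. 4 * \<nu> i)"
    unfolding l2 unfolding \<nu>_def using n q by (intro trunc_upper_bound) auto
  have dim: "(\<Prod>i<N. 4 * \<nu> i) = 4 ^ N * q ^ (N - m) * (q + 1) ^ m"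
    using prod_split_at[of m N "q + 1" q] n by (simp add: prod.distrib \<nu>_def mult_ac)
  note W = weight_multiplicities[OF bound, unfolded l2 dim, folded Weyl_trunc_def]
  show "vectorspace.fin_dim C_field (Weyl_trunc l1 l2 N)" by (rule W(1))
  show "vectorspace.dim C_field (Weyl_trunc l1 l2 N) = 4 ^ N * q ^ (N - m) * (q + 1) ^ m" by (rule W(2))
  let ?g = "\<lambda>k::nat. fexp (of_nat k / 2, of_nat k) - fexp (- of_nat k / 2, - of_nat k)"
  have "(\<Prod>i<N. ?g (\<nu> i)) = (\<Prod>i<N. if i < m then ?g (q + 1) else ?g q)"
    by (intro prod.cong refl) (simp only: \<nu>_def split: if_splits, simp)
  also have "\<dots> = ?g (q + 1) ^ m * ?g q ^ (N - m)" using n by (intro prod_split_at) simp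
  finally have g: "(\<Prod>i<N. ?g (\<nu> i)) = ?g q ^ (N - m) * ?g (q + 1) ^ m" by (simp only: mult.commute)
  have shift: "l1 + (of_nat N - of_nat l2) / 2 = l1 - of_nat (l2 - N) / 2"
    using n by (simp add: of_nat_diff field_simps)
  show "ch (Weyl_trunc l1 l2 N) * (fexp (1/2, 1) - fexp (-1/2, -1)) ^ N =
        fexp (l1 - of_nat (l2 - N) / 2, 0) * ch_Lambda ^ N
        * (fexp (of_nat q / 2, of_nat q) - fexp (- of_nat q / 2, - of_nat q)) ^ (N - m)
        * (fexp (of_nat (q + 1) / 2, of_nat (q + 1))
            - fexp (- of_nat (q + 1) / 2, - of_nat (q + 1))) ^ m"
    using ch_eq_sum_confs[OF bound] confs_character unfolding l2 g shift by (simp only: mult.assoc)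
qed

end
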